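(* Let $k=1$, let $h\in C([0,\infty);\mathbb{R})$ be fixed, let $z_0=(u_0,\rho_0)\in H^s\times H^{s-1}$ with $s=2$ or $s\ge3$, and let $T$ be the maximal existence time of the corresponding solution $z=(u,\rho)$ to the system (HS) with initial data $z_0$. If $\rho_0(x)\ne0$ for all $x\in\mathbb{S}$, then the solution $z$ exists globally in time, i.e. $T=\infty$.
   Context: Notation: $\mathbb{S}=\mathbb{R}/\mathbb{Z}$, $H^r=H^r(\mathbb{S})$; functions on $\mathbb{S}$ are identified with 1-periodic functions on $\mathbb{R}$; $\partial_x^{-1}g(x)=\int_0^x g(y)\,dy$. For $k\in\{1,-1\}$, the periodic two-component Hunter-Saxton system is $u_{txx}+2u_xu_{xx}+uu_{xxx}-k\rho\rho_x=0$, $\rho_t+(\rho u)_x=0$, with 1-periodic $u,\rho$ and initial data $(u_0,\rho_0)$. Its solutions are understood through the following integrated form, with an arbitrary but fixed $h\in C([0,\infty);\mathbb{R})$, called (HS): $$\begin{cases} u_t+uu_x=\partial_x^{-1}\left(\frac k2\rho^2+\frac12u_x^2+a\right)+h(t), & t>0,\ x\in\mathbb{R},\\ \rho_t+(\rho u)_x=0, & t>0,\ x\in\mathbb{R},\\ u(0,x)=u_0(x),\ \rho(0,x)=\rho_0(x), & x\in\mathbb{R},\\ u(t,x+1)=u(t,x),\ \rho(t,x+1)=\rho(t,x), & t\ge0,\ x\in\mathbb{R},\end{cases}$$ where $a=-\frac12\int_{\mathbb{S}}(k\rho_0^2+u_{0,x}^2)\,dx$. Known local well-posedness (used to define $T$):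 for $h\in C([0,\infty);\mathbb{R})$ and $z_0=(u_0,\rho_0)\in H^s\times H^{s-1}$ with $s\ge2$, there exist a maximal existence time $T\in(0,\infty]$ and a unique solution $z=(u,\rho)$ of (HS) with $z\in C([0,T);H^s\times H^{s-1})\cap C^1([0,T);H^{s-1}\times H^{s-2})$. *)

theory Defs
  imports "HOL-Analysis.Analysis"
begin

text \<open>Functions on the circle \<open>\<real>/\<int>\<close> are 1-periodic functions on \<open>\<real>\<close>, integrated over \<open>[0,1]\<close>.\<close>

definition periodic1 :: "(real \<Rightarrow> real) \<Rightarrow> bool" where
  "periodic1 f \<longleftrightarrow> (\<forall>x. f (x + 1) = f x)"

definition fourier_coeff :: "(real \<Rightarrow> real) \<Rightarrow> int \<Rightarrow> complex" where
  "fourier_coeff f n =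
     (LINT x:{0..1}|lebesgue. complex_of_real (f x) * cis (- (2 * pi * real_of_int n * x)))"

definition sobolev_term :: "real \<Rightarrow> (real \<Rightarrow> real) \<Rightarrow> int \<Rightarrow> real" where
  "sobolev_term r f n = (1 + (real_of_int n)\<^sup>2) powr r * (cmod (fourier_coeff f n))\<^sup>2"

text \<open>
  The space \<open>H\<^sup>r\<close> of the circle, for \<open>r \<ge> 0\<close> only (so that it is contained in \<open>L\<^sup>2\<close>).
  Its elements are functions rather than almost-everywhere classes.  For \<open>r > 1/2\<close> every
  class has a unique continuous representative, and that representative is the one in the set,
  so that point values are meaningful; for \<open>r \<le> 1/2\<close> functions that are equal almost
  everywhere have to be identified.
\<close>

definition sobolev :: "real \<Rightarrow> (real \<Rightarrow> real) set" where
  "sobolev r = {f. periodic1 f \<and> f \<in> borel_measurable lebesgue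
      \<and> set_integrable lebesgue {0..1} (\<lambda>x. (f x)\<^sup>2)
      \<and> sobolev_term r f summable_on UNIV
      \<and> (r > 1/2 \<longrightarrow> continuous_on UNIV f)}"

text \<open>Meaningful on \<open>sobolev r\<close> only: the infinite sum is 0 by convention if it diverges.\<close>

definition sobolev_norm :: "real \<Rightarrow> (real \<Rightarrow> real) \<Rightarrow> real" where
  "sobolev_norm r f = sqrt (\<Sum>\<^sub>\<infinity>n\<in>UNIV. sobolev_term r f n)"

definition time_interval :: "ereal \<Rightarrow> real set" where
  "time_interval T = {t. 0 \<le> t \<and> ereal t < T}"

text \<open>\<open>f \<in> C([0,T); H\<^sup>r)\<close>, where \<open>f t\<close> is the function of \<open>x\<close> at time \<open>t\<close>.\<close>

definition continuous_in_sobolev :: "ereal \<Rightarrow> real \<Rightarrow> (real \<Rightarrow> real \<Rightarrow> real) \<Rightarrow> bool" where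
  "continuous_in_sobolev T r f \<longleftrightarrow>
     (\<forall>t\<in>time_interval T. f t \<in> sobolev r
        \<and> ((\<lambda>\<tau>. sobolev_norm r (\<lambda>x. f \<tau> x - f t x)) \<longlongrightarrow> 0) (at t within time_interval T))"

text \<open>
  \<open>f \<in> C\<^sup>1([0,T); H\<^sup>r)\<close> with time derivative \<open>f'\<close>: the difference quotients converge in the
  norm of \<open>H\<^sup>r\<close>, with a one-sided derivative at time 0.
\<close>

definition C1_in_sobolev ::
  "ereal \<Rightarrow> real \<Rightarrow> (real \<Rightarrow> real \<Rightarrow> real) \<Rightarrow> (real \<Rightarrow> real \<Rightarrow> real) \<Rightarrow> bool" where
  "C1_in_sobolev T r f f' \<longleftrightarrow>
     continuous_in_sobolev T r f \<and> continuous_in_sobolev T r f'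
     \<and> (\<forall>t\<in>time_interval T.
          ((\<lambda>\<tau>. sobolev_norm r (\<lambda>x. (f \<tau> x - f t x) / (\<tau> - t) - f' t x)) \<longlongrightarrow> 0)
            (at t within time_interval T))"

definition smooth_periodic :: "(real \<Rightarrow> real) \<Rightarrow> bool" where
  "smooth_periodic \<phi> \<longleftrightarrow> periodic1 \<phi> \<and> (\<forall>n x. ((deriv ^^ n) \<phi>) field_differentiable (at x))"

text \<open>\<open>g\<close> is the weak (distributional) derivative of \<open>f\<close> on the circle.\<close>

definition weak_deriv :: "(real \<Rightarrow> real) \<Rightarrow> (real \<Rightarrow> real) \<Rightarrow> bool" where
  "weak_deriv f g \<longleftrightarrow> periodic1 g \<and> set_integrable lebesgue {0..1} g
     \<and> (\<forall>\<phi>. smooth_periodic \<phi> \<longrightarrow>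
          (LINT x:{0..1}|lebesgue. f x * deriv \<phi> x) = - (LINT x:{0..1}|lebesgue. g x * \<phi> x))"

text \<open>\<open>\<partial>\<^sub>x\<^sup>-\<^sup>1\<close>; the interval integral is oriented, so negative \<open>x\<close> are covered.\<close>

definition antideriv :: "(real \<Rightarrow> real) \<Rightarrow> real \<Rightarrow> real" where
  "antideriv g x = (LBINT y=ereal 0..ereal x. g y)"

definition HS_const :: "real \<Rightarrow> (real \<Rightarrow> real) \<Rightarrow> (real \<Rightarrow> real) \<Rightarrow> real" where
  "HS_const k u0 \<rho>0 = - (1/2) * (LINT x:{0..1}|lebesgue. k * (\<rho>0 x)\<^sup>2 + (deriv u0 x)\<^sup>2)"

text \<open>
  \<open>(u,\<rho>)\<close> solves the system on \<open>[0,T)\<close> and lies in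
  \<open>C([0,T); H\<^sup>s \<times> H\<^sup>s\<^sup>-\<^sup>1) \<inter> C\<^sup>1([0,T); H\<^sup>s\<^sup>-\<^sup>1 \<times> H\<^sup>s\<^sup>-\<^sup>2)\<close>, where \<open>s \<ge> 2\<close>.  Both sides of the first
  equation are continuous in \<open>x\<close> and \<open>u t\<close> is continuously differentiable, so that equation
  is read pointwise.  The second one is an identity in \<open>H\<^sup>s\<^sup>-\<^sup>2\<close>, which is only \<open>L\<^sup>2\<close> for \<open>s = 2\<close>;
  it is read almost everywhere, with a weak derivative.  Spatial periodicity is part of
  membership in \<open>sobolev\<close>.
\<close>

definition HS_solution ::
  "real \<Rightarrow> (real \<Rightarrow> real) \<Rightarrow> real \<Rightarrow> (real \<Rightarrow> real) \<Rightarrow> (real \<Rightarrow> real) \<Rightarrow> ereal \<Rightarrow>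
   (real \<Rightarrow> real \<Rightarrow> real) \<Rightarrow> (real \<Rightarrow> real \<Rightarrow> real) \<Rightarrow> bool" where
  "HS_solution k h s u0 \<rho>0 T u \<rho> \<longleftrightarrow>
     continuous_in_sobolev T s u \<and> continuous_in_sobolev T (s - 1) \<rho>
     \<and> u 0 = u0 \<and> \<rho> 0 = \<rho>0
     \<and> (\<exists>ut \<rho>t. C1_in_sobolev T (s - 1) u ut \<and> C1_in_sobolev T (s - 2) \<rho> \<rho>t
          \<and> (\<forall>t. 0 < t \<and> ereal t < T \<longrightarrow>
               (\<forall>x. ut t x + u t x * deriv (u t) x =
                  antideriv (\<lambda>y. k / 2 * (\<rho> t y)\<^sup>2 + 1 / 2 * (deriv (u t) y)\<^sup>2
                                 + HS_const k u0 \<rho>0) x + h t)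
               \<and> (\<exists>w. weak_deriv (\<lambda>x. \<rho> t x * u t x) w
                      \<and> (AE x in lebesgue. \<rho>t t x + w x = 0))))"

text \<open>
  \<open>T \<in> (0,\<infinity>]\<close> is the maximal existence time, for the regularity index \<open>s\<close>, and \<open>(u,\<rho>)\<close> is
  the corresponding solution on \<open>[0,T)\<close>.
\<close>

definition maximal_HS_solution ::
  "real \<Rightarrow> (real \<Rightarrow> real) \<Rightarrow> real \<Rightarrow> (real \<Rightarrow> real) \<Rightarrow> (real \<Rightarrow> real) \<Rightarrow> ereal \<Rightarrow>
   (real \<Rightarrow> real \<Rightarrow> real) \<Rightarrow> (real \<Rightarrow> real \<Rightarrow> real) \<Rightarrow> bool" where
  "maximal_HS_solution k h s u0 \<rho>0 T u \<rho> \<longleftrightarrow>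
     0 < T \<and> HS_solution k h s u0 \<rho>0 T u \<rho>
     \<and> (\<forall>T' u' \<rho>'. HS_solution k h s u0 \<rho>0 T' u' \<rho>' \<longrightarrow> T' \<le> T)"

end

theory Submission
  imports Defs
begin

text \<open>A maximal solution lives at least as long as every other solution with the same data, so it
suffices to produce one solution on all of \<open>[0,\<infinity>)\<close>.  For \<open>k = 1\<close> this can be done by an explicit
formula.  Let \<open>\<phi>\<close> be the flow of \<open>u\<close> and \<open>J\<close> its Jacobian.  Along the flow, \<open>Z = u\<^sub>x + \<i> \<rho>\<close>
satisfies the complex Riccati equation \<open>Z' = - Z\<^sup>2 / 2 - 2 c\<^sup>2\<close>, where \<open>4 c\<^sup>2\<close> is the integral of
\<open>u\<^sub>0'\<^sup>2 + \<rho>\<^sub>0\<^sup>2\<close>; hence \<open>Z = 2 w' / w\<close> with the harmonic oscillator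
\<open>w = cos (c t) + (u\<^sub>0' + \<i> \<rho>\<^sub>0) sin (c t) / (2 c)\<close>, and \<open>J\<close> is the squared modulus of \<open>w\<close>.  The real
part of \<open>w\<close> may vanish, but where it does the imaginary part does not, because \<open>\<rho>\<^sub>0\<close> has no
zero.  So \<open>J\<close> is bounded below by a positive constant, uniformly in space and time
(\<open>J_lower\<close>), the flow stays a diffeomorphism of the circle, and nothing blows up.

The Jacobian determines the flow up to a translation \<open>q t\<close>.  Since \<open>\<partial>\<^sub>x\<^sup>-\<^sup>1\<close> is normalised at the
Eulerian point 0, \<open>q\<close> solves a second-order equation \<open>q'' = h - M2 t (Y t (- q))\<close>, whose right-hand
side is globally Lipschitz in \<open>q\<close>; \<open>picard_second_order\<close> solves it for all times.  With the
inverse flow \<open>g\<close> the solution is \<open>u = \<phi>\<^sub>t \<circ> g\<close> and \<open>\<rho> = (\<rho>\<^sub>0 / J) \<circ> g\<close>.  The first equation is a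
pointwise identity (\<open>momentum_equation\<close>, from \<open>J_identity\<close>); time derivatives in Sobolev norms
are obtained from the Fourier coefficients, which become integrals over fixed labels after the
substitution \<open>y = \<phi> t x\<close> (\<open>fc_transport\<close>, \<open>sob_sq_difference_quotient\<close>).

It remains to see that these formulas define curves in \<open>H\<^sup>s\<close> for real \<open>s\<close>.  Write
\<open>s = k + 2 + \<sigma>\<close> with \<open>0 \<le> \<sigma> < 1\<close>.  A curve in \<open>H\<^bsup>m+\<sigma>\<^esup>\<close> is described by \<open>m\<close> successive derivatives of
absolutely continuous functions, the last of which is a continuous curve in \<open>H\<^bsup>\<sigma>\<^esup>\<close>
(\<open>sob_family\<close>).  Products, reciprocals and compositions with the inverse flow are then treated
by induction on \<open>m\<close>, and everything rests on the operators \<open>f \<mapsto> b \<cdot> (f \<circ> g)\<close> at the bottom level.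
They are bounded on \<open>L\<^sup>2\<close> and on \<open>H\<^sup>1\<close> by a change of variables, hence on \<open>H\<^bsup>\<sigma>\<^esup>\<close> by
\<open>interpolation\<close>, and they depend continuously on time because they do so on trigonometric
polynomials (\<open>sob_cont_weighted_composition\<close>).  The passage between Fourier coefficients and
functions is provided by \<open>riesz_fischer\<close> and \<open>parseval\<close>.\<close>

section \<open>Integrals of periodic functions\<close>

lemma abs_integrable_bound:
  fixes f :: "real \<Rightarrow> 'a::euclidean_space"
  assumes "f \<in> borel_measurable borel" "g integrable_on {a..b}"
    and "\<And>x. x \<in> {a..b} \<Longrightarrow> norm (f x) \<le> g x"
  shows "f absolutely_integrable_on {a..b}"
proof (rule measurable_bounded_by_integrable_imp_absolutely_integrable)
  show "f \<in> borel_measurable (lebesgue_on {a..b})"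
    using assms(1) by (intro measurable_restrict_space1 measurable_completion) auto
qed (use assms in auto)

lemma abs_integrable_continuous:
  fixes f :: "real \<Rightarrow> 'a::euclidean_space"
  assumes "continuous_on {a..b} f"
  shows "f absolutely_integrable_on {a..b}"
  using absolutely_integrable_continuous_real assms by blast

lemma abs_integrable_mult_bounded:
  fixes f g :: "real \<Rightarrow> real"
  assumes "f absolutely_integrable_on {a..b}" "continuous_on {a..b} g"
  shows "(\<lambda>x. g x * f x) absolutely_integrable_on {a..b}" "(\<lambda>x. f x * g x) absolutely_integrable_on {a..b}"
proof -
  have "bounded (g ` {a..b})"
    using assms(2) compact_continuous_image compact_imp_bounded by blast
  moreover have "g \<in> borel_measurable (lebesgue_on {a..b})"
    using assms(2) by (simp add: continuous_imp_measurable_on_sets_lebesgue)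
  ultimately show "(\<lambda>x. g x * f x) absolutely_integrable_on {a..b}"
    using assms(1) by (intro absolutely_integrable_bounded_measurable_product_real) auto
  then show "(\<lambda>x. f x * g x) absolutely_integrable_on {a..b}"
    by (simp add: mult.commute)
qed

lemma integral_translate:
  fixes f :: "real \<Rightarrow> 'a::euclidean_space"
  assumes "f absolutely_integrable_on {a+c..b+c}"
  shows "(\<lambda>x. f (x + c)) absolutely_integrable_on {a..b}"
    and "integral {a..b} (\<lambda>x. f (x + c)) = integral {a+c..b+c} f"
proof -
  have im: "(\<lambda>x. x + c) ` {a..b} = {a+c..b+c}"
    by (simp add: add.commute[of _ c])
  have "(\<lambda>x. \<bar>1\<bar> *\<^sub>R f (x + c)) absolutely_integrable_on {a..b} \<and>
      integral {a..b} (\<lambda>x. \<bar>1\<bar> *\<^sub>R f (x + c)) = integral {a+c..b+c} f"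
    using has_absolute_integral_change_of_variables_real[of "{a..b}" "\<lambda>x. x + c" "\<lambda>_. 1" f "integral {a+c..b+c} f"]
      assms im DERIV_subset[OF DERIV_add[OF DERIV_ident DERIV_const[of c]]] by auto
  then show "(\<lambda>x. f (x + c)) absolutely_integrable_on {a..b}"
    and "integral {a..b} (\<lambda>x. f (x + c)) = integral {a+c..b+c} f"
    by auto
qed

lemma periodic_of_int:
  fixes f :: "real \<Rightarrow> 'a"
  assumes "\<And>x. f (x + 1) = f x"
  shows "f (x + of_int k) = f x"
proof -
  have nat: "f (y + real n) = f y" for y n
  proof (induction n)
    case (Suc n)
    then show ?case using assms[of "y + real n"] by (simp add: add_ac)
  qed auto
  show ?thesis
  proof (cases "k \<ge> 0")
    case True
    then show ?thesis using nat[of x "nat k"] by simp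
  next
    case False
    then show ?thesis using nat[of "x + of_int k" "nat (-k)"] by simp
  qed
qed

text \<open>The interval is covered by finitely many translates of the fundamental domain.\<close>

lemma periodic_abs_integrable:
  fixes f :: "real \<Rightarrow> 'a::euclidean_space"
  assumes per: "\<And>x. f (x + 1) = f x" and int: "f absolutely_integrable_on {0..1}"
  shows "f absolutely_integrable_on {a..b}"
proof -
  have unit: "f absolutely_integrable_on {of_int k..of_int k + 1}" for k :: int
  proof -
    have "(\<lambda>x. f (x + of_int (-k))) absolutely_integrable_on {of_int k..of_int k+1}"
      using int by (intro integral_translate) auto
    then show ?thesis by (simp only: periodic_of_int[where f=f, OF per])
  qed
  have "f absolutely_integrable_on {of_int k..of_int k + real n}" for k n
  proof (induction n)
    case 0
    show ?case by (rule set_integrable_subset[OF unit[of k]]) auto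
  next
    case (Suc n)
    have "f absolutely_integrable_on {of_int k + real n..of_int k + real n + 1}"
      using unit[of "k + int n"] by simp
    with Suc have "f absolutely_integrable_on ({of_int k..of_int k + real n} \<union> {of_int k + real n..of_int k + real n + 1})"
      by (intro set_integrable_Un) auto
    moreover have "{of_int k..of_int k + real n} \<union> {of_int k + real n..of_int k + real n + 1}
       = {of_int k..of_int k + real (Suc n)}" by auto
    ultimately show ?case by simp
  qed
  from this[of "\<lfloor>a\<rfloor>" "nat (\<lceil>b\<rceil> - \<lfloor>a\<rfloor>)"]
  show ?thesis
  proof (rule absolutely_integrable_on_subinterval)
    show "{a..b} \<subseteq> {of_int \<lfloor>a\<rfloor>..of_int \<lfloor>a\<rfloor> + real (nat (\<lceil>b\<rceil> - \<lfloor>a\<rfloor>))}"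
    proof
      fix x assume "x \<in> {a..b}"
      then have x: "a \<le> x" "x \<le> b" by auto
      have "b \<le> of_int \<lceil>b\<rceil>" "of_int \<lfloor>a\<rfloor> \<le> a" by auto
      moreover have "of_int \<lceil>b\<rceil> \<le> of_int \<lfloor>a\<rfloor> + real (nat (\<lceil>b\<rceil> - \<lfloor>a\<rfloor>))" by linarith
      ultimately show "x \<in> {of_int \<lfloor>a\<rfloor>..of_int \<lfloor>a\<rfloor> + real (nat (\<lceil>b\<rceil> - \<lfloor>a\<rfloor>))}"
        using x unfolding atLeastAtMost_iff by linarith
    qed
  qed
qed

text \<open>The window \<open>[a, a+1]\<close> is cut at the integer inside it, and the part to the right of the cut is
moved back by one period.\<close>

lemma periodic_integral:
  fixes f :: "real \<Rightarrow> 'a::euclidean_space"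
  assumes per: "\<And>x. f (x + 1) = f x" and int: "f absolutely_integrable_on {0..1}"
  shows "integral {a..a+1} f = integral {0..1} f"
proof -
  note I = set_lebesgue_integral_eq_integral(1)[OF periodic_abs_integrable[OF per int]]
  define k where "k = \<lfloor>a\<rfloor>"
  have k: "of_int k \<le> a" "a \<le> of_int k + 1" unfolding k_def by linarith+
  have 1: "integral {of_int k + 1..a + 1} f = integral {of_int k..a} f"
    using integral_translate(2)[where f=f and a="of_int k" and c=1 and b=a] periodic_abs_integrable[OF per int] per by simp
  have 2: "integral {0..1} f = integral {of_int k..of_int k + 1} f"
    using integral_translate(2)[where f=f and a=0 and c="of_int k" and b=1] periodic_abs_integrable[OF per int] per
    by (simp add: periodic_of_int add.commute)
  have "integral {a..a+1} f = integral {a..of_int k + 1} f + integral {of_int k + 1..a + 1} f"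
    using k I by (intro Henstock_Kurzweil_Integration.integral_combine[symmetric]) auto
  moreover have "integral {of_int k..of_int k + 1} f = integral {of_int k..a} f + integral {a..of_int k + 1} f"
    using k I by (intro Henstock_Kurzweil_Integration.integral_combine[symmetric]) auto
  ultimately show ?thesis using 1 2 by simp
qed

section \<open>Absolutely continuous functions\<close>

text \<open>Absolute continuity on the line, with a chosen representative \<open>f'\<close> of the derivative.  The
integral form, rather than differentiability almost everywhere, is what survives products,
reciprocals and changes of variables and what pairs with Fourier coefficients.\<close>

definition ac_deriv :: "(real \<Rightarrow> real) \<Rightarrow> (real \<Rightarrow> real) \<Rightarrow> bool" where
  "ac_deriv f f' \<longleftrightarrow>
     (\<forall>a b. a \<le> b \<longrightarrow> f' absolutely_integrable_on {a..b} \<and> f b - f a = integral {a..b} f')"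

lemma ac_derivD:
  assumes "ac_deriv f f'"
  shows "f' absolutely_integrable_on {a..b}" "f' integrable_on {a..b}"
    "a \<le> b \<Longrightarrow> f b - f a = integral {a..b} f'" "a \<le> b \<Longrightarrow> integral {a..b} f' = f b - f a"
proof -
  show "f' absolutely_integrable_on {a..b}"
    using assms unfolding ac_deriv_def by (cases "a \<le> b") auto
  then show "f' integrable_on {a..b}" using set_lebesgue_integral_eq_integral(1) by blast
qed (use assms in \<open>auto simp: ac_deriv_def\<close>)

lemma ac_deriv_continuous:
  assumes "ac_deriv f f'" shows "continuous_on S f"
proof -
  have "isCont f x" for x
  proof -
    have "continuous_on {x-1..x+1} (\<lambda>y. f (x - 1) + integral {x-1..y} f')"
      by (intro continuous_intros indefinite_integral_continuous_1 ac_derivD[OF assms])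
    moreover have "f (x - 1) + integral {x-1..y} f' = f y" if "y \<in> {x-1..x+1}" for y
      using ac_derivD(3)[OF assms, of "x-1" y] that by auto
    ultimately have "continuous_on {x-1..x+1} f" by (rule continuous_on_eq)
    then have "continuous_on {x-1<..<x+1} f" by (rule continuous_on_subset) auto
    then show ?thesis by (simp add: continuous_on_eq_continuous_at)
  qed
  then show ?thesis by (simp add: continuous_at_imp_continuous_on)
qed

lemma ac_deriv_C1:
  assumes "\<And>x. (f has_real_derivative f' x) (at x)" "continuous_on UNIV f'"
  shows "ac_deriv f f'"
  unfolding ac_deriv_def
proof (intro allI impI conjI)
  fix a b :: real assume ab: "a \<le> b"
  show "f' absolutely_integrable_on {a..b}"
    by (intro abs_integrable_continuous continuous_on_subset[OF assms(2)]) auto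
  have "(f' has_integral (f b - f a)) {a..b}"
    using ab by (intro fundamental_theorem_of_calculus)
      (auto simp: has_real_derivative_iff_has_vector_derivative[symmetric] intro: has_field_derivative_at_within assms(1))
  then show "f b - f a = integral {a..b} f'" by (simp add: integral_unique)
qed

lemma ac_deriv_imp_C1:
  assumes "ac_deriv f f'" "continuous_on UNIV f'"
  shows "(f has_real_derivative f' x) (at x)"
proof -
  have "((\<lambda>y. integral {x-1..y} f') has_real_derivative f' x) (at x within {x-1..x+1})"
    by (intro integral_has_real_derivative continuous_on_subset[OF assms(2)]) auto
  then have "((\<lambda>y. integral {x-1..y} f') has_real_derivative f' x) (at x)"
    by (subst (asm) at_within_interior) auto
  then have "((\<lambda>y. f (x-1) + integral {x-1..y} f') has_real_derivative f' x) (at x)"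
    by (auto intro!: derivative_eq_intros)
  moreover have "\<forall>\<^sub>F y in nhds x. f (x-1) + integral {x-1..y} f' = f y"
  proof -
    have "\<forall>\<^sub>F y in nhds x. y \<in> {x-1<..}" by (rule eventually_nhds_in_open) auto
    then show ?thesis by eventually_elim (use ac_derivD(3)[OF assms(1)] in \<open>smt (verit) greaterThan_iff\<close>)
  qed
  ultimately show ?thesis by (subst (asm) DERIV_cong_ev[OF refl _ refl]) auto
qed

lemma ac_deriv_add:
  assumes "ac_deriv f f'" "ac_deriv g g'"
  shows "ac_deriv (\<lambda>x. f x + g x) (\<lambda>x. f' x + g' x)"
  unfolding ac_deriv_def
  using ac_derivD[OF assms(1)] ac_derivD[OF assms(2)]
  by (auto simp: Henstock_Kurzweil_Integration.integral_add intro!: set_integral_add)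

lemma ac_deriv_cmult:
  assumes "ac_deriv f f'"
  shows "ac_deriv (\<lambda>x. c * f x) (\<lambda>x. c * f' x)"
  unfolding ac_deriv_def
  using ac_derivD[OF assms]
  by (auto simp: right_diff_distrib[symmetric] intro!: set_integrable_mult_right)

lemma ac_deriv_diff:
  assumes "ac_deriv f f'" "ac_deriv g g'"
  shows "ac_deriv (\<lambda>x. f x - g x) (\<lambda>x. f' x - g' x)"
  using ac_deriv_add[OF assms(1) ac_deriv_cmult[OF assms(2), of "-1"]] by simp

lemma ac_deriv_const: "ac_deriv (\<lambda>x. c) (\<lambda>x. 0)"
  unfolding ac_deriv_def by (auto simp: absolutely_integrable_on_def)

text \<open>A local-to-global principle: the defect \<open>f b - f a - integral {a..b} h\<close> is additive in the
interval, so a bound by \<open>e\<close> times another additive quantity need only be checked on short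
intervals.  As \<open>e\<close> is arbitrary the defect vanishes.  Product and reciprocal rules follow
by freezing the continuous factors at the end points of a short interval.\<close>

lemma ac_deriv_local:
  assumes h: "\<And>a b. h absolutely_integrable_on {a..b}"
    and w: "\<And>a b. w integrable_on {a..b}"
    and loc: "\<And>x e. e > 0 \<Longrightarrow> \<exists>d>0. \<forall>a b. a \<le> x \<and> x \<le> b \<and> b - a < d \<longrightarrow>
              \<bar>f b - f a - integral {a..b} h\<bar> \<le> e * integral {a..b} w"
  shows "ac_deriv f h"
  unfolding ac_deriv_def
proof (intro allI impI conjI h)
  fix a b :: real assume ab: "a \<le> b"
  have hi: "h integrable_on {a..b}" for a b using h set_lebesgue_integral_eq_integral(1) by blast
  have bd: "\<bar>f b - f a - integral {a..b} h\<bar> \<le> e * integral {a..b} w" if "e > 0" for e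
    using ab
  proof (induction rule: Bolzano)
    case (trans a b c)
    have "integral {a..c} h = integral {a..b} h + integral {b..c} h"
      using trans hi by (intro Henstock_Kurzweil_Integration.integral_combine[symmetric]) auto
    moreover have "integral {a..c} w = integral {a..b} w + integral {b..c} w"
      using trans w by (intro Henstock_Kurzweil_Integration.integral_combine[symmetric]) auto
    ultimately show ?case using trans(1,2) by (simp add: distrib_left)
  next
    case (local x)
    show ?case using loc[OF that, of x] .
  qed
  show "f b - f a = integral {a..b} h"
  proof (rule ccontr)
    assume "f b - f a \<noteq> integral {a..b} h"
    then have p: "\<bar>f b - f a - integral {a..b} h\<bar> > 0" (is "?d > 0") by auto
    have W: "?d \<le> 1 * integral {a..b} w" using bd[of 1] by auto
    then have "integral {a..b} w > 0" using p by linarith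
    then have "?d \<le> (?d / (2 * integral {a..b} w)) * integral {a..b} w" using p by (intro bd) auto
    also have "\<dots> = ?d / 2" using \<open>integral {a..b} w > 0\<close> by simp
    finally show False using p by argo
  qed
qed

lemma integral_norm_bound_real:
  fixes f g :: "real \<Rightarrow> real"
  assumes "f integrable_on {a..b}" "g integrable_on {a..b}" "\<And>x. x \<in> {a..b} \<Longrightarrow> \<bar>f x\<bar> \<le> g x"
  shows "\<bar>integral {a..b} f\<bar> \<le> integral {a..b} g"
  using integral_norm_bound_integral[OF assms(1,2)] assms(3) by auto

lemma ac_deriv_mult:
  assumes f: "ac_deriv f f'" and g: "ac_deriv g g'"
  shows "ac_deriv (\<lambda>x. f x * g x) (\<lambda>x. f' x * g x + f x * g' x)"
proof -
  note cf = ac_deriv_continuous[OF f] and cg = ac_deriv_continuous[OF g]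
  let ?h = "\<lambda>x. f' x * g x + f x * g' x" and ?w = "\<lambda>x. \<bar>f' x\<bar> + \<bar>g' x\<bar>"
  have h: "?h absolutely_integrable_on {a..b}" for a b
    by (intro set_integral_add abs_integrable_mult_bounded ac_derivD[OF f] ac_derivD[OF g] cf cg)
  have w: "?w integrable_on {a..b}" for a b
    using ac_derivD(1)[OF f] ac_derivD(1)[OF g]
    by (intro integrable_add) (auto simp: absolutely_integrable_on_def)
  show ?thesis
  proof (rule ac_deriv_local[OF h w])
    fix x e :: real assume e: "e > 0"
    from cf[of UNIV] cg[of UNIV] have "isCont f x" "isCont g x" by (auto simp: continuous_on_eq_continuous_at)
    then obtain d1 d2 where d: "d1 > 0" "d2 > 0" "\<And>y. \<bar>y - x\<bar> < d1 \<Longrightarrow> \<bar>f y - f x\<bar> < e/2"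
       "\<And>y. \<bar>y - x\<bar> < d2 \<Longrightarrow> \<bar>g y - g x\<bar> < e/2"
      using half_gt_zero[OF e] unfolding continuous_at_eps_delta dist_real_def by fast
    show "\<exists>d>0. \<forall>a b. a \<le> x \<and> x \<le> b \<and> b - a < d \<longrightarrow>
              \<bar>f b * g b - f a * g a - integral {a..b} ?h\<bar> \<le> e * integral {a..b} ?w"
    proof (intro exI[of _ "min d1 d2"] conjI allI impI)
      fix a b assume ab: "a \<le> x \<and> x \<le> b \<and> b - a < min d1 d2"
      then have le: "a \<le> b" by simp
      let ?k = "\<lambda>z. f b * g' z + g a * f' z"
      have ki: "?k integrable_on {a..b}"
        by (intro integrable_add integrable_on_mult_right ac_derivD[OF f] ac_derivD[OF g])
      have hi: "?h integrable_on {a..b}" using h set_lebesgue_integral_eq_integral(1) by blast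
      have "integral {a..b} ?k = f b * (g b - g a) + g a * (f b - f a)"
        using ac_derivD[OF f] ac_derivD[OF g] le
        by (subst Henstock_Kurzweil_Integration.integral_add) (auto intro!: integrable_on_mult_right)
      also have "\<dots> = f b * g b - f a * g a" by (simp add: algebra_simps)
      finally have "\<bar>f b * g b - f a * g a - integral {a..b} ?h\<bar> = \<bar>integral {a..b} (\<lambda>z. ?k z - ?h z)\<bar>"
        using ki hi by (simp add: Henstock_Kurzweil_Integration.integral_diff)
      also have "\<dots> \<le> integral {a..b} (\<lambda>z. e * ?w z)"
      proof (rule integral_norm_bound_real)
        show "(\<lambda>z. ?k z - ?h z) integrable_on {a..b}" using ki hi by (intro integrable_diff)
        show "(\<lambda>z. e * ?w z) integrable_on {a..b}" using w by (intro integrable_on_mult_right)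
        fix z assume z: "z \<in> {a..b}"
        have nx: "\<bar>y - x\<bar> < d1" "\<bar>y - x\<bar> < d2" if "y \<in> {a..b}" for y using that ab by auto
        have 1: "\<bar>f b - f z\<bar> \<le> e" using d(3)[OF nx(1), of b] d(3)[OF nx(1), of z] z le unfolding atLeastAtMost_iff by argo
        have 2: "\<bar>g a - g z\<bar> \<le> e" using d(4)[OF nx(2), of a] d(4)[OF nx(2), of z] z le unfolding atLeastAtMost_iff by argo
        have "?k z - ?h z = (f b - f z) * g' z + (g a - g z) * f' z" by (simp add: algebra_simps)
        also have "\<bar>\<dots>\<bar> \<le> \<bar>f b - f z\<bar> * \<bar>g' z\<bar> + \<bar>g a - g z\<bar> * \<bar>f' z\<bar>"
          using abs_triangle_ineq by (simp add: abs_mult[symmetric])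
        also have "\<dots> \<le> e * \<bar>g' z\<bar> + e * \<bar>f' z\<bar>"
          using 1 2 by (intro add_mono mult_right_mono) auto
        finally show "\<bar>?k z - ?h z\<bar> \<le> e * ?w z" by (simp add: algebra_simps)
      qed
      also have "\<dots> = e * integral {a..b} ?w" by simp
      finally show "\<bar>f b * g b - f a * g a - integral {a..b} ?h\<bar> \<le> e * integral {a..b} ?w" .
    qed (use d(1,2) in auto)
  qed
qed

lemma ac_deriv_inverse:
  assumes f: "ac_deriv f f'" and nz: "\<And>x. f x \<noteq> 0"
  shows "ac_deriv (\<lambda>x. inverse (f x)) (\<lambda>x. - (f' x * (inverse (f x))\<^sup>2))"
proof -
  note cf = ac_deriv_continuous[OF f]
  have ci: "continuous_on S (\<lambda>x. inverse (f x))" for S by (intro continuous_intros cf) (use nz in auto)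
  define i where "i = (\<lambda>x. inverse (f x))"
  have ci: "continuous_on S i" for S unfolding i_def by (rule ci)
  let ?h = "\<lambda>x. - (f' x * (i x)\<^sup>2)" and ?w = "\<lambda>x. \<bar>f' x\<bar>"
  have h: "?h absolutely_integrable_on {a..b}" for a b
    using abs_integrable_mult_bounded(2)[OF ac_derivD(1)[OF f], of a b "\<lambda>x. - (i x)\<^sup>2"]
      continuous_on_minus[OF continuous_on_power[OF ci]] by simp
  have w: "?w integrable_on {a..b}" for a b
    using ac_derivD(1)[OF f] by (auto simp: absolutely_integrable_on_def)
  have "ac_deriv i ?h"
  proof (rule ac_deriv_local[OF h w])
    fix x e :: real assume e: "e > 0"
    (* K bounds 1/f near x, and e / (4 K) makes the two terms of the final estimate e/2 each. *)
    define K where "K = \<bar>i x\<bar> + 1"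
    have K: "K > 0" unfolding K_def by linarith
    have ix: "isCont i x" using ci[of UNIV] by (auto simp: continuous_on_eq_continuous_at)
    have "e / (4 * K) > 0" using e K by simp
    then have "min 1 (e / (4 * K)) > 0" by simp
    then obtain d1 where d: "d1 > 0" "\<And>y. \<bar>y - x\<bar> < d1 \<Longrightarrow> \<bar>i y - i x\<bar> < min 1 (e / (4 * K))"
      using ix unfolding continuous_at_eps_delta dist_real_def by fast
    show "\<exists>d>0. \<forall>a b. a \<le> x \<and> x \<le> b \<and> b - a < d \<longrightarrow>
              \<bar>i b - i a - integral {a..b} ?h\<bar> \<le> e * integral {a..b} ?w"
    proof (intro exI[of _ d1] conjI allI impI)
      fix a b assume ab: "a \<le> x \<and> x \<le> b \<and> b - a < d1"
      then have le: "a \<le> b" by simp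
      let ?k = "\<lambda>z. - (i a * i b) * f' z"
      have ki: "?k integrable_on {a..b}"
        by (intro integrable_on_mult_right ac_derivD[OF f])
      have hi: "?h integrable_on {a..b}" using h set_lebesgue_integral_eq_integral(1) by blast
      have "integral {a..b} ?k = - (i a * i b) * (f b - f a)"
        using ac_derivD(4)[OF f le] by simp
      also have "\<dots> = i b - i a" using nz[of a] nz[of b] by (simp add: field_simps i_def)
      finally have "\<bar>i b - i a - integral {a..b} ?h\<bar> = \<bar>integral {a..b} (\<lambda>z. ?k z - ?h z)\<bar>"
        using ki hi by (simp only: Henstock_Kurzweil_Integration.integral_diff)
      also have "\<dots> \<le> integral {a..b} (\<lambda>z. e * ?w z)"
      proof (rule integral_norm_bound_real)
        show "(\<lambda>z. ?k z - ?h z) integrable_on {a..b}" using ki hi by (intro integrable_diff)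
        show "(\<lambda>z. e * ?w z) integrable_on {a..b}" using w by (intro integrable_on_mult_right)
        fix z assume z: "z \<in> {a..b}"
        have near: "\<bar>i y - i z\<bar> \<le> e / (2*K)" "\<bar>i y\<bar> \<le> K" if "y \<in> {a..b}" for y
        proof -
          have "\<bar>i y - i x\<bar> < min 1 (e / (4*K))" "\<bar>i z - i x\<bar> < min 1 (e / (4*K))"
            using d(2)[of y] d(2)[of z] ab z that by auto
          moreover have "e / (2*K) = e/(4*K) + e/(4*K)" by (simp add: field_simps)
          ultimately show "\<bar>i y - i z\<bar> \<le> e / (2*K)" by argo
          show "\<bar>i y\<bar> \<le> K" using \<open>\<bar>i y - i x\<bar> < min 1 (e / (4*K))\<close> unfolding K_def by linarith
        qed
        have "\<bar>(i z)\<^sup>2 - i a * i b\<bar> = \<bar>i z * (i z - i a) + i a * (i z - i b)\<bar>"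
          by (simp add: algebra_simps power2_eq_square)
        also have "\<dots> \<le> \<bar>i z\<bar> * \<bar>i a - i z\<bar> + \<bar>i a\<bar> * \<bar>i b - i z\<bar>"
          unfolding abs_mult[symmetric] abs_minus_commute[of "i a"] abs_minus_commute[of "i b"]
          using abs_triangle_ineq[of "i z * (i z - i a)" "i a * (i z - i b)"] by (simp add: abs_mult)
        also have "\<dots> \<le> K * (e/(2*K)) + K * (e/(2*K))"
          by (intro add_mono mult_mono near) (use z le K in auto)
        also have "\<dots> = e" using K by simp
        finally have "\<bar>((i z)\<^sup>2 - i a * i b) * f' z\<bar> \<le> e * \<bar>f' z\<bar>"
          unfolding abs_mult by (intro mult_right_mono) auto
        then show "\<bar>?k z - ?h z\<bar> \<le> e * ?w z" by (simp add: algebra_simps)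
      qed
      also have "\<dots> = e * integral {a..b} ?w" by simp
      finally show "\<bar>i b - i a - integral {a..b} ?h\<bar> \<le> e * integral {a..b} ?w" .
    qed (rule d(1))
  qed
  then show ?thesis by (simp add: i_def)
qed

lemma strict_mono_of_pos_deriv:
  fixes g \<gamma> :: "real \<Rightarrow> real"
  assumes g: "\<And>x. (g has_real_derivative \<gamma> x) (at x)" and pos: "\<And>x. \<gamma> x > 0"
  shows "strict_mono g"
proof (rule strict_monoI)
  fix x y :: real assume "x < y"
  then show "g x < g y" by (rule DERIV_pos_imp_increasing) (use g pos in auto)
qed

text \<open>A change of variables for an increasing diffeomorphism that needs no regularity of the
integrand, and for complex values as well.\<close>

lemma integral_substitution_increasing:
  fixes f :: "real \<Rightarrow> 'a::euclidean_space" and g \<gamma> :: "real \<Rightarrow> real"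
  assumes g: "\<And>x. (g has_real_derivative \<gamma> x) (at x)" and pos: "\<And>x. \<gamma> x > 0"
    and f: "f absolutely_integrable_on {g a..g b}" and "a \<le> b"
  shows "(\<lambda>x. \<gamma> x *\<^sub>R f (g x)) absolutely_integrable_on {a..b}"
    and "integral {a..b} (\<lambda>x. \<gamma> x *\<^sub>R f (g x)) = integral {g a..g b} f"
proof -
  have mono: "strict_mono g"
    by (rule strict_mono_of_pos_deriv[OF g pos])
  have cont: "continuous_on {a..b} g" using g by (meson DERIV_isCont continuous_at_imp_continuous_on)
  have im: "g ` {a..b} = {g a..g b}"
  proof
    show "g ` {a..b} \<subseteq> {g a..g b}" using mono by (auto simp: strict_mono_less_eq)
    show "{g a..g b} \<subseteq> g ` {a..b}"
    proof
      fix y assume "y \<in> {g a..g b}"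
      then show "y \<in> g ` {a..b}" using IVT'[of g a y b] cont assms(4) by auto
    qed
  qed
  have gw: "(g has_real_derivative \<gamma> x) (at x within S)" for x S
    using g by (rule has_field_derivative_at_within)
  have "(\<lambda>x. \<bar>\<gamma> x\<bar> *\<^sub>R f (g x)) absolutely_integrable_on {a..b} \<and>
      integral {a..b} (\<lambda>x. \<bar>\<gamma> x\<bar> *\<^sub>R f (g x)) = integral {g a..g b} f"
    using has_absolute_integral_change_of_variables_real[of "{a..b}" g \<gamma> f "integral {g a..g b} f"]
      f im strict_mono_imp_inj_on[OF mono] gw by auto
  moreover have "\<bar>\<gamma> x\<bar> = \<gamma> x" for x using pos[of x] by simp
  ultimately show "(\<lambda>x. \<gamma> x *\<^sub>R f (g x)) absolutely_integrable_on {a..b}"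
    and "integral {a..b} (\<lambda>x. \<gamma> x *\<^sub>R f (g x)) = integral {g a..g b} f" by auto
qed

lemma ac_deriv_compose:
  assumes f: "ac_deriv f f'" and g: "\<And>x. (g has_real_derivative \<gamma> x) (at x)" and pos: "\<And>x. \<gamma> x > 0"
  shows "ac_deriv (\<lambda>x. f (g x)) (\<lambda>x. f' (g x) * \<gamma> x)"
  unfolding ac_deriv_def
proof (intro allI impI conjI)
  fix a b :: real assume ab: "a \<le> b"
  have mono: "strict_mono g"
    by (rule strict_mono_of_pos_deriv[OF g pos])
  then have le: "g a \<le> g b" using ab by (simp add: strict_mono_less_eq)
  note * = integral_substitution_increasing[OF g pos ac_derivD(1)[OF f] ab]
  show "(\<lambda>x. f' (g x) * \<gamma> x) absolutely_integrable_on {a..b}" using *(1) by (simp add: mult.commute)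
  show "f (g b) - f (g a) = integral {a..b} (\<lambda>x. f' (g x) * \<gamma> x)"
    using *(2) ac_derivD(3)[OF f le] by (simp add: mult.commute)
qed

section \<open>Fourier coefficients of functions on the circle\<close>

abbreviation fc where "fc \<equiv> fourier_coeff"

definition circle_integrable :: "(real \<Rightarrow> real) \<Rightarrow> bool" where
  "circle_integrable f \<longleftrightarrow> f \<in> borel_measurable borel \<and> f absolutely_integrable_on {0..1}"

lemma abs_integrable_imp:
  fixes f :: "real \<Rightarrow> 'a::euclidean_space"
  shows "f absolutely_integrable_on S \<Longrightarrow> f integrable_on S"
  by (rule set_lebesgue_integral_eq_integral(1))

lemma circle_integrable_add: "circle_integrable f \<Longrightarrow> circle_integrable g \<Longrightarrow> circle_integrable (\<lambda>x. f x + g x)"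
  unfolding circle_integrable_def by (auto intro: set_integral_add)

lemma circle_integrable_cmult: "circle_integrable f \<Longrightarrow> circle_integrable (\<lambda>x. c * f x)"
  unfolding circle_integrable_def by (auto intro: set_integrable_mult_right)

lemma circle_integrable_mult_continuous:
  assumes "circle_integrable f" "continuous_on UNIV g" shows "circle_integrable (\<lambda>x. f x * g x)"
  using assms continuous_on_subset[OF assms(2) subset_UNIV] unfolding circle_integrable_def
  by (intro conjI borel_measurable_times abs_integrable_mult_bounded(2)) (auto intro: borel_measurable_continuous_onI)

lemma circle_integrable_continuous: "continuous_on UNIV f \<Longrightarrow> circle_integrable f"
  unfolding circle_integrable_def
  by (auto intro!: borel_measurable_continuous_onI abs_integrable_continuous intro: continuous_on_subset)

lemma circle_integrable_integrable: "circle_integrable f \<Longrightarrow> f integrable_on {0..1}"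
  unfolding circle_integrable_def using abs_integrable_imp by blast

text \<open>Real trigonometric functions of frequency \<open>k\<close>, with amplitude and phase encoded in one complex
coefficient.  Working with real functions matches \<open>fourier_coeff\<close>, which accepts only these.\<close>

definition trig_mode :: "complex \<Rightarrow> int \<Rightarrow> real \<Rightarrow> real" where
  "trig_mode a k x = Re (a * cis (2 * pi * real_of_int k * x))"

lemma trig_mode_cos_sin: "trig_mode a k x = Re a * cos (2 * pi * real_of_int k * x) - Im a * sin (2 * pi * real_of_int k * x)"
  by (simp add: trig_mode_def)

lemma trig_mode_continuous: "continuous_on S (trig_mode a k)"
  unfolding trig_mode_cos_sin[abs_def] by (intro continuous_intros)

lemma trig_mode_periodic: "trig_mode a k (x + 1) = trig_mode a k x"
proof -
  have "cis (2 * pi * real_of_int k * x + 2 * pi * real_of_int k) = cis (2 * pi * real_of_int k * x) * cis (2 * pi * real_of_int k)"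
    by (rule cis_mult[symmetric])
  also have "cis (2 * pi * real_of_int k) = 1" by (rule cis_multiple_2pi) simp
  finally show ?thesis by (simp add: trig_mode_def distrib_left)
qed

text \<open>Splitting into real and imaginary part reduces many later computations to real integrals.\<close>

lemma fc_eq_Complex:
  assumes "circle_integrable f"
  shows "fc f n = Complex (integral {0..1} (\<lambda>x. f x * cos (2 * pi * real_of_int n * x)))
       (- integral {0..1} (\<lambda>x. f x * sin (2 * pi * real_of_int n * x)))"
proof -
  let ?g = "\<lambda>x. complex_of_real (f x) * cis (- (2 * pi * real_of_int n * x))"
  have cm: "cis \<in> borel_measurable borel"
    by (intro borel_measurable_continuous_onI continuous_intros)
  have "?g absolutely_integrable_on {0..1}"
  proof (rule abs_integrable_bound[where g = "\<lambda>x. \<bar>f x\<bar>"])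
    have [measurable]: "f \<in> borel_measurable borel" using assms unfolding circle_integrable_def by simp
    show "?g \<in> borel_measurable borel"
      by (intro borel_measurable_times measurable_compose[OF _ cm]) measurable
    show "(\<lambda>x. \<bar>f x\<bar>) integrable_on {0..1}"
      using assms unfolding circle_integrable_def absolutely_integrable_on_def by auto
  qed (simp add: norm_mult)
  then have gi: "?g integrable_on {0..1}" and eq: "fc f n = integral {0..1} ?g"
    using set_lebesgue_integral_eq_integral[of "{0..1}" ?g] unfolding fourier_coeff_def by auto
  have "Re (integral {0..1} ?g) = integral {0..1} (\<lambda>x. f x * cos (2 * pi * real_of_int n * x))"
    using integral_linear[OF gi bounded_linear_Re] by (simp add: o_def)
  moreover have "Im (integral {0..1} ?g) = integral {0..1} (\<lambda>x. - (f x * sin (2 * pi * real_of_int n * x)))"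
    using integral_linear[OF gi bounded_linear_Im] by (simp add: o_def)
  ultimately show ?thesis using eq by (simp add: complex_eq_iff)
qed

lemma circle_integrable_cos_sin:
  assumes "circle_integrable f"
  shows "(\<lambda>x. f x * cos (c * x)) integrable_on {0..1}"
    "(\<lambda>x. f x * sin (c * x)) integrable_on {0..1}" "(\<lambda>x. f x * trig_mode a k x) integrable_on {0..1}"
  by (intro circle_integrable_integrable circle_integrable_mult_continuous assms continuous_intros trig_mode_continuous)+

lemma integral_trig_mode:
  assumes "circle_integrable f"
  shows "integral {0..1} (\<lambda>x. f x * trig_mode a k x) = Re (a * cnj (fc f k))"
proof -
  have "integral {0..1} (\<lambda>x. f x * trig_mode a k x) = integral {0..1} (\<lambda>x. Re a * (f x * cos (2 * pi * real_of_int k * x)) - Im a * (f x * sin (2 * pi * real_of_int k * x)))"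
    by (simp add: trig_mode_cos_sin algebra_simps)
  also have "\<dots> = Re a * integral {0..1} (\<lambda>x. f x * cos (2 * pi * real_of_int k * x)) - Im a * integral {0..1} (\<lambda>x. f x * sin (2 * pi * real_of_int k * x))"
    using circle_integrable_cos_sin[OF assms, of "2 * pi * real_of_int k"]
    by (subst Henstock_Kurzweil_Integration.integral_diff) (auto intro!: integrable_on_mult_right)
  finally show ?thesis by (simp add: fc_eq_Complex[OF assms])
qed

lemma fc_add:
  assumes "circle_integrable f" "circle_integrable g"
  shows "fc (\<lambda>x. f x + g x) n = fc f n + fc g n"
  using circle_integrable_cos_sin[OF assms(1)] circle_integrable_cos_sin[OF assms(2)]
  by (simp add: fc_eq_Complex circle_integrable_add assms complex_eq_iff distrib_right Henstock_Kurzweil_Integration.integral_add)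

lemma fc_cmult:
  assumes "circle_integrable f"
  shows "fc (\<lambda>x. c * f x) n = of_real c * fc f n"
  by (simp add: fc_eq_Complex circle_integrable_cmult assms complex_eq_iff mult.assoc)

lemma fc_diff:
  assumes "circle_integrable f" "circle_integrable g"
  shows "fc (\<lambda>x. f x - g x) n = fc f n - fc g n"
  using fc_add[OF assms(1) circle_integrable_cmult[OF assms(2), of "-1"]] fc_cmult[OF assms(2), of "-1"] by simp

lemma circle_integrable_diff: "circle_integrable f \<Longrightarrow> circle_integrable g \<Longrightarrow> circle_integrable (\<lambda>x. f x - g x)"
  using circle_integrable_add[OF _ circle_integrable_cmult[of g "-1"]] by simp

lemma fc_minus:
  assumes "circle_integrable f" shows "fc f (- n) = cnj (fc f n)"
  using integral_trig_mode[OF assms, of 1 n] by (simp add: fc_eq_Complex assms complex_eq_iff)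

lemma fc_sum:
  assumes "finite A" "\<And>i. i \<in> A \<Longrightarrow> circle_integrable (F i)"
  shows "circle_integrable (\<lambda>x. \<Sum>i\<in>A. F i x) \<and> fc (\<lambda>x. \<Sum>i\<in>A. F i x) n = (\<Sum>i\<in>A. fc (F i) n)"
  using assms
proof (induction A rule: finite_induct)
  case empty
  have "circle_integrable (\<lambda>x. 0)" by (intro circle_integrable_continuous continuous_intros)
  then show ?case by (simp add: fc_eq_Complex complex_eq_iff)
next
  case (insert i A)
  then show ?case by (simp add: fc_add circle_integrable_add)
qed

lemma integral_trig_mode_1: "integral {0..1} (trig_mode a k) = (if k = 0 then Re a else 0)"
proof (cases "k = 0")
  case False
  define w where "w = 2 * pi * real_of_int k"
  have w: "w \<noteq> 0" using False by (simp add: w_def)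
  have z: "cos w = 1" "sin w = 0" unfolding w_def
    using cos_int_2pin[of k] sin_int_2pin[of k] by (simp_all add: mult_ac)
  let ?F = "\<lambda>x. (Re a * sin (w * x) + Im a * cos (w * x)) / w"
  have "((\<lambda>x. Re a * cos (w * x) - Im a * sin (w * x)) has_integral ?F 1 - ?F 0) {0..1}"
    by (rule fundamental_theorem_of_calculus)
      (auto intro!: derivative_eq_intros simp: has_real_derivative_iff_has_vector_derivative[symmetric] w field_simps)
  then have "(trig_mode a k has_integral 0) {0..1}"
    using z w unfolding w_def trig_mode_cos_sin[abs_def] by simp
  then show ?thesis using False by (simp add: integral_unique)
qed (simp add: trig_mode_def[abs_def])

lemma trig_mode_mult: "trig_mode a k x * trig_mode b m x = (trig_mode (a*b) (k+m) x + trig_mode (a * cnj b) (k-m) x) / 2"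
proof -
  have 1: "cis (2 * pi * real_of_int (k+m) * x) = cis (2 * pi * real_of_int k * x) * cis (2 * pi * real_of_int m * x)"
    "cis (2 * pi * real_of_int (k-m) * x) = cis (2 * pi * real_of_int k * x) * cnj (cis (2 * pi * real_of_int m * x))"
    by (simp_all add: cis_mult cis_cnj algebra_simps)
  have 2: "Re u * Re v = (Re (u * v) + Re (u * cnj v)) / 2" for u v by simp
  show ?thesis unfolding trig_mode_def 2 1 by (simp add: mult_ac)
qed

lemma circle_integrable_tw: "circle_integrable (trig_mode a k)"
  by (intro circle_integrable_continuous trig_mode_continuous)

text \<open>A complex number is determined by its real inner products with \<open>1\<close> and \<open>\<i>\<close>, so the coefficient
can be read off from integrals of products of two modes.\<close>

lemma fc_trig_mode: "fc (trig_mode a k) m = ((if m = k then a else 0) + (if m = -k then cnj a else 0)) / 2"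
proof -
  have *: "Re (b * cnj (fc (trig_mode a k) m)) = Re (b * cnj (((if m = k then a else 0) + (if m = -k then cnj a else 0)) / 2))" for b
  proof -
    have "Re (b * cnj (fc (trig_mode a k) m)) = integral {0..1} (\<lambda>x. trig_mode a k x * trig_mode b m x)"
      by (simp add: integral_trig_mode circle_integrable_tw)
    also have "\<dots> = (integral {0..1} (trig_mode (a*b) (k+m)) + integral {0..1} (trig_mode (a*cnj b) (k-m))) / 2"
      unfolding trig_mode_mult using circle_integrable_integrable[OF circle_integrable_tw]
      by (simp add: Henstock_Kurzweil_Integration.integral_add)
    also have "\<dots> = Re (b * cnj (((if m = k then a else 0) + (if m = -k then cnj a else 0)) / 2))"
      unfolding integral_trig_mode_1 by (auto simp: algebra_simps add_eq_0_iff)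
    finally show ?thesis .
  qed
  from *[of 1] *[of \<i>] show ?thesis by (simp add: complex_eq_iff)
qed

text \<open>A symmetric partial sum; it is a real function by construction, and for a \<open>hermitian\<close> sequence
it has exactly the coefficients \<open>a\<close> up to frequency \<open>N\<close>.\<close>

definition trig_poly :: "nat \<Rightarrow> (int \<Rightarrow> complex) \<Rightarrow> real \<Rightarrow> real" where
  "trig_poly N a x = (\<Sum>k\<in>{- int N..int N}. trig_mode (a k) k x)"

definition hermitian :: "(int \<Rightarrow> complex) \<Rightarrow> bool" where
  "hermitian a \<longleftrightarrow> (\<forall>k. a (- k) = cnj (a k))"

lemma hermitian_fc: "circle_integrable f \<Longrightarrow> hermitian (fc f)"
  by (simp add: hermitian_def fc_minus)

lemma trig_poly_continuous: "continuous_on S (trig_poly N a)"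
  unfolding trig_poly_def[abs_def] by (intro continuous_intros trig_mode_continuous)

lemma trig_poly_periodic: "trig_poly N a (x + 1) = trig_poly N a x"
  by (simp add: trig_poly_def trig_mode_periodic)

lemma circle_integrable_trig_poly: "circle_integrable (trig_poly N a)"
  by (intro circle_integrable_continuous trig_poly_continuous)

lemma fc_trig_poly:
  assumes "hermitian a"
  shows "fc (trig_poly N a) m = (if \<bar>m\<bar> \<le> int N then a m else 0)"
proof -
  have "fc (trig_poly N a) m = (\<Sum>k\<in>{-int N..int N}. fc (trig_mode (a k) k) m)"
    unfolding trig_poly_def[abs_def] by (rule fc_sum[THEN conjunct2]) (auto intro: circle_integrable_tw)
  also have "\<dots> = (\<Sum>k\<in>{-int N..int N}. if m = k then a k / 2 else 0) + (\<Sum>k\<in>{-int N..int N}. if - m = k then cnj (a k) / 2 else 0)"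
    unfolding sum.distrib[symmetric] fc_trig_mode by (intro sum.cong) (auto simp: add_divide_distrib)
  also have "\<dots> = (if \<bar>m\<bar> \<le> int N then a m else 0)"
    using assms[unfolded hermitian_def, rule_format, of m]
    by (auto simp: abs_le_iff)
  finally show ?thesis .
qed

lemma integral_trig_poly:
  assumes "circle_integrable f"
  shows "integral {0..1} (\<lambda>x. f x * trig_poly N a x) = (\<Sum>k\<in>{-int N..int N}. Re (a k * cnj (fc f k)))"
proof -
  have "integral {0..1} (\<lambda>x. f x * trig_poly N a x) = integral {0..1} (\<lambda>x. \<Sum>k\<in>{-int N..int N}. f x * trig_mode (a k) k x)"
    by (simp add: trig_poly_def sum_distrib_left)
  also have "\<dots> = (\<Sum>k\<in>{-int N..int N}. integral {0..1} (\<lambda>x. f x * trig_mode (a k) k x))"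
    by (rule Henstock_Kurzweil_Integration.integral_sum) (auto intro: circle_integrable_cos_sin assms)
  finally show ?thesis by (simp add: integral_trig_mode assms)
qed

lemma integral_trig_poly_sq:
  assumes "hermitian a"
  shows "integral {0..1} (\<lambda>x. (trig_poly N a x)\<^sup>2) = (\<Sum>k\<in>{-int N..int N}. (cmod (a k))\<^sup>2)"
proof -
  have "integral {0..1} (\<lambda>x. (trig_poly N a x)\<^sup>2) = (\<Sum>k\<in>{-int N..int N}. Re (a k * cnj (fc (trig_poly N a) k)))"
    unfolding power2_eq_square by (rule integral_trig_poly[OF circle_integrable_trig_poly])
  also have "\<dots> = (\<Sum>k\<in>{-int N..int N}. (cmod (a k))\<^sup>2)"
    by (intro sum.cong) (auto simp: fc_trig_poly assms abs_le_iff complex_mult_cnj cmod_power2)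
  finally show ?thesis .
qed

text \<open>Square integrable functions on the circle, as honest Borel functions.  Borel measurability is
stable under composition with continuous maps, which Lebesgue measurability is not.\<close>

definition L2fun :: "(real \<Rightarrow> real) \<Rightarrow> bool" where
  "L2fun f \<longleftrightarrow> periodic1 f \<and> f \<in> borel_measurable borel \<and> (\<lambda>x. (f x)\<^sup>2) integrable_on {0..1}"

lemma abs_mult_le_squares: "\<bar>x * y\<bar> \<le> (x\<^sup>2 + y\<^sup>2) / (2::real)"
  using sum_squares_bound[of "\<bar>x\<bar>" "\<bar>y\<bar>"] by (simp add: abs_mult)

lemma L2fun_mult:
  assumes "L2fun f" "L2fun g" shows "circle_integrable (\<lambda>x. f x * g x)"
  unfolding circle_integrable_def
proof
  have [measurable]: "f \<in> borel_measurable borel" "g \<in> borel_measurable borel"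
    using assms by (auto simp: L2fun_def)
  show m: "(\<lambda>x. f x * g x) \<in> borel_measurable borel" by measurable
  show "(\<lambda>x. f x * g x) absolutely_integrable_on {0..1}"
  proof (rule abs_integrable_bound[OF m])
    show "(\<lambda>x. ((f x)\<^sup>2 + (g x)\<^sup>2) / 2) integrable_on {0..1}"
      using assms by (intro integrable_on_divide integrable_add) (auto simp: L2fun_def)
  qed (use abs_mult_le_squares in auto)
qed

lemma L2fun_continuous:
  assumes "continuous_on UNIV f" "periodic1 f" shows "L2fun f"
  unfolding L2fun_def using assms
  by (auto intro!: borel_measurable_continuous_onI integrable_continuous_interval continuous_intros intro: continuous_on_subset)

lemma L2fun_circle_integrable: "L2fun f \<Longrightarrow> circle_integrable f"
  using L2fun_mult[of f "\<lambda>_. 1"] L2fun_continuous[of "\<lambda>_. 1"] by (simp add: periodic1_def)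

lemma L2fun_sq: "L2fun f \<Longrightarrow> (\<lambda>x. (f x)\<^sup>2) integrable_on {0..1}"
  by (simp add: L2fun_def)

lemma L2fun_add:
  assumes "L2fun f" "L2fun g" shows "L2fun (\<lambda>x. f x + g x)"
  unfolding L2fun_def
proof (intro conjI)
  show "(\<lambda>x. (f x + g x)\<^sup>2) integrable_on {0..1}"
    unfolding power2_sum using L2fun_sq[OF assms(1)] L2fun_sq[OF assms(2)] circle_integrable_integrable[OF L2fun_mult[OF assms]]
      integrable_on_mult_right[of "\<lambda>x. f x * g x" "{0..1}" 2]
    by (intro integrable_add) (auto simp: mult.assoc)
qed (use assms in \<open>auto simp: L2fun_def periodic1_def\<close>)

lemma L2fun_cmult: "L2fun f \<Longrightarrow> L2fun (\<lambda>x. c * f x)"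
  unfolding L2fun_def periodic1_def power_mult_distrib by (auto intro: integrable_on_mult_right)

lemma L2fun_diff: "L2fun f \<Longrightarrow> L2fun g \<Longrightarrow> L2fun (\<lambda>x. f x - g x)"
  using L2fun_add[OF _ L2fun_cmult[of g "-1"]] by simp

lemma L2fun_trig_poly: "L2fun (trig_poly N a)"
  by (intro L2fun_continuous trig_poly_continuous) (simp add: periodic1_def trig_poly_periodic)

text \<open>The best approximation identity: the error splits into the tail of \<open>f\<close> and the distance of the
coefficients.  It yields Bessel's inequality and, in the proof of Riesz--Fischer, the norm
of the limit.\<close>

lemma integral_diff_trig_poly_sq:
  assumes f: "L2fun f" and a: "hermitian a"
  shows "integral {0..1} (\<lambda>x. (f x - trig_poly N a x)\<^sup>2) =
     integral {0..1} (\<lambda>x. (f x)\<^sup>2) - (\<Sum>k\<in>{-int N..int N}. (cmod (fc f k))\<^sup>2)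
       + (\<Sum>k\<in>{-int N..int N}. (cmod (a k - fc f k))\<^sup>2)"
proof -
  let ?P = "trig_poly N a"
  have id: "(cmod z)\<^sup>2 - 2 * Re (z * cnj c) = (cmod (z - c))\<^sup>2 - (cmod c)\<^sup>2" for z c
    unfolding cmod_power2 by (simp add: power2_eq_square algebra_simps)
  have i: "(\<lambda>x. (f x)\<^sup>2) integrable_on {0..1}" "(\<lambda>x. (?P x)\<^sup>2) integrable_on {0..1}" "(\<lambda>x. f x * ?P x) integrable_on {0..1}"
    using f L2fun_trig_poly by (auto intro: L2fun_sq circle_integrable_integrable L2fun_mult)
  have "integral {0..1} (\<lambda>x. (f x - ?P x)\<^sup>2) = integral {0..1} (\<lambda>x. ((f x)\<^sup>2 + (?P x)\<^sup>2) - 2 * (f x * ?P x))"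
    by (intro integral_cong) (simp add: power2_diff)
  also have "\<dots> = integral {0..1} (\<lambda>x. (f x)\<^sup>2) + integral {0..1} (\<lambda>x. (?P x)\<^sup>2) - 2 * integral {0..1} (\<lambda>x. f x * ?P x)"
    using i by (simp add: Henstock_Kurzweil_Integration.integral_diff Henstock_Kurzweil_Integration.integral_add integrable_add)
  also have "\<dots> = integral {0..1} (\<lambda>x. (f x)\<^sup>2) + (\<Sum>k\<in>{-int N..int N}. (cmod (a k))\<^sup>2 - 2 * Re (a k * cnj (fc f k)))"
    by (simp add: integral_trig_poly L2fun_circle_integrable f integral_trig_poly_sq a sum_subtractf sum_distrib_left)
  also have "(\<Sum>k\<in>{-int N..int N}. (cmod (a k))\<^sup>2 - 2 * Re (a k * cnj (fc f k))) =
     (\<Sum>k\<in>{-int N..int N}. (cmod (a k - fc f k))\<^sup>2 - (cmod (fc f k))\<^sup>2)"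
    by (intro sum.cong refl id)
  finally show ?thesis by (simp add: sum_subtractf)
qed

lemma bessel_interval:
  assumes f: "L2fun f"
  shows "(\<Sum>k\<in>{-int N..int N}. (cmod (fc f k))\<^sup>2) \<le> integral {0..1} (\<lambda>x. (f x)\<^sup>2)"
proof -
  have "0 \<le> integral {0..1} (\<lambda>x. (f x - trig_poly N (fc f) x)\<^sup>2)"
    by (intro Henstock_Kurzweil_Integration.integral_nonneg L2fun_sq L2fun_diff f L2fun_trig_poly) auto
  then show ?thesis using integral_diff_trig_poly_sq[OF f hermitian_fc[OF L2fun_circle_integrable[OF f]], of N] by simp
qed

lemma finite_int_bounded:
  fixes F :: "int set" assumes "finite F" obtains N where "F \<subseteq> {- int N..int N}"
proof
  show "F \<subseteq> {- int (nat (sum abs F))..int (nat (sum abs F))}"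
  proof
    fix k assume k: "k \<in> F"
    have "\<bar>k\<bar> \<le> sum abs F"
      by (rule member_le_sum[OF k]) (use assms in auto)
    then show "k \<in> {- int (nat (sum abs F))..int (nat (sum abs F))}" by auto
  qed
qed

lemma filterlim_int_intervals: "filterlim (\<lambda>N. {- int N..int N}) (finite_subsets_at_top UNIV) sequentially"
  unfolding filterlim_finite_subsets_at_top
proof (intro allI impI)
  fix X :: "int set" assume "finite X \<and> X \<subseteq> UNIV"
  then obtain N where N: "X \<subseteq> {- int N..int N}" using finite_int_bounded by blast
  show "\<forall>\<^sub>F y in sequentially. finite {- int y..int y} \<and> X \<subseteq> {- int y..int y} \<and> {- int y..int y} \<subseteq> UNIV"
    using eventually_ge_at_top[of N] by eventually_elim (use N in force)
qed

lemma summable_int_bounded: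
  fixes g :: "int \<Rightarrow> real"
  assumes "\<And>k. 0 \<le> g k" "\<And>N. (\<Sum>k\<in>{-int N..int N}. g k) \<le> B"
  shows "g summable_on UNIV"
proof (rule nonneg_bdd_above_summable_on)
  show "bdd_above (sum g ` {F. F \<subseteq> UNIV \<and> finite F})"
  proof (rule bdd_aboveI[of _ B], clarsimp)
    fix F :: "int set" assume "finite F"
    then obtain N where N: "F \<subseteq> {- int N..int N}" using finite_int_bounded by blast
    have "sum g F \<le> (\<Sum>k\<in>{-int N..int N}. g k)" by (rule sum_mono2) (use N assms in auto)
    then show "sum g F \<le> B" using assms(2)[of N] by linarith
  qed
qed (use assms in auto)

lemma has_sum_int_intervals:
  fixes g :: "int \<Rightarrow> real"
  assumes "(g has_sum S) UNIV"
  shows "(\<lambda>N. \<Sum>k\<in>{-int N..int N}. g k) \<longlonglongrightarrow> S"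
  using filterlim_compose[OF assms[unfolded has_sum_def] filterlim_int_intervals] by simp

lemma L2fun_summable: "L2fun f \<Longrightarrow> (\<lambda>n. (cmod (fc f n))\<^sup>2) summable_on UNIV"
  by (rule summable_int_bounded[OF _ bessel_interval]) auto

section \<open>Uniqueness of Fourier coefficients\<close>

text \<open>The linear span of the modes, described inductively so that closure under products and
orthogonality to a function with vanishing coefficients are simple inductions.\<close>

inductive trig_function :: "(real \<Rightarrow> real) \<Rightarrow> bool" where
  trig_function_tw: "trig_function (trig_mode a k)"
| trig_function_add: "trig_function p \<Longrightarrow> trig_function q \<Longrightarrow> trig_function (\<lambda>x. p x + q x)"

lemma trig_function_mult_tw: "trig_function q \<Longrightarrow> trig_function (\<lambda>x. trig_mode a k x * q x)"
proof (induction q rule: trig_function.induct)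
  case (trig_function_tw b m)
  have half: "trig_mode (c/2) j x = trig_mode c j x / 2" for c j x by (simp add: trig_mode_def)
  have "trig_mode a k x * trig_mode b m x = trig_mode (a*b/2) (k+m) x + trig_mode (a * cnj b/2) (k-m) x" for x
    unfolding trig_mode_mult using half[of "a*b"] half[of "a * cnj b"] by simp
  then show ?case using trig_function.trig_function_add[OF trig_function.trig_function_tw[of "a*b/2" "k+m"] trig_function.trig_function_tw[of "a*cnj b/2" "k-m"]] by presburger
next
  case (trig_function_add p q)
  then show ?case using trig_function.trig_function_add by (simp add: distrib_left)
qed

lemma trig_function_mult: "trig_function p \<Longrightarrow> trig_function q \<Longrightarrow> trig_function (\<lambda>x. p x * q x)"
proof (induction p rule: trig_function.induct)
  case (trig_function_tw a k)
  then show ?case by (rule trig_function_mult_tw)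
next
  case (trig_function_add p q)
  then show ?case using trig_function.trig_function_add by (simp add: distrib_right)
qed

lemma real_polynomial_cis:
  "real_polynomial_function g \<Longrightarrow> trig_function (\<lambda>x. g (cis (2 * pi * x)))"
proof (induction g rule: real_polynomial_function.induct)
  case (linear h)
  interpret bounded_linear h by fact
  have "h (cis (2 * pi * x)) = trig_mode (Complex (h 1) (- h \<i>)) 1 x" for x
  proof -
    have "cis (2 * pi * x) = cos (2 * pi * x) *\<^sub>R 1 + sin (2 * pi * x) *\<^sub>R \<i>"
      by (simp add: complex_eq_iff)
    then show ?thesis by (simp only: add scaleR) (simp add: trig_mode_cos_sin)
  qed
  then show ?case by (simp add: trig_function_tw)
next
  case (const c)
  have "c = trig_mode (of_real c) 0 x" for x by (simp add: trig_mode_def)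
  then show ?case using trig_function_tw[of "of_real c" 0] by presburger
qed (auto intro: trig_function_add trig_function_mult)

lemma cis_eq_periodic:
  assumes "periodic1 f" "cis (2 * pi * x) = cis (2 * pi * y)" shows "f x = f y"
proof -
  have "sin (2 * pi * x) = sin (2 * pi * y) \<and> cos (2 * pi * x) = cos (2 * pi * y)"
    using assms(2) by (simp add: complex_eq_iff)
  then obtain n where "2 * pi * x = 2 * pi * y + 2 * pi * real_of_int n"
    using sin_cos_eq_iff by blast
  then have "2 * pi * x = 2 * pi * (y + real_of_int n)" by (simp add: distrib_left)
  then have "x = y + of_int n" by simp
  then show ?thesis using periodic_of_int[of f y n] assms(1) by (simp add: periodic1_def)
qed

lemma cis_Arg_circle: "cmod z = 1 \<Longrightarrow> cis (Arg z) = z"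
  using Arg_eq[of z] by (simp add: cis_conv_exp mult.commute) (metis norm_zero zero_neq_one)

text \<open>Stone--Weierstrass on the unit circle in the plane: polynomials in the coordinates become
trigonometric functions.  The function is transported to the circle with the argument; at the
cut of \<open>Arg\<close> continuity is seen by using the argument of \<open>- z\<close> instead.\<close>

lemma trig_approx:
  assumes f: "continuous_on UNIV f" "periodic1 f" and e: "e > 0"
  shows "\<exists>p. trig_function p \<and> (\<forall>x. \<bar>f x - p x\<bar> < e)"
proof -
  define F where "F z = f (Arg z / (2 * pi))" for z
  have F_cis: "F (cis (2 * pi * x)) = f x" for x
    unfolding F_def by (rule cis_eq_periodic[OF f(2)]) (simp add: cis_Arg_circle)
  have F': "F z = f (Arg (- z) / (2 * pi) + 1/2)" if "cmod z = 1" for z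
  proof -
    have "cis (2 * pi * (Arg (- z) / (2 * pi) + 1/2)) = cis (Arg (-z) + pi)" by (simp add: distrib_left)
    also have "\<dots> = z" using cis_Arg_circle[of "-z"] that by (simp add: cis_mult[symmetric])
    finally show ?thesis using F_cis by metis
  qed
  have fc: "isCont f x" for x using f(1) by (simp add: continuous_on_eq_continuous_at)
  have "continuous_on (sphere 0 1) F"
    unfolding continuous_on_eq_continuous_within
  proof
    fix z :: complex assume z: "z \<in> sphere 0 1"
    show "continuous (at z within sphere 0 1) F"
    proof (cases "z \<in> \<real>\<^sub>\<le>\<^sub>0")
      case False
      have "isCont F z" unfolding F_def
        by (rule isCont_o2[OF _ fc]) (use continuous_at_Arg[OF False] in \<open>auto intro!: continuous_intros\<close>)
      then show ?thesis by (rule continuous_at_imp_continuous_at_within)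
    next
      case True
      then have nz: "- z \<notin> \<real>\<^sub>\<le>\<^sub>0" using z by (auto simp: complex_nonpos_Reals_iff cmod_def)
      have "isCont (\<lambda>z. Arg (- z)) z"
        by (rule isCont_o2[of _ uminus]) (use continuous_at_Arg[OF nz] in \<open>auto intro!: continuous_intros\<close>)
      then have "isCont (\<lambda>z. f (Arg (- z) / (2 * pi) + 1/2)) z"
        by (intro isCont_o2[OF _ fc]) (auto intro!: continuous_intros)
      then have "continuous (at z within sphere 0 1) (\<lambda>z. f (Arg (- z) / (2 * pi) + 1/2))"
        by (rule continuous_at_imp_continuous_at_within)
      then show ?thesis
        by (rule continuous_transform_within[OF _ zero_less_one]) (use z F' in auto)
    qed
  qed
  then obtain g where g: "real_polynomial_function g" "\<And>z. z \<in> sphere 0 1 \<Longrightarrow> \<bar>F z - g z\<bar> < e"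
    using Stone_Weierstrass_real_polynomial_function[of "sphere 0 1" F e] e by (metis compact_sphere)
  have "\<bar>f x - g (cis (2 * pi * x))\<bar> < e" for x
    using g(2)[of "cis (2 * pi * x)"] by (simp add: F_cis)
  then show ?thesis using real_polynomial_cis[OF g(1)] by blast
qed

text \<open>Such an \<open>f\<close> is orthogonal to all trigonometric functions, which approximate \<open>f\<close> itself uniformly,
so the integral of \<open>f\<^sup>2\<close> is zero.\<close>

lemma fc_zero_continuous:
  assumes f: "continuous_on UNIV f" "periodic1 f" and z: "\<And>n. fc f n = 0"
  shows "f x = 0"
proof -
  have i: "circle_integrable f" using f by (intro circle_integrable_continuous)
  have tr: "integral {0..1} (\<lambda>x. f x * p x) = 0 \<and> (\<lambda>x. f x * p x) integrable_on {0..1}" if "trig_function p" for p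
    using that
    by (induction p rule: trig_function.induct)
      (auto simp: integral_trig_mode[OF i] z distrib_left Henstock_Kurzweil_Integration.integral_add intro: circle_integrable_cos_sin i integrable_add)
  have sqi: "(\<lambda>x. f x * f x) integrable_on {0..1}"
    using L2fun_mult[OF L2fun_continuous[OF f] L2fun_continuous[OF f]] circle_integrable_integrable by blast
  have absi: "(\<lambda>x. \<bar>f x\<bar>) integrable_on {0..1}"
    using i by (auto simp: circle_integrable_def absolutely_integrable_on_def)
  let ?I = "integral {0..1} (\<lambda>x. \<bar>f x\<bar>)"
  have "integral {0..1} (\<lambda>x. f x * f x) \<le> e * ?I" if e: "e > 0" for e
  proof -
    obtain p where p: "trig_function p" "\<And>x. \<bar>f x - p x\<bar> < e" using trig_approx[OF f e] by blast
    have "integral {0..1} (\<lambda>x. f x * f x) = integral {0..1} (\<lambda>x. f x * f x - f x * p x)"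
      using tr[OF p(1)] sqi by (simp add: Henstock_Kurzweil_Integration.integral_diff)
    also have "\<dots> \<le> integral {0..1} (\<lambda>x. e * \<bar>f x\<bar>)"
    proof (rule integral_le)
      fix x :: real
      have "f x * f x - f x * p x \<le> \<bar>f x\<bar> * \<bar>f x - p x\<bar>"
        by (metis abs_ge_self abs_mult right_diff_distrib)
      also have "\<dots> \<le> \<bar>f x\<bar> * e" using p(2)[of x] by (intro mult_left_mono) auto
      finally show "f x * f x - f x * p x \<le> e * \<bar>f x\<bar>" by (simp add: mult.commute)
    qed (use tr[OF p(1)] sqi absi in \<open>auto intro: integrable_diff integrable_on_mult_right\<close>)
    finally show ?thesis by simp
  qed
  note bd = this
  have "integral {0..1} (\<lambda>x. f x * f x) \<le> 0"
  proof (rule field_le_epsilon)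
    fix e :: real assume e: "e > 0"
    have nn: "?I \<ge> 0" by (rule Henstock_Kurzweil_Integration.integral_nonneg[OF absi]) auto
    have "integral {0..1} (\<lambda>x. f x * f x) \<le> e / (?I + 1) * ?I" by (rule bd) (use e nn in auto)
    also have "\<dots> \<le> e" using e nn by (simp add: field_simps)
    finally show "integral {0..1} (\<lambda>x. f x * f x) \<le> 0 + e" by simp
  qed
  moreover have "integral {0..1} (\<lambda>x. f x * f x) \<ge> 0" by (rule Henstock_Kurzweil_Integration.integral_nonneg[OF sqi]) auto
  ultimately have "integral {0..1} (\<lambda>x. f x * f x) = 0" by simp
  moreover have "continuous_on {0..1} (\<lambda>x. f x * f x)"
    by (intro continuous_on_mult continuous_on_subset[OF f(1)]) auto
  ultimately have z1: "\<forall>x\<in>{0..1}. f x * f x = 0"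
    using integral_eq_0_iff[of 0 1 "\<lambda>x. f x * f x"] by simp
  have "f x = f (frac x)"
    using periodic_of_int[of f "frac x" "\<lfloor>x\<rfloor>"] f(2) unfolding periodic1_def frac_def diff_add_cancel by blast
  moreover have "f (frac x) * f (frac x) = 0"
    by (rule z1[rule_format]) (use frac_ge_0[of x] frac_lt_1[of x] in auto)
  ultimately show ?thesis by simp
qed

lemma ac_deriv_exists:
  assumes "\<And>a b. d absolutely_integrable_on {a..b}"
  shows "\<exists>F. F 0 = 0 \<and> ac_deriv F d"
proof -
  let ?F = "\<lambda>x. if 0 \<le> x then integral {0..x} d else - integral {x..0} d"
  have i: "d integrable_on {a..b}" for a b using assms abs_integrable_imp by blast
  have F: "ac_deriv ?F d" unfolding ac_deriv_def
  proof (intro allI impI conjI assms)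
    fix a b :: real assume ab: "a \<le> b"
    have c: "integral {x..y} d + integral {y..z} d = integral {x..z} d" if "x \<le> y" "y \<le> z" for x y z
      using that i by (intro Henstock_Kurzweil_Integration.integral_combine) auto
    show "?F b - ?F a = integral {a..b} d"
      using ab c[of 0 a b] c[of a 0 b] c[of a b 0] by (auto split: if_splits)
  qed
  show ?thesis by (rule exI[of _ ?F]) (use F in simp)
qed

lemma ac_deriv_periodic:
  assumes F: "ac_deriv F d" and d: "periodic1 d" and z: "integral {0..1} d = 0"
  shows "periodic1 F"
  unfolding periodic1_def
proof
  fix x
  have "F (x+1) - F x = integral {x..x+1} d" by (rule ac_derivD(3)[OF F]) simp
  also have "\<dots> = integral {0..1} d"
    using d unfolding periodic1_def by (intro periodic_integral[where f = d] ac_derivD[OF F]) blast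
  finally show "F (x+1) = F x" using z by simp
qed

lemma ac_deriv_parts:
  assumes F: "ac_deriv F f" "periodic1 F" and G: "ac_deriv G g" "periodic1 G"
  shows "integral {0..1} (\<lambda>x. f x * G x) = - integral {0..1} (\<lambda>x. F x * g x)"
proof -
  note m = ac_deriv_mult[OF F(1) G(1)]
  have i1: "(\<lambda>x. f x * G x) integrable_on {0..1}" "(\<lambda>x. F x * g x) integrable_on {0..1}"
    by (intro abs_integrable_imp abs_integrable_mult_bounded ac_derivD[OF F(1)] ac_derivD[OF G(1)] ac_deriv_continuous[OF F(1)] ac_deriv_continuous[OF G(1)])+
  have "integral {0..1} (\<lambda>x. f x * G x + F x * g x) = F 1 * G 1 - F 0 * G 0"
    using ac_derivD(4)[OF m, of 0 1] by simp
  also have "\<dots> = 0" using F(2) G(2) unfolding periodic1_def by (metis add_0 diff_self)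
  finally show ?thesis using i1 by (simp add: Henstock_Kurzweil_Integration.integral_add)
qed

lemma ac_deriv_cos: "ac_deriv (\<lambda>x. cos (w * x)) (\<lambda>x. - (w * sin (w * x)))"
  by (rule ac_deriv_C1) (auto intro!: derivative_eq_intros continuous_intros)

lemma ac_deriv_sin: "ac_deriv (\<lambda>x. sin (w * x)) (\<lambda>x. w * cos (w * x))"
  by (rule ac_deriv_C1) (auto intro!: derivative_eq_intros continuous_intros)

lemma periodic1_cos_sin:
  "periodic1 (\<lambda>x. cos (2 * pi * real_of_int n * x))" "periodic1 (\<lambda>x. sin (2 * pi * real_of_int n * x))"
  using trig_mode_periodic[of 1 n] trig_mode_periodic[of \<i> n] unfolding periodic1_def trig_mode_cos_sin by simp_all

lemma fc_deriv:
  assumes f: "ac_deriv f f'" "periodic1 f" and i: "circle_integrable f'"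
  shows "fc f' n = \<i> * of_real (2 * pi * real_of_int n) * fc f n"
proof -
  define w where "w = 2 * pi * real_of_int n"
  have fi: "circle_integrable f" by (intro circle_integrable_continuous ac_deriv_continuous[OF f(1)])
  have "integral {0..1} (\<lambda>x. f' x * cos (w * x)) = w * integral {0..1} (\<lambda>x. f x * sin (w * x))"
    using ac_deriv_parts[OF f ac_deriv_cos[of w]] periodic1_cos_sin[of n]
    by (simp add: w_def mult.left_commute[of _ "2 * pi * real_of_int n"])
  moreover have "integral {0..1} (\<lambda>x. f' x * sin (w * x)) = - w * integral {0..1} (\<lambda>x. f x * cos (w * x))"
    using ac_deriv_parts[OF f ac_deriv_sin[of w]] periodic1_cos_sin[of n]
    by (simp add: w_def mult.left_commute[of _ "2 * pi * real_of_int n"])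
  ultimately show ?thesis
    by (simp add: fc_eq_Complex[OF fi] fc_eq_Complex[OF i] complex_eq_iff w_def)
qed

text \<open>The positive and the negative part of \<open>d\<close> define measures that agree on all rays, hence
coincide, and so do their densities almost everywhere.\<close>

lemma ac_deriv_zero_AE:
  assumes d: "ac_deriv (\<lambda>_. 0) d" and m[measurable]: "d \<in> borel_measurable borel"
  shows "negligible {x\<in>{0..1}. d x \<noteq> 0}"
proof -
  define p where "p x = ennreal (max 0 (d x)) * indicator {0..1} x" for x
  define q where "q x = ennreal (max 0 (- d x)) * indicator {0..1} x" for x
  have [measurable]: "p \<in> borel_measurable borel" "q \<in> borel_measurable borel"
    unfolding p_def[abs_def] q_def[abs_def] by measurable
  have absi: "(\<lambda>x. max 0 (d x)) integrable_on {a..b}" "(\<lambda>x. max 0 (- d x)) integrable_on {a..b}" for a b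
  proof -
    have i: "(\<lambda>x. (\<bar>d x\<bar> + d x) / 2) integrable_on {a..b}" "(\<lambda>x. (\<bar>d x\<bar> - d x) / 2) integrable_on {a..b}"
      using ac_derivD(1)[OF d, of a b]
      by (auto intro!: integrable_on_divide integrable_add integrable_diff simp: absolutely_integrable_on_def)
    have e: "(\<bar>d x\<bar> + d x) / 2 = max 0 (d x)" "(\<bar>d x\<bar> - d x) / 2 = max 0 (- d x)" for x by auto
    show "(\<lambda>x. max 0 (d x)) integrable_on {a..b}" "(\<lambda>x. max 0 (- d x)) integrable_on {a..b}"
      using i unfolding e .
  qed
  have int_eq: "integral {a..b} (\<lambda>x. max 0 (d x)) = integral {a..b} (\<lambda>x. max 0 (- d x))" for a b
  proof (cases "a \<le> b")
    case True
    have "integral {a..b} (\<lambda>x. max 0 (d x) - max 0 (- d x)) = integral {a..b} d"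
      by (intro integral_cong) (auto simp: max_def)
    then show ?thesis using absi ac_derivD(4)[OF d True] by (simp add: Henstock_Kurzweil_Integration.integral_diff)
  qed simp
  have ev: "emeasure (density lborel (\<lambda>x. ennreal (g x) * indicator {0..1} x)) {x<..} = ennreal (integral {max 0 x..1} g)"
    if gi: "g integrable_on {max 0 x..1}" and gn: "\<And>x. 0 \<le> g x" and [measurable]: "g \<in> borel_measurable borel" for g :: "real \<Rightarrow> real" and x
  proof -
    have "emeasure (density lborel (\<lambda>x. ennreal (g x) * indicator {0..1} x)) {x<..} =
      (\<integral>\<^sup>+y. ennreal (g y) * indicator {0..1} y * indicator {x<..} y \<partial>lborel)"
      by (subst emeasure_density) measurable
    also have "\<dots> = (\<integral>\<^sup>+y. ennreal (g y) * indicator {max 0 x..1} y \<partial>lborel)"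
    proof (rule nn_integral_cong_AE)
      show "AE y in lborel. ennreal (g y) * indicator {0..1} y * indicator {x<..} y = ennreal (g y) * indicator {max 0 x..1} y"
        using AE_lborel_singleton[of x] by eventually_elim (auto split: split_indicator)
    qed
    also have "\<dots> = ennreal (integral {max 0 x..1} g)"
      by (rule nn_integral_has_integral_lebesgue') (use gn gi in auto)
    finally show ?thesis .
  qed
  have "density lborel p = density lborel q"
  proof (rule measure_eqI_lessThan)
    fix x
    show "emeasure (density lborel p) {x<..} < \<infinity>"
      unfolding p_def[abs_def] by (subst ev) (auto intro: absi)
    show "emeasure (density lborel p) {x<..} = emeasure (density lborel q) {x<..}"
      unfolding p_def[abs_def] q_def[abs_def] by (subst (1 2) ev) (auto intro: absi simp: int_eq)
  qed auto
  then have "AE x in lborel. p x = q x"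
    by (intro sigma_finite_measure.density_unique[OF sigma_finite_lborel]) auto
  then have "AE x in lborel. \<not> (x \<in> {0..1} \<and> d x \<noteq> 0)"
    by eventually_elim (auto simp: p_def q_def max_def split: if_splits)
  then have "{x\<in>{0..1}. d x \<noteq> 0} \<in> null_sets lborel"
    by (subst (asm) AE_iff_null) (auto simp: conj_ac)
  then show ?thesis
    by (simp add: negligible_iff_null_sets null_sets_completionI)
qed

text \<open>Uniqueness for \<open>L\<^sup>2\<close> is reduced to continuous functions by integration: the primitive of \<open>d\<close> is
continuous and periodic and has vanishing coefficients except at frequency 0, so it is constant.\<close>

lemma fc_zero:
  assumes d: "L2fun d" and z: "\<And>n. fc d n = 0"
  shows "ac_deriv (\<lambda>_. 0) d" "negligible {x\<in>{0..1}. d x \<noteq> 0}"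
proof -
  have i: "circle_integrable d" by (rule L2fun_circle_integrable[OF d])
  have per: "periodic1 d" using d by (simp add: L2fun_def)
  have ab: "d absolutely_integrable_on {a..b}" for a b
  proof (rule periodic_abs_integrable)
    show "d (x + 1) = d x" for x using per by (simp add: periodic1_def)
    show "d absolutely_integrable_on {0..1}" using i by (simp add: circle_integrable_def)
  qed
  obtain F where F: "F 0 = 0" "ac_deriv F d" using ac_deriv_exists[OF ab] by blast
  have "integral {0..1} d = 0" using z[of 0] by (simp add: fc_eq_Complex[OF i] complex_eq_iff)
  then have Fp: "periodic1 F" by (rule ac_deriv_periodic[OF F(2) per])
  note Fc = ac_deriv_continuous[OF F(2)]
  define G where "G x = F x - trig_mode (fc F 0) 0 x" for x
  have Fi: "circle_integrable F" by (intro circle_integrable_continuous Fc)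
  have tw0: "trig_mode a 0 = (\<lambda>x. Re a)" for a by (simp add: trig_mode_def[abs_def])
  have "fc G n = 0" for n
  proof (cases "n = 0")
    case True
    have "Im (fc F 0) = 0" by (simp add: fc_eq_Complex[OF Fi])
    then show ?thesis unfolding G_def[abs_def] using True
      by (simp add: fc_diff Fi circle_integrable_tw fc_trig_mode complex_eq_iff)
  next
    case False
    have "fc F n = 0" using fc_deriv[OF F(2) Fp i, of n] z[of n] False by simp
    then show ?thesis unfolding G_def[abs_def] using False
      by (simp add: fc_diff Fi circle_integrable_tw fc_trig_mode)
  qed
  moreover have "continuous_on UNIV G" "periodic1 G"
    using Fp unfolding G_def[abs_def]
    by (auto simp: periodic1_def trig_mode_periodic intro: continuous_on_diff Fc trig_mode_continuous)
  ultimately have "G x = 0" for x using fc_zero_continuous[of G x] by blast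
  then have "F x = F 0" for x by (simp add: G_def tw0)
  then have "F = (\<lambda>_. 0)" by (intro ext) (rule trans[OF _ F(1)])
  then show "ac_deriv (\<lambda>_. 0) d" using F(2) by simp
  then show "negligible {x\<in>{0..1}. d x \<noteq> 0}"
    by (rule ac_deriv_zero_AE) (use d in \<open>simp add: L2fun_def\<close>)
qed

section \<open>Riesz--Fischer and Parseval\<close>

lemma hermitian_trig_poly_dist:
  assumes "hermitian a" "N \<le> M"
  shows "integral {0..1} (\<lambda>x. (trig_poly M a x - trig_poly N a x)\<^sup>2) =
    (\<Sum>k\<in>{-int M..int M}. (cmod (a k))\<^sup>2) - (\<Sum>k\<in>{-int N..int N}. (cmod (a k))\<^sup>2)"
proof -
  have e: "fc (trig_poly M a) k = a k" if "k \<in> {-int N..int N}" for k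
    using that assms(2) by (auto simp: fc_trig_poly[OF assms(1)])
  show ?thesis
    by (simp add: integral_diff_trig_poly_sq[OF L2fun_trig_poly assms(1)] integral_trig_poly_sq[OF assms(1)] e)
qed

lemma norm_fc_le:
  assumes "L2fun f" shows "(cmod (fc f n))\<^sup>2 \<le> integral {0..1} (\<lambda>x. (f x)\<^sup>2)"
proof -
  have "(cmod (fc f n))\<^sup>2 \<le> (\<Sum>k\<in>{-int (nat \<bar>n\<bar>)..int (nat \<bar>n\<bar>)}. (cmod (fc f k))\<^sup>2)"
    by (rule member_le_sum) auto
  also have "\<dots> \<le> integral {0..1} (\<lambda>x. (f x)\<^sup>2)" by (rule bessel_interval[OF assms])
  finally show ?thesis .
qed

text \<open>Cauchy--Schwarz with geometric weights.  It turns summability of weighted squares into a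
square integrable bound for all partial sums of a series, without Minkowski's inequality.\<close>

lemma telescope_square_bound:
  fixes d :: "nat \<Rightarrow> real"
  assumes "\<And>n. (\<Sum>j<n. 4 ^ j * (d j)\<^sup>2) \<le> w" and "k \<le> m"
  shows "(\<Sum>j\<in>{k..<m}. d j)\<^sup>2 \<le> 2 * w"
proof -
  have w: "0 \<le> w" using assms(1)[of 0] by simp
  have "(\<Sum>j\<in>{k..<m}. d j)\<^sup>2 = (\<Sum>j\<in>{k..<m}. (1/2) ^ j * (2 ^ j * d j))\<^sup>2"
    by (simp add: power_one_over)
  also have "\<dots> \<le> (\<Sum>j\<in>{k..<m}. ((1/2) ^ j)\<^sup>2) * (\<Sum>j\<in>{k..<m}. (2 ^ j * d j)\<^sup>2)"
    by (rule Cauchy_Schwarz_ineq_sum)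
  also have "\<dots> \<le> 2 * w"
  proof (intro mult_mono)
    have "(\<Sum>j\<in>{k..<m}. ((1/2::real) ^ j)\<^sup>2) = (\<Sum>j\<in>{k..<m}. (1/4) ^ j)"
      by (simp add: power2_eq_square power_mult_distrib[symmetric])
    also have "\<dots> \<le> (\<Sum>j<m. (1/4) ^ j)" by (rule sum_mono2) auto
    also have "\<dots> \<le> (\<Sum>j. (1/4) ^ j)" by (rule sum_le_suminf) (auto intro: summable_geometric)
    also have "\<dots> \<le> 2" by (simp add: suminf_geometric)
    finally show "(\<Sum>j\<in>{k..<m}. ((1/2::real) ^ j)\<^sup>2) \<le> 2" .
    have "(\<Sum>j\<in>{k..<m}. (2 ^ j * d j)\<^sup>2) = (\<Sum>j\<in>{k..<m}. 4 ^ j * (d j)\<^sup>2)"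
      by (intro sum.cong) (auto simp: power_mult_distrib power2_eq_square power_mult_distrib[symmetric])
    also have "\<dots> \<le> (\<Sum>j<m. 4 ^ j * (d j)\<^sup>2)" by (rule sum_mono2) auto
    finally show "(\<Sum>j\<in>{k..<m}. (2 ^ j * d j)\<^sup>2) \<le> w" using assms(1)[of m] by linarith
  qed (auto intro: sum_nonneg)
  finally show ?thesis .
qed

text \<open>Along a subsequence with tails below \<open>(1/16) ^ k\<close> the weighted squares of the increments have an
integrable sum \<open>w\<close>.  Where \<open>w\<close> is finite the partial sums converge, and \<open>w\<close> dominates the squared
errors, so convergence also holds in \<open>L\<^sup>2\<close>.\<close>

theorem riesz_fischer:
  assumes a: "hermitian a" and sa: "(\<lambda>n. (cmod (a n))\<^sup>2) summable_on UNIV"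
  shows "\<exists>f. L2fun f \<and> (\<forall>n. fc f n = a n) \<and> integral {0..1} (\<lambda>x. (f x)\<^sup>2) = (\<Sum>\<^sub>\<infinity>n. (cmod (a n))\<^sup>2)"
proof -
  define S where "S = (\<Sum>\<^sub>\<infinity>n. (cmod (a n))\<^sup>2)"
  define s where "s N = (\<Sum>k\<in>{-int N..int N}. (cmod (a k))\<^sup>2)" for N
  define P where "P N = trig_poly N a" for N
  have s_lim: "s \<longlonglongrightarrow> S" unfolding s_def[abs_def] S_def
    by (rule has_sum_int_intervals) (rule has_sum_infsum[OF sa])
  have s_le: "s N \<le> S" for N unfolding s_def S_def
    by (rule finite_sum_le_infsum[OF sa]) auto
  have dist: "integral {0..1} (\<lambda>x. (P M x - P N x)\<^sup>2) \<le> max (S - s N) (S - s M)" for M N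
  proof (cases "N \<le> M")
    case True
    then show ?thesis using hermitian_trig_poly_dist[OF a True] s_le[of M] by (simp add: P_def s_def)
  next
    case False
    then have "M \<le> N" by simp
    have "integral {0..1} (\<lambda>x. (P M x - P N x)\<^sup>2) = integral {0..1} (\<lambda>x. (P N x - P M x)\<^sup>2)"
      by (simp add: power2_commute)
    then show ?thesis using hermitian_trig_poly_dist[OF a \<open>M \<le> N\<close>] s_le[of N] by (simp add: P_def s_def)
  qed
  (* Tails this small leave a convergent series after multiplication by the weights 4 ^ k. *)
  have "\<exists>N\<ge>k. S - s N \<le> (1/16) ^ k" for k
  proof -
    have "\<forall>\<^sub>F N in sequentially. S - (1/16) ^ k < s N"
      by (rule order_tendstoD(1)[OF s_lim]) simp
    then have "\<forall>\<^sub>F N in sequentially. S - (1/16) ^ k < s N \<and> N \<ge> k"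
      using eventually_ge_at_top[of k] by eventually_elim auto
    then show ?thesis by (auto simp: eventually_sequentially intro: less_imp_le)
        (metis add_diff_cancel_left' diff_add_cancel less_eq_real_def le_diff_eq diff_le_eq order_refl add.commute)
  qed
  then obtain r where r: "\<And>k. r k \<ge> k" "\<And>k. S - s (r k) \<le> (1/16) ^ k" by metis
  define d where "d k x = P (r (Suc k)) x - P (r k) x" for k x
  have Pper: "P N (x + 1) = P N x" for N x by (simp add: P_def trig_poly_periodic)
  have Pc: "continuous_on A (P N)" for A N by (simp add: P_def trig_poly_continuous)
  have [measurable]: "P N \<in> borel_measurable borel" for N by (intro borel_measurable_continuous_onI Pc)
  have PL2: "L2fun (P N)" for N by (simp add: P_def L2fun_trig_poly)
  have dm[measurable]: "d k \<in> borel_measurable borel" for k unfolding d_def[abs_def] by measurable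
  have dL2: "L2fun (d k)" for k unfolding d_def[abs_def] by (intro L2fun_diff PL2)
  have d_int: "integral {0..1} (\<lambda>x. (d k x)\<^sup>2) \<le> (1/16) ^ k" for k
  proof -
    have "(1/16::real) ^ Suc k \<le> (1/16) ^ k" by simp
    then show ?thesis using dist[of "r (Suc k)" "r k"] r(2)[of k] r(2)[of "Suc k"] unfolding d_def by linarith
  qed
  define w where "w x = (\<Sum>k. ennreal (4 ^ k * (d k x)\<^sup>2))" for x
  have [measurable]: "w \<in> borel_measurable borel" unfolding w_def[abs_def] by measurable
  have wper: "w (x + 1) = w x" for x unfolding w_def d_def Pper ..
  have "(\<integral>\<^sup>+x. w x * indicator {0..1} x \<partial>lborel) = (\<integral>\<^sup>+x. (\<Sum>k. ennreal (4 ^ k * (d k x)\<^sup>2) * indicator {0..1} x) \<partial>lborel)"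
    by (simp add: w_def ennreal_suminf_multc)
  also have "\<dots> = (\<Sum>k. \<integral>\<^sup>+x. ennreal (4 ^ k * (d k x)\<^sup>2) * indicator {0..1} x \<partial>lborel)"
    by (rule nn_integral_suminf) measurable
  also have "\<dots> \<le> (\<Sum>k. ennreal ((1/4) ^ k))"
  proof (rule suminf_le)
    fix k
    have "((\<lambda>x. 4 ^ k * (d k x)\<^sup>2) has_integral (4 ^ k * integral {0..1} (\<lambda>x. (d k x)\<^sup>2))) {0..1}"
      by (intro has_integral_mult_right integrable_integral L2fun_sq dL2)
    then have "(\<integral>\<^sup>+x. ennreal (4 ^ k * (d k x)\<^sup>2) * indicator {0..1} x \<partial>lborel) = ennreal (4 ^ k * integral {0..1} (\<lambda>x. (d k x)\<^sup>2))"
      by (intro nn_integral_has_integral_lebesgue') auto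
    also have "4 ^ k * integral {0..1} (\<lambda>x. (d k x)\<^sup>2) \<le> 4 ^ k * (1/16) ^ k"
      by (intro mult_left_mono d_int) auto
    also have "4 ^ k * (1/16) ^ k = (1/4::real) ^ k" by (simp add: power_mult_distrib[symmetric])
    finally show "(\<integral>\<^sup>+x. ennreal (4 ^ k * (d k x)\<^sup>2) * indicator {0..1} x \<partial>lborel) \<le> ennreal ((1/4) ^ k)"
      by (simp add: ennreal_leI)
  qed auto
  also have "\<dots> = ennreal (4/3)"
    using geometric_sums[of "1/4::real"] by (intro suminf_ennreal_eq) auto
  finally have wfin: "(\<integral>\<^sup>+x. w x * indicator {0..1} x \<partial>lborel) < \<infinity>"
    using le_less_trans by (metis ennreal_less_top infinity_ennreal_def)
  (* Z is periodic and Borel, so setting the limit to 0 on Z keeps both properties. *)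
  define Z where "Z = {x. w x = \<infinity>}"
  have [measurable]: "Z \<in> sets borel" unfolding Z_def by measurable
  have Zper: "x + 1 \<in> Z \<longleftrightarrow> x \<in> Z" for x by (simp add: Z_def wper)
  have "AE x in lborel. w x * indicator {0..1} x \<noteq> \<infinity>"
    by (rule nn_integral_noteq_infinite) (use wfin in auto)
  then have "AE x in lborel. \<not> (x \<in> Z \<inter> {0..1})"
    by eventually_elim (auto simp: Z_def)
  then have "Z \<inter> {0..1} \<in> null_sets lborel"
    by (subst (asm) AE_iff_null) (auto simp: Int_def conj_ac)
  then have Zneg: "negligible (Z \<inter> {0..1})"
    by (simp add: negligible_iff_null_sets null_sets_completionI)
  have sm: "summable (\<lambda>k. 4 ^ k * (d k x)\<^sup>2)" if "x \<notin> Z" for x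
    using that by (intro summable_suminf_not_top) (auto simp: Z_def w_def)
  have w_real: "enn2real (w x) = (\<Sum>k. 4 ^ k * (d k x)\<^sup>2)" if "x \<notin> Z" for x
  proof -
    have "(\<Sum>k. ennreal (4 ^ k * (d k x)\<^sup>2)) = ennreal (\<Sum>k. 4 ^ k * (d k x)\<^sup>2)"
      by (rule suminf_ennreal2[OF _ sm[OF that]]) simp
    moreover have "(\<Sum>k. 4 ^ k * (d k x)\<^sup>2) \<ge> 0" by (rule suminf_nonneg[OF sm[OF that]]) simp
    ultimately show ?thesis by (simp add: w_def)
  qed
  have part: "(\<Sum>j<n. 4 ^ j * (d j x)\<^sup>2) \<le> enn2real (w x)" if "x \<notin> Z" for x n
    unfolding w_real[OF that] by (rule sum_le_suminf[OF sm[OF that]]) auto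
  have tele: "(\<Sum>j\<in>{k..<m}. d j x) = P (r m) x - P (r k) x" if "k \<le> m" for k m x
    unfolding d_def using that by (rule sum_Suc_diff')
  have conv: "convergent (\<lambda>k. P (r k) x)" if x: "x \<notin> Z" for x
  proof -
    have "summable (\<lambda>k. d k x)"
    proof (rule summable_comparison_test'[where N = 0])
      show "summable (\<lambda>k. ((1/4) ^ k + 4 ^ k * (d k x)\<^sup>2) / 2)"
        by (intro summable_divide summable_add sm[OF x] summable_geometric) auto
      fix k
      have "\<bar>(1/2) ^ k * (2 ^ k * d k x)\<bar> \<le> (((1/2) ^ k)\<^sup>2 + (2 ^ k * d k x)\<^sup>2) / 2" by (rule abs_mult_le_squares)
      moreover have "(1/2) ^ k * (2 ^ k * d k x) = d k x" by (simp add: power_one_over)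
      moreover have "((1/2::real) ^ k)\<^sup>2 = (1/4) ^ k" "(2 ^ k * d k x)\<^sup>2 = 4 ^ k * (d k x)\<^sup>2"
        by (simp_all add: power2_eq_square power_mult_distrib[symmetric] power_mult_distrib)
      ultimately show "norm (d k x) \<le> ((1/4) ^ k + 4 ^ k * (d k x)\<^sup>2) / 2" by simp
    qed
    then have "(\<lambda>k. P (r 0) x + (\<Sum>j<k. d j x)) \<longlonglongrightarrow> P (r 0) x + (\<Sum>j. d j x)"
      by (intro tendsto_intros summable_LIMSEQ)
    moreover have "P (r 0) x + (\<Sum>j<k. d j x) = P (r k) x" for k
      using tele[of 0 k x] by (simp add: atLeast0LessThan)
    ultimately show ?thesis by (auto simp: convergent_def)
  qed
  define f where "f x = lim (\<lambda>k. if x \<in> Z then 0 else P (r k) x)" for x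
  have ite[measurable]: "(\<lambda>x. if x \<in> Z then 0 else g x) \<in> borel_measurable borel"
    if "g \<in> borel_measurable borel" for g :: "real \<Rightarrow> real"
    by (rule measurable_If_set) (use that in auto)
  have fm[measurable]: "f \<in> borel_measurable borel" unfolding f_def[abs_def]
    by (intro borel_measurable_lim_metric ite) measurable
  have f_lim: "(\<lambda>k. P (r k) x) \<longlonglongrightarrow> f x" if "x \<notin> Z" for x
    using conv[OF that] that by (simp add: f_def convergent_LIMSEQ_iff)
  have fper: "f (x + 1) = f x" for x by (simp add: f_def Zper Pper cong: if_cong)
  have fbd: "(f x - P (r k) x)\<^sup>2 \<le> 2 * enn2real (w x)" if x: "x \<notin> Z" for x k
  proof (rule LIMSEQ_le_const2)
    show "(\<lambda>m. (P (r m) x - P (r k) x)\<^sup>2) \<longlonglongrightarrow> (f x - P (r k) x)\<^sup>2"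
      by (intro tendsto_intros f_lim x)
    show "\<exists>N. \<forall>m\<ge>N. (P (r m) x - P (r k) x)\<^sup>2 \<le> 2 * enn2real (w x)"
      using telescope_square_bound[OF part[OF x], of k] by (metis tele)
  qed
  define W where "W x = 2 * enn2real (w x * indicator {0..1} x)" for x
  have Wi: "W integrable_on {0..1}"
  proof -
    have "(\<lambda>x. enn2real (w x * indicator {0..1} x)) integrable_on UNIV"
    proof (rule nn_integral_integrable_on)
      have "(\<integral>\<^sup>+x. ennreal (enn2real (w x * indicator {0..1} x)) \<partial>lborel) \<le> (\<integral>\<^sup>+x. w x * indicator {0..1} x \<partial>lborel)"
        by (intro nn_integral_mono) (simp add: ennreal_enn2real_if)
      then show "(\<integral>\<^sup>+x. ennreal (enn2real (w x * indicator {0..1} x)) \<partial>lborel) < \<infinity>"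
        using wfin by (rule le_less_trans)
    qed auto
    then show ?thesis unfolding W_def[abs_def]
      by (intro integrable_on_mult_right) (rule integrable_on_subinterval, auto)
  qed
  define h where "h k x = (if x \<in> Z then 0 else (f x - P (r k) x)\<^sup>2)" for k x
  have [measurable]: "h k \<in> borel_measurable borel" for k unfolding h_def[abs_def] by (intro ite) measurable
  have hbd: "norm (h k x) \<le> W x" if "x \<in> {0..1}" for k x
    using fbd[of x k] that by (auto simp: h_def W_def)
  have hi: "h k integrable_on {0..1}" for k
    by (rule abs_integrable_imp[OF abs_integrable_bound[OF _ Wi hbd]]) auto
  have h_lim: "(\<lambda>k. integral {0..1} (h k)) \<longlonglongrightarrow> integral {0..1} (\<lambda>_::real. 0::real)"
  proof (rule dominated_convergence(2)[OF hi Wi hbd])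
    fix x :: real
    show "(\<lambda>k. h k x) \<longlonglongrightarrow> 0"
    proof (cases "x \<in> Z")
      case False
      have "(\<lambda>k. (f x - P (r k) x)\<^sup>2) \<longlonglongrightarrow> (f x - f x)\<^sup>2" by (intro tendsto_intros f_lim False)
      then show ?thesis using False by (simp add: h_def)
    qed (simp add: h_def)
  qed
  have spike: "(\<lambda>x. (f x - P (r k) x)\<^sup>2) integrable_on {0..1}"
      "integral {0..1} (\<lambda>x. (f x - P (r k) x)\<^sup>2) = integral {0..1} (h k)" for k
  proof -
    have e: "(f x - P (r k) x)\<^sup>2 = h k x" if "x \<in> {0..1} - (Z \<inter> {0..1})" for x
      using that by (auto simp: h_def)
    show "(\<lambda>x. (f x - P (r k) x)\<^sup>2) integrable_on {0..1}"
      by (rule integrable_spike[OF hi Zneg e])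
    show "integral {0..1} (\<lambda>x. (f x - P (r k) x)\<^sup>2) = integral {0..1} (h k)"
      by (rule integral_spike[OF Zneg]) (rule e[symmetric])
  qed
  have dL: "L2fun (\<lambda>x. f x - P (r k) x)" for k
    unfolding L2fun_def periodic1_def using spike(1) by (simp add: fper Pper)
  have fL2: "L2fun f" using L2fun_add[OF dL[of 0] PL2[of "r 0"]] by simp
  have fca: "fc f n = a n" for n
  proof -
    have "(cmod (fc f n - a n))\<^sup>2 \<le> 0"
    proof (rule LIMSEQ_le_const)
      show "(\<lambda>k. integral {0..1} (h k)) \<longlonglongrightarrow> 0" using h_lim by simp
      show "\<exists>N. \<forall>k\<ge>N. (cmod (fc f n - a n))\<^sup>2 \<le> integral {0..1} (h k)"
      proof (intro exI[of _ "nat \<bar>n\<bar>"] allI impI)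
        fix k assume "nat \<bar>n\<bar> \<le> k"
        then have "\<bar>n\<bar> \<le> int (r k)" using r(1)[of k] by linarith
        then have "fc (\<lambda>x. f x - P (r k) x) n = fc f n - a n"
          by (simp add: fc_diff L2fun_circle_integrable fL2 PL2) (simp add: P_def fc_trig_poly a)
        then show "(cmod (fc f n - a n))\<^sup>2 \<le> integral {0..1} (h k)"
          using norm_fc_le[OF dL[of k], of n] spike(2)[of k] by simp
      qed
    qed
    then show ?thesis by simp
  qed
  have "integral {0..1} (\<lambda>x. (f x)\<^sup>2) = S"
  proof -
    have "integral {0..1} (h k) = integral {0..1} (\<lambda>x. (f x)\<^sup>2) - s (r k)" for k
      using integral_diff_trig_poly_sq[OF fL2 a, of "r k"] spike(2)[of k] by (simp add: fca P_def s_def)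
    then have "(\<lambda>k. integral {0..1} (\<lambda>x. (f x)\<^sup>2) - s (r k)) \<longlonglongrightarrow> 0" using h_lim by simp
    moreover have "filterlim r at_top sequentially"
      by (rule filterlim_at_top_mono[OF filterlim_ident]) (use r(1) in auto)
    then have "(\<lambda>k. s (r k)) \<longlonglongrightarrow> S" by (rule filterlim_compose[OF s_lim])
    then have "(\<lambda>k. integral {0..1} (\<lambda>x. (f x)\<^sup>2) - s (r k)) \<longlonglongrightarrow> integral {0..1} (\<lambda>x. (f x)\<^sup>2) - S"
      by (intro tendsto_intros)
    ultimately show ?thesis using LIMSEQ_unique by fastforce
  qed
  then show ?thesis using fL2 fca by (auto simp: S_def)
qed

text \<open>The function rebuilt from the coefficients of \<open>f\<close> has the right norm by construction and agrees
with \<open>f\<close> almost everywhere by uniqueness.\<close>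

theorem parseval:
  assumes f: "L2fun f"
  shows "((\<lambda>n. (cmod (fc f n))\<^sup>2) has_sum integral {0..1} (\<lambda>x. (f x)\<^sup>2)) UNIV"
proof -
  note s = L2fun_summable[OF f]
  obtain g where g: "L2fun g" "\<And>n. fc g n = fc f n" "integral {0..1} (\<lambda>x. (g x)\<^sup>2) = (\<Sum>\<^sub>\<infinity>n. (cmod (fc f n))\<^sup>2)"
    using riesz_fischer[OF hermitian_fc[OF L2fun_circle_integrable[OF f]] s] by blast
  have "negligible {x\<in>{0..1}. f x - g x \<noteq> 0}"
    by (rule fc_zero(2)[OF L2fun_diff[OF f g(1)]]) (simp add: fc_diff L2fun_circle_integrable f g)
  then have "integral {0..1} (\<lambda>x. (f x)\<^sup>2) = integral {0..1} (\<lambda>x. (g x)\<^sup>2)"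
    by (rule integral_spike) auto
  then show ?thesis using has_sum_infsum[OF s] g(3) by simp
qed

section \<open>Sobolev norms\<close>

text \<open>The square of the Sobolev norm.  All estimates are made for squares, where \<open>(a + b)\<^sup>2 \<le> 2 a\<^sup>2 + 2 b\<^sup>2\<close>
replaces the triangle inequality.\<close>

definition sob_sq :: "real \<Rightarrow> (real \<Rightarrow> real) \<Rightarrow> real" where
  "sob_sq r f = (\<Sum>\<^sub>\<infinity>n. sobolev_term r f n)"

text \<open>Membership in \<open>H\<^sup>r\<close> up to the choice of representative: in contrast to \<open>sobolev\<close>, no continuity is
demanded for \<open>r > 1/2\<close>.  This is the right notion for the highest derivative.\<close>

definition hsp :: "real \<Rightarrow> (real \<Rightarrow> real) \<Rightarrow> bool" where
  "hsp r f \<longleftrightarrow> L2fun f \<and> sobolev_term r f summable_on UNIV"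

lemma sobolev_term_nonneg: "0 \<le> sobolev_term r f n"
  by (simp add: sobolev_term_def)

lemma sob_sq_nonneg: "0 \<le> sob_sq r f"
  unfolding sob_sq_def by (intro infsum_nonneg sobolev_term_nonneg)

lemma hsp_L2: "hsp r f \<Longrightarrow> L2fun f" by (simp add: hsp_def)

lemma hsp_summable: "hsp r f \<Longrightarrow> sobolev_term r f summable_on UNIV" by (simp add: hsp_def)

lemma weight_pos: "0 < 1 + (real_of_int n)\<^sup>2" and weight_ge_1: "1 \<le> 1 + (real_of_int n)\<^sup>2"
  by (simp_all add: add_pos_nonneg)

lemma sobolev_term_0: "sobolev_term 0 f n = (cmod (fc f n))\<^sup>2"
  using weight_pos[of n] by (simp add: sobolev_term_def)

lemma sobolev_term_1: "sobolev_term 1 f n = (1 + (real_of_int n)\<^sup>2) * (cmod (fc f n))\<^sup>2"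
  using weight_pos[of n] by (simp add: sobolev_term_def)

lemma hsp_0: "hsp 0 f \<longleftrightarrow> L2fun f"
  unfolding hsp_def sobolev_term_0[abs_def] using L2fun_summable by blast

lemma sob_sq_0: "L2fun f \<Longrightarrow> sob_sq 0 f = integral {0..1} (\<lambda>x. (f x)\<^sup>2)"
  unfolding sob_sq_def sobolev_term_0[abs_def] using parseval infsumI by blast

lemma sobolev_term_mono: "r \<le> r' \<Longrightarrow> sobolev_term r f n \<le> sobolev_term r' f n"
  unfolding sobolev_term_def using weight_ge_1[of n] by (intro mult_right_mono powr_mono) auto

lemma hsp_mono:
  assumes "hsp r' f" "r \<le> r'" shows "hsp r f" "sob_sq r f \<le> sob_sq r' f"
proof -
  have s: "sobolev_term r f summable_on UNIV"
    by (rule summable_on_comparison_test[OF hsp_summable[OF assms(1)]]) (auto intro: sobolev_term_mono sobolev_term_nonneg assms(2))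
  then show "hsp r f" using assms(1) by (simp add: hsp_def)
  show "sob_sq r f \<le> sob_sq r' f" unfolding sob_sq_def
    by (rule infsum_mono[OF s hsp_summable[OF assms(1)]]) (rule sobolev_term_mono[OF assms(2)])
qed

lemma hsp_bound:
  assumes f: "L2fun f" and s: "(\<lambda>n. g n) summable_on UNIV" and le: "\<And>n. sobolev_term r f n \<le> g n"
  shows "hsp r f" "sob_sq r f \<le> infsum g UNIV"
proof -
  have s': "sobolev_term r f summable_on UNIV"
    by (rule summable_on_comparison_test[OF s]) (auto intro: le sobolev_term_nonneg)
  then show "hsp r f" using f by (simp add: hsp_def)
  show "sob_sq r f \<le> infsum g UNIV" unfolding sob_sq_def
    by (rule infsum_mono[OF s' s]) (rule le)
qed

lemma norm_add_sq_le: "(cmod (x + y))\<^sup>2 \<le> 2 * (cmod x)\<^sup>2 + 2 * (cmod y)\<^sup>2"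
proof -
  have "(cmod (x + y))\<^sup>2 \<le> (cmod x + cmod y)\<^sup>2" by (intro power_mono norm_triangle_ineq) auto
  also have "\<dots> \<le> 2 * (cmod x)\<^sup>2 + 2 * (cmod y)\<^sup>2"
    using sum_squares_bound[of "cmod x" "cmod y"] by (simp add: power2_sum)
  finally show ?thesis .
qed

lemma sobolev_term_add_le:
  assumes "circle_integrable f" "circle_integrable g"
  shows "sobolev_term r (\<lambda>x. f x + g x) n \<le> 2 * sobolev_term r f n + 2 * sobolev_term r g n"
proof -
  have "sobolev_term r (\<lambda>x. f x + g x) n \<le> (1 + (real_of_int n)\<^sup>2) powr r * (2 * (cmod (fc f n))\<^sup>2 + 2 * (cmod (fc g n))\<^sup>2)"
    unfolding sobolev_term_def fc_add[OF assms] by (intro mult_left_mono norm_add_sq_le) auto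
  then show ?thesis by (simp add: sobolev_term_def algebra_simps)
qed

lemma hsp_add:
  assumes "hsp r f" "hsp r g"
  shows "hsp r (\<lambda>x. f x + g x)" "sob_sq r (\<lambda>x. f x + g x) \<le> 2 * sob_sq r f + 2 * sob_sq r g"
proof -
  have L: "L2fun f" "L2fun g" using assms hsp_L2 by auto
  have s: "(\<lambda>n. 2 * sobolev_term r f n) summable_on UNIV" "(\<lambda>n. 2 * sobolev_term r g n) summable_on UNIV"
    using assms by (auto intro: summable_on_cmult_right hsp_summable)
  have le: "sobolev_term r (\<lambda>x. f x + g x) n \<le> 2 * sobolev_term r f n + 2 * sobolev_term r g n" for n
    by (rule sobolev_term_add_le) (use L L2fun_circle_integrable in auto)
  note b = hsp_bound[OF L2fun_add[OF L] summable_on_add[OF s] le]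
  show "hsp r (\<lambda>x. f x + g x)" by (rule b(1))
  show "sob_sq r (\<lambda>x. f x + g x) \<le> 2 * sob_sq r f + 2 * sob_sq r g"
    using b(2) by (simp add: infsum_add[OF s] infsum_cmult_right' sob_sq_def)
qed

lemma sobolev_term_cmult: "circle_integrable f \<Longrightarrow> sobolev_term r (\<lambda>x. c * f x) n = c\<^sup>2 * sobolev_term r f n"
  by (simp add: sobolev_term_def fc_cmult norm_mult power_mult_distrib)

lemma hsp_cmult:
  assumes "hsp r f"
  shows "hsp r (\<lambda>x. c * f x)" "sob_sq r (\<lambda>x. c * f x) = c\<^sup>2 * sob_sq r f"
proof -
  have e: "sobolev_term r (\<lambda>x. c * f x) = (\<lambda>n. c\<^sup>2 * sobolev_term r f n)"
    using L2fun_circle_integrable[OF hsp_L2[OF assms]] by (auto simp: sobolev_term_cmult)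
  show "hsp r (\<lambda>x. c * f x)"
    using assms by (auto simp: hsp_def e intro: L2fun_cmult summable_on_cmult_right)
  show "sob_sq r (\<lambda>x. c * f x) = c\<^sup>2 * sob_sq r f"
    by (simp add: sob_sq_def e infsum_cmult_right')
qed

lemma hsp_diff:
  assumes "hsp r f" "hsp r g"
  shows "hsp r (\<lambda>x. f x - g x)" "sob_sq r (\<lambda>x. f x - g x) \<le> 2 * sob_sq r f + 2 * sob_sq r g"
  using hsp_add[OF assms(1) hsp_cmult(1)[OF assms(2), of "-1"]] hsp_cmult(2)[OF assms(2), of "-1"] by simp_all

text \<open>Differentiation multiplies the coefficient by \<open>2 \<pi> \<i> n\<close>, and
\<open>(1 + n\<^sup>2)\<^bsup>r+1\<^esup> = (1 + n\<^sup>2)\<^sup>r + n\<^sup>2 (1 + n\<^sup>2)\<^sup>r\<close>.  So norms of integer order above \<open>r\<close> can be computed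
exactly from derivatives.\<close>

lemma sobolev_term_deriv:
  assumes f: "ac_deriv f f'" "periodic1 f" and f': "L2fun f'"
  shows "sobolev_term (r + 1) f n = sobolev_term r f n + 1 / (4 * pi\<^sup>2) * sobolev_term r f' n"
proof -
  have "cmod (fc f' n) = 2 * pi * \<bar>real_of_int n\<bar> * cmod (fc f n)"
    using fc_deriv[OF f L2fun_circle_integrable[OF f'], of n] by (simp add: norm_mult abs_mult)
  then have "(cmod (fc f' n))\<^sup>2 = 4 * pi\<^sup>2 * (real_of_int n)\<^sup>2 * (cmod (fc f n))\<^sup>2"
    by (simp add: power_mult_distrib)
  then have 1: "1 / (4 * pi\<^sup>2) * (cmod (fc f' n))\<^sup>2 = (real_of_int n)\<^sup>2 * (cmod (fc f n))\<^sup>2" by simp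
  have 2: "(1 + (real_of_int n)\<^sup>2) powr (r + 1) = (1 + (real_of_int n)\<^sup>2) powr r * (1 + (real_of_int n)\<^sup>2)"
    using weight_pos[of n] by (simp add: powr_add)
  have "sobolev_term (r + 1) f n = (1 + (real_of_int n)\<^sup>2) powr r * ((cmod (fc f n))\<^sup>2 + (real_of_int n)\<^sup>2 * (cmod (fc f n))\<^sup>2)"
    by (simp add: sobolev_term_def 2 distrib_left distrib_right)
  also have "\<dots> = sobolev_term r f n + 1 / (4 * pi\<^sup>2) * sobolev_term r f' n"
    unfolding sobolev_term_def 1[symmetric] by (simp add: distrib_left)
  finally show ?thesis .
qed

lemma hsp_deriv:
  assumes f: "ac_deriv f f'" "periodic1 f" and h: "hsp r f" "hsp r f'"
  shows "hsp (r + 1) f" "sob_sq (r + 1) f = sob_sq r f + 1 / (4 * pi\<^sup>2) * sob_sq r f'"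
proof -
  have e: "sobolev_term (r + 1) f = (\<lambda>n. sobolev_term r f n + 1 / (4 * pi\<^sup>2) * sobolev_term r f' n)"
    using sobolev_term_deriv[OF f hsp_L2[OF h(2)]] by blast
  have s: "(\<lambda>n. 1 / (4 * pi\<^sup>2) * sobolev_term r f' n) summable_on UNIV"
    by (intro summable_on_cmult_right hsp_summable h)
  show "hsp (r + 1) f" using hsp_L2[OF h(1)] summable_on_add[OF hsp_summable[OF h(1)] s] by (simp add: hsp_def e)
  show "sob_sq (r + 1) f = sob_sq r f + 1 / (4 * pi\<^sup>2) * sob_sq r f'"
    unfolding sob_sq_def e by (subst infsum_add[OF hsp_summable[OF h(1)] s]) (simp only: infsum_cmult_right')
qed

lemma hsp_1:
  assumes f: "ac_deriv f f'" "periodic1 f" and f': "L2fun f'"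
  shows "hsp 1 f" "sob_sq 1 f = integral {0..1} (\<lambda>x. (f x)\<^sup>2) + 1 / (4 * pi\<^sup>2) * integral {0..1} (\<lambda>x. (f' x)\<^sup>2)"
proof -
  have "L2fun f" using L2fun_continuous[OF ac_deriv_continuous[OF f(1)] f(2)] .
  then show "hsp 1 f" "sob_sq 1 f = integral {0..1} (\<lambda>x. (f x)\<^sup>2) + 1 / (4 * pi\<^sup>2) * integral {0..1} (\<lambda>x. (f' x)\<^sup>2)"
    using hsp_deriv[OF f, of 0] f' by (simp_all add: hsp_0 sob_sq_0)
qed

section \<open>Truncation\<close>

abbreviation "trunc N f \<equiv> trig_poly N (fc f)"

lemma hsp_trig_poly:
  assumes "hermitian a" shows "hsp r (trig_poly N a)"
proof -
  have "sobolev_term r (trig_poly N a) summable_on {- int N..int N}" by simp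
  then have "sobolev_term r (trig_poly N a) summable_on UNIV"
    by (rule summable_on_cong_neutral[THEN iffD1, rotated -1]) (auto simp: sobolev_term_def fc_trig_poly[OF assms])
  then show ?thesis by (simp add: hsp_def L2fun_trig_poly)
qed

lemma fc_trunc: "L2fun f \<Longrightarrow> fc (trunc N f) m = (if \<bar>m\<bar> \<le> int N then fc f m else 0)"
  by (rule fc_trig_poly[OF hermitian_fc[OF L2fun_circle_integrable]])

lemma sobolev_term_trunc: "L2fun f \<Longrightarrow> sobolev_term r (trunc N f) m = (if \<bar>m\<bar> \<le> int N then sobolev_term r f m else 0)"
  by (simp add: sobolev_term_def fc_trunc)

lemma sobolev_term_rest:
  "L2fun f \<Longrightarrow> sobolev_term r (\<lambda>x. f x - trunc N f x) m = (if \<bar>m\<bar> \<le> int N then 0 else sobolev_term r f m)"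
  by (simp add: sobolev_term_def fc_diff fc_trunc L2fun_circle_integrable circle_integrable_trig_poly)

lemma hsp_trunc: "L2fun f \<Longrightarrow> hsp r (trunc N f)"
  by (rule hsp_trig_poly[OF hermitian_fc[OF L2fun_circle_integrable]])

lemma hsp_rest: "hsp r f \<Longrightarrow> hsp r (\<lambda>x. f x - trunc N f x)"
  by (intro hsp_diff hsp_trunc) (auto intro: hsp_L2)

lemma sob_sq_rest:
  assumes f: "hsp r f"
  shows "sob_sq r (\<lambda>x. f x - trunc N f x) = sob_sq r f - (\<Sum>k\<in>{-int N..int N}. sobolev_term r f k)"
proof -
  let ?A = "{-int N..int N}"
  have "sob_sq r (\<lambda>x. f x - trunc N f x) = infsum (sobolev_term r f) (UNIV - ?A)"
    unfolding sob_sq_def by (rule infsum_cong_neutral) (auto simp: sobolev_term_rest[OF hsp_L2[OF f]])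
  also have "\<dots> = sob_sq r f - infsum (sobolev_term r f) ?A"
    unfolding sob_sq_def by (rule infsum_Diff[OF hsp_summable[OF f]]) auto
  finally show ?thesis by simp
qed

lemma sob_sq_rest_tendsto:
  assumes f: "hsp r f"
  shows "(\<lambda>N. sob_sq r (\<lambda>x. f x - trunc N f x)) \<longlonglongrightarrow> 0"
proof -
  have "(\<lambda>N. sob_sq r f - (\<Sum>k\<in>{-int N..int N}. sobolev_term r f k)) \<longlonglongrightarrow> sob_sq r f - sob_sq r f"
    unfolding sob_sq_def
    by (intro tendsto_intros has_sum_int_intervals has_sum_infsum hsp_summable f)
  then show ?thesis by (simp add: sob_sq_rest[OF f])
qed

section \<open>Interpolation\<close>

lemma real_power_bracket:
  fixes X :: real assumes "X \<ge> 1"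
  obtains i where "4 ^ i \<le> X" "X < 4 ^ Suc i"
proof -
  define n where "n = (LEAST n. X < 4 ^ n)"
  obtain m where "X < 4 ^ m" using real_arch_pow[of 4 X] by auto
  then have n: "X < 4 ^ n" unfolding n_def by (rule LeastI)
  have "n \<noteq> 0" using n assms by (cases n) auto
  then obtain i where i: "n = Suc i" by (cases n) auto
  have "\<not> X < 4 ^ i" using not_less_Least[of i "\<lambda>n. X < 4 ^ n"] i by (simp add: n_def[symmetric])
  then show thesis using that[of i] n i by simp
qed

lemma sum_geometric_tail_le:
  fixes q :: real assumes "0 \<le> q" "q < 1"
  shows "(\<Sum>j\<in>{m..<J}. q ^ j) \<le> q ^ m / (1 - q)"
proof (cases "m \<le> J")
  case True
  have "(\<Sum>j\<in>{m..<J}. q ^ j) = (q ^ m - q ^ J) / (1 - q)"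
    using True
  proof (induction J rule: dec_induct)
    case (step n)
    have e: "q ^ n = (q ^ n - q ^ Suc n) / (1 - q)" using assms by (simp add: field_simps)
    have "(\<Sum>j\<in>{m..<Suc n}. q ^ j) = (\<Sum>j\<in>{m..<n}. q ^ j) + q ^ n" using step by simp
    also have "\<dots> = (q ^ m - q ^ n) / (1 - q) + (q ^ n - q ^ Suc n) / (1 - q)" using step.IH e by presburger
    also have "\<dots> = (q ^ m - q ^ Suc n) / (1 - q)" unfolding add_divide_distrib[symmetric] by simp
    finally show ?case .
  qed simp
  also have "\<dots> \<le> q ^ m / (1 - q)" using assms by (intro divide_right_mono) auto
  finally show ?thesis .
qed (use assms in auto)

text \<open>The two geometric series below and above the dyadic scale of a frequency.\<close>

definition interp_const :: "real \<Rightarrow> real" where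
  "interp_const \<sigma> = 4 powr \<sigma> / (4 powr \<sigma> - 1) + 1 / (1 - 4 powr \<sigma> / 4)"

lemma interp_base:
  assumes "0 < \<sigma>" "\<sigma> < 1" shows "1 < 4 powr \<sigma>" "4 powr \<sigma> < (4::real)" "0 \<le> interp_const \<sigma>"
proof -
  show "1 < 4 powr \<sigma>" using assms by simp
  show "4 powr \<sigma> < (4::real)" using powr_less_mono[of \<sigma> 1 4] assms by simp
  then show "0 \<le> interp_const \<sigma>" using \<open>1 < 4 powr \<sigma>\<close> by (simp add: interp_const_def)
qed

text \<open>The weights \<open>4\<^bsup>\<sigma>j\<^esup> min 1 (X / 4\<^sup>j)\<close> increase geometrically as long as \<open>4\<^sup>j \<le> X\<close> and decrease
geometrically afterwards, so their sum is comparable to the largest term, which is about \<open>X\<^bsup>\<sigma>\<^esup>\<close>.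
Growth uses \<open>\<sigma> > 0\<close> and decay uses \<open>\<sigma> < 1\<close>.\<close>

lemma dyadic_upper:
  fixes X \<sigma> :: real
  assumes s: "0 < \<sigma>" "\<sigma> < 1" and X: "1 \<le> X"
  shows "(\<Sum>j<J. (4 powr \<sigma>) ^ j * min 1 (X / 4 ^ j)) \<le> interp_const \<sigma> * X powr \<sigma>"
proof -
  define b where "b = 4 powr \<sigma>"
  have b: "1 < b" "b < 4" using interp_base[OF s] by (auto simp: b_def)
  obtain i where i: "4 ^ i \<le> X" "X < 4 ^ Suc i" by (rule real_power_bracket[OF X])
  have bp: "b ^ n = (4 ^ n) powr \<sigma>" for n
    by (simp add: b_def powr_powr powr_realpow[symmetric] mult.commute)
  have bi: "b ^ i \<le> X powr \<sigma>" unfolding bp using i s by (intro powr_mono2) auto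
  (* The first term beyond the largest one. *)
  have Xi: "X * (b / 4) ^ Suc i \<le> X powr \<sigma>"
  proof -
    have "(4 ^ Suc i) powr (\<sigma> - 1) \<le> X powr (\<sigma> - 1)"
      using i X s by (intro powr_mono2') auto
    then have "X * (4 ^ Suc i) powr (\<sigma> - 1) \<le> X * X powr (\<sigma> - 1)" using X by (intro mult_left_mono) auto
    also have "X * X powr (\<sigma> - 1) = X powr \<sigma>" using X by (simp add: powr_diff)
    finally show ?thesis by (simp add: power_divide bp powr_diff del: power_Suc)
  qed
  let ?t = "\<lambda>j. b ^ j * min 1 (X / 4 ^ j)"
  have "(\<Sum>j<J. ?t j) \<le> (\<Sum>j\<in>{..<Suc i} \<union> {Suc i..<J}. ?t j)"
    using b X by (intro sum_mono2) auto
  also have "\<dots> = (\<Sum>j<Suc i. ?t j) + (\<Sum>j\<in>{Suc i..<J}. ?t j)"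
    by (rule sum.union_disjoint) auto
  also have "(\<Sum>j<Suc i. ?t j) \<le> (\<Sum>j<Suc i. b ^ j)"
    using b by (intro sum_mono) (simp add: mult_left_le)
  also have "(\<Sum>j<Suc i. b ^ j) = (b ^ Suc i - 1) / (b - 1)"
    using b by (intro geometric_sum) simp
  also have "\<dots> \<le> b / (b - 1) * b ^ i"
    using b by (simp add: divide_right_mono)
  also have "\<dots> \<le> b / (b - 1) * X powr \<sigma>"
    using b bi by (intro mult_left_mono) auto
  also have "(\<Sum>j\<in>{Suc i..<J}. ?t j) \<le> (\<Sum>j\<in>{Suc i..<J}. X * (b / 4) ^ j)"
  proof (rule sum_mono)
    fix j
    have "?t j \<le> b ^ j * (X / 4 ^ j)" using b by (intro mult_left_mono) auto
    then show "?t j \<le> X * (b / 4) ^ j" by (simp add: power_divide mult.commute)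
  qed
  also have "\<dots> \<le> X * ((b / 4) ^ Suc i / (1 - b / 4))"
    unfolding sum_distrib_left[symmetric] using X b by (intro mult_left_mono sum_geometric_tail_le) auto
  also have "\<dots> \<le> 1 / (1 - b / 4) * X powr \<sigma>"
    using divide_right_mono[OF Xi, of "1 - b/4"] b by simp
  finally show ?thesis by (simp add: interp_const_def b_def[symmetric] distrib_right)
qed

lemma dyadic_lower:
  fixes X \<sigma> :: real
  assumes s: "0 < \<sigma>" and X: "1 \<le> X"
  shows "\<exists>i. \<forall>J>i. X powr \<sigma> \<le> 4 powr \<sigma> * (\<Sum>j<J. (4 powr \<sigma>) ^ j * min 1 (X / 4 ^ j))"
proof -
  obtain i where i: "4 ^ i \<le> X" "X < 4 ^ Suc i" by (rule real_power_bracket[OF X])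
  have "X powr \<sigma> \<le> 4 powr \<sigma> * (\<Sum>j<J. (4 powr \<sigma>) ^ j * min 1 (X / 4 ^ j))" if J: "J > i" for J
  proof -
    have "X powr \<sigma> \<le> (4 ^ Suc i) powr \<sigma>" using i X s by (intro powr_mono2) auto
    also have "\<dots> = 4 powr \<sigma> * ((4 powr \<sigma>) ^ i * min 1 (X / 4 ^ i))"
      using i by (simp add: powr_mult powr_powr powr_realpow[symmetric] mult.commute)
    also have "(4 powr \<sigma>) ^ i * min 1 (X / 4 ^ i) \<le> (\<Sum>j<J. (4 powr \<sigma>) ^ j * min 1 (X / 4 ^ j))"
      using J X by (intro member_le_sum) auto
    finally show ?thesis by simp
  qed
  then show ?thesis by blast
qed

lemma infsum_finite_sum:
  fixes g :: "'i \<Rightarrow> 'a \<Rightarrow> real"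
  assumes "finite J" "\<And>j. j \<in> J \<Longrightarrow> g j summable_on A"
  shows "(\<lambda>n. \<Sum>j\<in>J. g j n) summable_on A \<and> (\<Sum>\<^sub>\<infinity>n\<in>A. \<Sum>j\<in>J. g j n) = (\<Sum>j\<in>J. infsum (g j) A)"
  using assms by (induction J rule: finite_induct) (auto intro: summable_on_add simp: infsum_add)

text \<open>A discrete version of real interpolation.  The kernel \<open>min 1 (X / 4\<^sup>j)\<close> measures a sequence in the
sum of the two endpoint norms at scale \<open>2\<^sup>j\<close>; an inequality between these quantities at each
scale is summed with weights \<open>4\<^bsup>\<sigma>j\<^esup>\<close>.\<close>

lemma dyadic_interpolation:
  fixes X x y :: "'i \<Rightarrow> real"
  assumes s: "0 < \<sigma>" "\<sigma> < 1" and X: "\<And>n. 1 \<le> X n" and x: "\<And>n. 0 \<le> x n" and y: "\<And>n. 0 \<le> y n" and B: "0 \<le> B"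
    and sx: "(\<lambda>n. X n powr \<sigma> * x n) summable_on UNIV"
    and K: "\<And>j F. finite F \<Longrightarrow> (\<Sum>n\<in>F. min 1 (X n / 4 ^ j) * y n) \<le> B * (\<Sum>\<^sub>\<infinity>n. min 1 (X n / 4 ^ j) * x n)"
  shows "(\<lambda>n. X n powr \<sigma> * y n) summable_on UNIV"
    and "(\<Sum>\<^sub>\<infinity>n. X n powr \<sigma> * y n) \<le> 4 powr \<sigma> * interp_const \<sigma> * B * (\<Sum>\<^sub>\<infinity>n. X n powr \<sigma> * x n)"
proof -
  define b where "b = 4 powr \<sigma>"
  have b: "1 < b" using interp_base[OF s] by (simp add: b_def)
  define k where "k j n = min 1 (X n / 4 ^ j)" for j :: nat and n
  have k0: "0 \<le> k j n" for j n using X[of n] by (simp add: k_def)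
  have "X n powr \<sigma> \<ge> 1" for n using X[of n] s by (simp add: ge_one_powr_ge_zero)
  then have "k j n \<le> X n powr \<sigma>" for j n by (rule order_trans[rotated]) (simp add: k_def)
  then have xle: "k j n * x n \<le> X n powr \<sigma> * x n" for j n
    using x[of n] by (intro mult_right_mono)
  have skx: "(\<lambda>n. k j n * x n) summable_on UNIV" for j
    by (rule summable_on_comparison_test[OF sx]) (auto intro: xle mult_nonneg_nonneg k0 x)
  let ?B = "4 powr \<sigma> * interp_const \<sigma> * B * (\<Sum>\<^sub>\<infinity>n. X n powr \<sigma> * x n)"
  have bound: "(\<Sum>n\<in>F. X n powr \<sigma> * y n) \<le> ?B" if F: "finite F" for F
  proof -
    obtain i where i: "\<And>n J. J > i n \<Longrightarrow> X n powr \<sigma> \<le> b * (\<Sum>j<J. b ^ j * k j n)"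
      using dyadic_lower[OF s(1) X] unfolding b_def k_def by metis
    define J where "J = Suc (\<Sum>n\<in>F. i n)"
    have J: "J > i n" if "n \<in> F" for n
      using member_le_sum[OF that, of i] F by (simp add: J_def)
    have "(\<Sum>n\<in>F. X n powr \<sigma> * y n) \<le> (\<Sum>n\<in>F. b * (\<Sum>j<J. b ^ j * k j n) * y n)"
      by (intro sum_mono mult_right_mono i J y)
    also have "\<dots> = b * (\<Sum>n\<in>F. \<Sum>j<J. b ^ j * (k j n * y n))"
      by (simp add: sum_distrib_left sum_distrib_right mult_ac)
    also have "(\<Sum>n\<in>F. \<Sum>j<J. b ^ j * (k j n * y n)) = (\<Sum>j<J. b ^ j * (\<Sum>n\<in>F. k j n * y n))"
      by (subst sum.swap) (simp add: sum_distrib_left)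
    also have "\<dots> \<le> (\<Sum>j<J. b ^ j * (B * (\<Sum>\<^sub>\<infinity>n. k j n * x n)))"
      using b K[OF F] unfolding k_def by (intro sum_mono mult_left_mono) auto
    also have "\<dots> = B * (\<Sum>j<J. \<Sum>\<^sub>\<infinity>n. b ^ j * (k j n * x n))"
      by (simp only: infsum_cmult_right' sum_distrib_left mult.left_commute[of B])
    also have "(\<Sum>j<J. \<Sum>\<^sub>\<infinity>n. b ^ j * (k j n * x n)) = (\<Sum>\<^sub>\<infinity>n. \<Sum>j<J. b ^ j * (k j n * x n))"
      by (subst infsum_finite_sum[THEN conjunct2]) (auto intro: summable_on_cmult_right skx)
    also have "\<dots> \<le> (\<Sum>\<^sub>\<infinity>n. interp_const \<sigma> * (X n powr \<sigma> * x n))"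
    proof (rule infsum_mono)
      show "(\<lambda>n. \<Sum>j<J. b ^ j * (k j n * x n)) summable_on UNIV"
        by (rule infsum_finite_sum[THEN conjunct1]) (auto intro: summable_on_cmult_right skx)
      show "(\<lambda>n. interp_const \<sigma> * (X n powr \<sigma> * x n)) summable_on UNIV"
        by (intro summable_on_cmult_right sx)
      fix n
      have "(\<Sum>j<J. b ^ j * (k j n * x n)) = (\<Sum>j<J. b ^ j * k j n) * x n"
        by (simp add: sum_distrib_right mult.assoc)
      also have "\<dots> \<le> interp_const \<sigma> * X n powr \<sigma> * x n"
        using dyadic_upper[OF s X[of n], of J] x[of n] unfolding b_def k_def by (intro mult_right_mono)
      finally show "(\<Sum>j<J. b ^ j * (k j n * x n)) \<le> interp_const \<sigma> * (X n powr \<sigma> * x n)" by (simp add: mult_ac)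
    qed
    also have "\<dots> = interp_const \<sigma> * (\<Sum>\<^sub>\<infinity>n. X n powr \<sigma> * x n)" by (rule infsum_cmult_right')
    finally have "(\<Sum>n\<in>F. X n powr \<sigma> * y n) \<le> b * (B * (interp_const \<sigma> * (\<Sum>\<^sub>\<infinity>n. X n powr \<sigma> * x n)))"
      using b B by (simp add: mult_left_mono)
    then show ?thesis by (simp add: b_def mult_ac)
  qed
  show sy: "(\<lambda>n. X n powr \<sigma> * y n) summable_on UNIV"
  proof (rule nonneg_bdd_above_summable_on)
    show "0 \<le> X n powr \<sigma> * y n" for n using y[of n] by simp
    show "bdd_above (sum (\<lambda>n. X n powr \<sigma> * y n) ` {F. F \<subseteq> UNIV \<and> finite F})"
      using bound by (intro bdd_aboveI[of _ ?B]) blast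
  qed
  show "(\<Sum>\<^sub>\<infinity>n. X n powr \<sigma> * y n) \<le> ?B"
    by (rule infsum_le_finite_sums[OF sy]) (rule bound)
qed

text \<open>Here \<open>q\<close> is the image of \<open>f\<close> under a linear operator and \<open>qa N\<close>, \<open>qb N\<close> are the images of the
high and low frequencies of \<open>f\<close>.  At scale \<open>2\<^sup>j\<close> the frequencies are cut at \<open>N = 2\<^sup>j\<close>; the \<open>L\<^sup>2\<close> bound is
used for the high part and the \<open>H\<^sup>1\<close> bound for the low part.\<close>

theorem interpolation:
  assumes s: "0 < \<sigma>" "\<sigma> < 1" and f: "hsp \<sigma> f" and q: "L2fun q" and M: "0 \<le> M"
    and split: "\<And>N x. q x = qa N x + qb N x"
    and qa: "\<And>N. L2fun (qa N)" "\<And>N. sob_sq 0 (qa N) \<le> M * sob_sq 0 (\<lambda>x. f x - trunc N f x)"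
    and qb: "\<And>N. hsp 1 (qb N)" "\<And>N. sob_sq 1 (qb N) \<le> M * sob_sq 1 (trunc N f)"
  shows "hsp \<sigma> q" "sob_sq \<sigma> q \<le> 4 powr \<sigma> * interp_const \<sigma> * (4 * M) * sob_sq \<sigma> f"
proof -
  define X where "X n = 1 + (real_of_int n)\<^sup>2" for n
  define x where "x n = (cmod (fc f n))\<^sup>2" for n
  define y where "y n = (cmod (fc q n))\<^sup>2" for n
  have X1: "1 \<le> X n" for n by (simp add: X_def)
  have fL: "L2fun f" using hsp_L2[OF f] .
  have tf: "sobolev_term \<sigma> f = (\<lambda>n. X n powr \<sigma> * x n)" "sobolev_term \<sigma> q = (\<lambda>n. X n powr \<sigma> * y n)"
    by (auto simp: sobolev_term_def X_def x_def y_def)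
  have sx: "(\<lambda>n. X n powr \<sigma> * x n) summable_on UNIV" using hsp_summable[OF f] by (simp add: tf)
  have K: "(\<Sum>n\<in>F. min 1 (X n / 4 ^ j) * y n) \<le> (4 * M) * (\<Sum>\<^sub>\<infinity>n. min 1 (X n / 4 ^ j) * x n)"
    if F: "finite F" for F j
  proof -
    define N where "N = (2::nat) ^ j"
    have N2: "real N * real N = 4 ^ j" by (simp add: N_def power_mult_distrib[symmetric])
    have ts: "sobolev_term 0 (qa N) summable_on UNIV" using qa(1)[of N] hsp_0 hsp_summable by blast
    have yle: "min 1 (X n / 4 ^ j) * y n \<le> 2 * sobolev_term 0 (qa N) n + 2 / 4 ^ j * sobolev_term 1 (qb N) n" for n
    proof -
      have "fc q n = fc (qa N) n + fc (qb N) n"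
        using fc_add[of "qa N" "qb N" n] L2fun_circle_integrable[OF qa(1)] L2fun_circle_integrable[OF hsp_L2[OF qb(1)]] split[of _ N] by presburger
      then have "y n \<le> 2 * (cmod (fc (qa N) n))\<^sup>2 + 2 * (cmod (fc (qb N) n))\<^sup>2"
        unfolding y_def by (simp add: norm_add_sq_le)
      then have "min 1 (X n / 4 ^ j) * y n \<le> min 1 (X n / 4 ^ j) * (2 * (cmod (fc (qa N) n))\<^sup>2) + min 1 (X n / 4 ^ j) * (2 * (cmod (fc (qb N) n))\<^sup>2)"
        unfolding distrib_left[symmetric] using X1[of n] by (intro mult_left_mono) auto
      also have "\<dots> \<le> 1 * (2 * (cmod (fc (qa N) n))\<^sup>2) + X n / 4 ^ j * (2 * (cmod (fc (qb N) n))\<^sup>2)"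
        by (intro add_mono mult_right_mono) auto
      finally show ?thesis by (simp add: sobolev_term_0 sobolev_term_1 X_def mult.left_commute)
    qed
    have "(\<Sum>n\<in>F. min 1 (X n / 4 ^ j) * y n) \<le> 2 * (\<Sum>n\<in>F. sobolev_term 0 (qa N) n) + 2 / 4 ^ j * (\<Sum>n\<in>F. sobolev_term 1 (qb N) n)"
      unfolding sum_distrib_left sum.distrib[symmetric] by (intro sum_mono yle)
    also have "\<dots> \<le> 2 * sob_sq 0 (qa N) + 2 / 4 ^ j * sob_sq 1 (qb N)"
      unfolding sob_sq_def using F ts hsp_summable[OF qb(1)]
      by (intro add_mono mult_left_mono finite_sum_le_infsum) (auto simp: sobolev_term_nonneg)
    also have "\<dots> \<le> 2 * (M * sob_sq 0 (\<lambda>x. f x - trunc N f x)) + 2 / 4 ^ j * (M * sob_sq 1 (trunc N f))"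
      by (intro add_mono mult_left_mono qa qb) auto
    also have "\<dots> = 2 * M * (sob_sq 0 (\<lambda>x. f x - trunc N f x) + 1 / 4 ^ j * sob_sq 1 (trunc N f))"
      by (simp add: algebra_simps)
    also have "sob_sq 0 (\<lambda>x. f x - trunc N f x) + 1 / 4 ^ j * sob_sq 1 (trunc N f) \<le> (\<Sum>\<^sub>\<infinity>n. 2 * (min 1 (X n / 4 ^ j) * x n))"
    proof -
      have s1: "sobolev_term 0 (\<lambda>x. f x - trunc N f x) summable_on UNIV"
        by (intro hsp_summable hsp_rest) (simp add: hsp_0 fL)
      have s2: "(\<lambda>n. 1 / 4 ^ j * sobolev_term 1 (trunc N f) n) summable_on UNIV"
        by (intro summable_on_cmult_right hsp_summable hsp_trunc fL)
      have s3: "(\<lambda>n. 2 * (min 1 (X n / 4 ^ j) * x n)) summable_on UNIV"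
      proof (intro summable_on_cmult_right summable_on_comparison_test[OF sx])
        fix n
        have "min 1 (X n / 4 ^ j) \<le> 1" by simp
        also have "\<dots> \<le> X n powr \<sigma>" using X1[of n] s by (simp add: ge_one_powr_ge_zero)
        finally have "min 1 (X n / 4 ^ j) \<le> X n powr \<sigma>" .
        then show "min 1 (X n / 4 ^ j) * x n \<le> X n powr \<sigma> * x n" by (intro mult_right_mono) (auto simp: x_def)
        show "0 \<le> min 1 (X n / 4 ^ j) * x n" using X1[of n] by (simp add: x_def)
      qed
      have "sob_sq 0 (\<lambda>x. f x - trunc N f x) + 1 / 4 ^ j * sob_sq 1 (trunc N f)
        = (\<Sum>\<^sub>\<infinity>n. sobolev_term 0 (\<lambda>x. f x - trunc N f x) n + 1 / 4 ^ j * sobolev_term 1 (trunc N f) n)"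
        unfolding sob_sq_def by (subst infsum_add[OF s1 s2]) (simp add: infsum_cmult_right'[symmetric])
      also have "\<dots> \<le> (\<Sum>\<^sub>\<infinity>n. 2 * (min 1 (X n / 4 ^ j) * x n))"
      proof (rule infsum_mono[OF summable_on_add[OF s1 s2] s3])
        fix n
        show "sobolev_term 0 (\<lambda>x. f x - trunc N f x) n + 1 / 4 ^ j * sobolev_term 1 (trunc N f) n \<le> 2 * (min 1 (X n / 4 ^ j) * x n)"
        proof (cases "\<bar>n\<bar> \<le> int N")
          case True
          then have "\<bar>real_of_int n\<bar> \<le> real N" by linarith
          then have "\<bar>real_of_int n\<bar> * \<bar>real_of_int n\<bar> \<le> 4 ^ j" unfolding N2[symmetric] by (intro mult_mono) auto
          then have "X n \<le> 2 * 4 ^ j" using abs_mult_self_eq[of "real_of_int n"] one_le_power[of "4::real" j] unfolding X_def power2_eq_square by linarith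
          then have "X n / 4 ^ j \<le> 2 * min 1 (X n / 4 ^ j)" using X1[of n] by (simp add: field_simps min_def)
          then have "X n / 4 ^ j * x n \<le> 2 * min 1 (X n / 4 ^ j) * x n" by (intro mult_right_mono) (auto simp: x_def)
          then show ?thesis using True unfolding sobolev_term_rest[OF fL] sobolev_term_trunc[OF fL] by (simp add: sobolev_term_1 X_def x_def mult.assoc)
        next
          case False
          then have "\<bar>real_of_int n\<bar> \<ge> real N" by linarith
          then have "4 ^ j \<le> \<bar>real_of_int n\<bar> * \<bar>real_of_int n\<bar>" unfolding N2[symmetric] by (intro mult_mono) auto
          then have "4 ^ j \<le> X n" by (simp add: X_def power2_eq_square)
          then have "min 1 (X n / 4 ^ j) = 1" by simp
          then show ?thesis using False unfolding sobolev_term_rest[OF fL] sobolev_term_trunc[OF fL] by (simp add: sobolev_term_0 x_def)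
        qed
      qed
      finally show ?thesis .
    qed
    also have "(\<Sum>\<^sub>\<infinity>n. 2 * (min 1 (X n / 4 ^ j) * x n)) = 2 * (\<Sum>\<^sub>\<infinity>n. min 1 (X n / 4 ^ j) * x n)"
      by (rule infsum_cmult_right')
    finally show ?thesis using M by (simp add: mult_left_mono)
  qed
  note D = dyadic_interpolation[OF s X1 _ _ _ sx K]
  have nn: "0 \<le> x n" "0 \<le> y n" for n by (auto simp: x_def y_def)
  show "hsp \<sigma> q" using D(1) q M nn by (simp add: hsp_def tf)
  show "sob_sq \<sigma> q \<le> 4 powr \<sigma> * interp_const \<sigma> * (4 * M) * sob_sq \<sigma> f"
    using D(2) M nn by (simp add: sob_sq_def tf)
qed

section \<open>Jointly continuous families\<close>

text \<open>Families are written with time as first argument throughout.\<close>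

definition jcont :: "(real \<Rightarrow> real \<Rightarrow> real) \<Rightarrow> bool" where
  "jcont F \<longleftrightarrow> continuous_on UNIV (\<lambda>z. F (fst z) (snd z))"

lemma jcont_compose:
  assumes "jcont F" "continuous_on S a" "continuous_on S b"
  shows "continuous_on S (\<lambda>z. F (a z) (b z))"
  using continuous_on_compose2[OF assms(1)[unfolded jcont_def] continuous_on_Pair[OF assms(2,3)]] by simp

lemma jcont_x: "jcont F \<Longrightarrow> continuous_on S (F t)"
  by (rule jcont_compose[where a = "\<lambda>_. t" and b = "\<lambda>x. x"]) (auto intro: continuous_intros)

lemma jcont_t: "jcont F \<Longrightarrow> continuous_on S (\<lambda>t. F t x)"
  by (rule jcont_compose[where a = "\<lambda>t. t" and b = "\<lambda>_. x"]) (auto intro: continuous_intros)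

lemma jcont_comp: "jcont F \<Longrightarrow> jcont g \<Longrightarrow> jcont (\<lambda>t x. F t (g t x))"
  unfolding jcont_def[of "\<lambda>t x. F t (g t x)"]
  by (rule jcont_compose) (auto simp: jcont_def intro!: continuous_intros)

lemma jcont_add: "jcont F \<Longrightarrow> jcont G \<Longrightarrow> jcont (\<lambda>t x. F t x + G t x)"
  and jcont_mult: "jcont F \<Longrightarrow> jcont G \<Longrightarrow> jcont (\<lambda>t x. F t x * G t x)"
  and jcont_diff: "jcont F \<Longrightarrow> jcont G \<Longrightarrow> jcont (\<lambda>t x. F t x - G t x)"
  and jcont_inverse: "jcont F \<Longrightarrow> (\<And>t x. F t x \<noteq> 0) \<Longrightarrow> jcont (\<lambda>t x. inverse (F t x))"
  unfolding jcont_def by (auto intro!: continuous_intros)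

lemma jcont_const_t: "continuous_on UNIV f \<Longrightarrow> jcont (\<lambda>t x. f x)"
  unfolding jcont_def by (rule continuous_on_compose2[of UNIV f]) (auto intro!: continuous_intros)

lemma jcont_const_x: "continuous_on UNIV a \<Longrightarrow> jcont (\<lambda>t x. a t)"
  unfolding jcont_def by (rule continuous_on_compose2[of UNIV a]) (auto intro!: continuous_intros)

lemma periodic_frac: "periodic1 f \<Longrightarrow> f x = f (frac x)"
  using periodic_of_int[of f "frac x" "\<lfloor>x\<rfloor>"] unfolding periodic1_def frac_def diff_add_cancel by blast

lemma frac_unit: "frac x \<in> {0..1}"
  using frac_ge_0[of x] frac_lt_1[of x] by simp

lemma jcont_uniform:
  assumes F: "jcont F" and per: "\<And>t. periodic1 (F t)" and e: "e > 0"
  shows "\<forall>\<^sub>F \<tau> in at t. \<forall>x. \<bar>F \<tau> x - F t x\<bar> \<le> e"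
proof -
  have "continuous_on (UNIV \<times> {0..1}) (\<lambda>z. F (fst z) (snd z))"
    using F unfolding jcont_def by (rule continuous_on_subset) simp
  from continuous_on_prod_compactE[OF this compact_Icc UNIV_I e, of t]
  obtain T where T: "t \<in> T" "open T" "\<forall>\<tau>\<in>T \<inter> UNIV. \<forall>x\<in>{0..1}. dist (F \<tau> x) (F t x) \<le> e"
    by auto
  have "\<forall>\<^sub>F \<tau> in at t. \<tau> \<in> T" using T(1,2) by (intro eventually_at_in_open') auto
  then show ?thesis
  proof eventually_elim
    case (elim \<tau>)
    show ?case
    proof
      fix x
      have "F \<tau> x = F \<tau> (frac x)" "F t x = F t (frac x)" by (rule periodic_frac[OF per])+
      then show "\<bar>F \<tau> x - F t x\<bar> \<le> e" using T(3) elim frac_unit[of x] by (simp add: dist_real_def)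
    qed
  qed
qed

lemma jcont_bound:
  assumes F: "jcont F" and per: "\<And>t. periodic1 (F t)"
  obtains K where "K > 0" "\<And>t x. \<bar>t - t0\<bar> \<le> 1 \<Longrightarrow> \<bar>F t x\<bar> \<le> K"
proof -
  let ?S = "{t0-1..t0+1} \<times> {0..1::real}"
  have "compact ((\<lambda>z. F (fst z) (snd z)) ` ?S)"
    using F unfolding jcont_def
    by (intro compact_continuous_image compact_Times compact_Icc) (rule continuous_on_subset, auto)
  then obtain K where K: "K > 0" "\<And>y. y \<in> (\<lambda>z. F (fst z) (snd z)) ` ?S \<Longrightarrow> norm y \<le> K"
    using compact_imp_bounded bounded_pos by metis
  have "\<bar>F t x\<bar> \<le> K" if t: "\<bar>t - t0\<bar> \<le> 1" for t x
  proof -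
    have "F t (frac x) \<in> (\<lambda>z. F (fst z) (snd z)) ` ?S"
      using t frac_unit[of x] by (intro image_eqI[of _ _ "(t, frac x)"]) (auto simp: abs_le_iff)
    then show ?thesis using K(2)[of "F t (frac x)"] periodic_frac[OF per[of t], of x] by simp
  qed
  then show thesis using that[of K] K(1) by simp
qed

lemma jcont_lower_bound:
  assumes F: "jcont F" and per: "\<And>t. periodic1 (F t)" and pos: "\<And>t x. F t x > 0"
  obtains \<delta> where "\<delta> > 0" "\<And>t x. \<bar>t - t0\<bar> \<le> 1 \<Longrightarrow> \<delta> \<le> F t x"
proof -
  have nz: "F t x \<noteq> 0" for t x using pos[of t x] by simp
  have "periodic1 (\<lambda>x. inverse (F t x))" for t using per[of t] by (simp add: periodic1_def)
  with jcont_bound[OF jcont_inverse[OF F nz]]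
  obtain K where K: "K > 0" "\<And>t x. \<bar>t - t0\<bar> \<le> 1 \<Longrightarrow> \<bar>inverse (F t x)\<bar> \<le> K" by blast
  have "inverse K \<le> F t x" if "\<bar>t - t0\<bar> \<le> 1" for t x
    using le_imp_inverse_le[of "inverse (F t x)" K] K(2)[OF that, of x] pos[of t x] by simp
  then show thesis using that[of "inverse K"] K(1) by simp
qed

section \<open>Families that are continuous in time with values in a Sobolev space\<close>

text \<open>A continuous curve in \<open>H\<^sup>r\<close>, defined for all real times.\<close>

definition sob_cont :: "real \<Rightarrow> (real \<Rightarrow> real \<Rightarrow> real) \<Rightarrow> bool" where
  "sob_cont r F \<longleftrightarrow> (\<forall>t. hsp r (F t)) \<and> (\<forall>t. ((\<lambda>\<tau>. sob_sq r (\<lambda>x. F \<tau> x - F t x)) \<longlongrightarrow> 0) (at t))"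

lemma tendsto_zero_le:
  fixes g h :: "'a \<Rightarrow> real"
  assumes "(h \<longlongrightarrow> 0) A" "\<forall>\<^sub>F \<tau> in A. 0 \<le> g \<tau> \<and> g \<tau> \<le> h \<tau>"
  shows "(g \<longlongrightarrow> 0) A"
  by (rule tendsto_sandwich[OF _ _ tendsto_const assms(1)]) (use assms(2) in \<open>auto elim: eventually_mono\<close>)

lemma sob_contD: "sob_cont r F \<Longrightarrow> hsp r (F t)" "sob_cont r F \<Longrightarrow> L2fun (F t)"
  "sob_cont r F \<Longrightarrow> ((\<lambda>\<tau>. sob_sq r (\<lambda>x. F \<tau> x - F t x)) \<longlongrightarrow> 0) (at t)"
  unfolding sob_cont_def using hsp_L2 by blast+

lemma sob_cont_mono:
  assumes F: "sob_cont r' F" and "r \<le> r'" shows "sob_cont r F"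
  unfolding sob_cont_def
proof (intro conjI allI)
  fix t
  show "hsp r (F t)" using hsp_mono(1)[OF sob_contD(1)[OF F] assms(2)] .
  show "((\<lambda>\<tau>. sob_sq r (\<lambda>x. F \<tau> x - F t x)) \<longlongrightarrow> 0) (at t)"
    by (rule tendsto_zero_le[OF sob_contD(3)[OF F]])
      (intro always_eventually allI conjI sob_sq_nonneg hsp_mono(2)[OF hsp_diff(1)] sob_contD[OF F] assms)
qed

lemma sob_cont_add:
  assumes F: "sob_cont r F" and G: "sob_cont r G" shows "sob_cont r (\<lambda>t x. F t x + G t x)"
  unfolding sob_cont_def
proof (intro conjI allI)
  fix t
  show "hsp r (\<lambda>x. F t x + G t x)" by (intro hsp_add sob_contD F G)
  have l: "((\<lambda>\<tau>. 2 * sob_sq r (\<lambda>x. F \<tau> x - F t x) + 2 * sob_sq r (\<lambda>x. G \<tau> x - G t x)) \<longlongrightarrow> 0) (at t)"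
    using tendsto_add[OF tendsto_mult_right[OF sob_contD(3)[OF F, of t], of 2] tendsto_mult_right[OF sob_contD(3)[OF G, of t], of 2]]
    by (simp add: mult.commute)
  have e: "(F \<tau> x + G \<tau> x - (F t x + G t x)) = (F \<tau> x - F t x) + (G \<tau> x - G t x)" for \<tau> x by simp
  show "((\<lambda>\<tau>. sob_sq r (\<lambda>x. F \<tau> x + G \<tau> x - (F t x + G t x))) \<longlongrightarrow> 0) (at t)"
    unfolding e
    by (rule tendsto_zero_le[OF l])
      (intro always_eventually allI conjI sob_sq_nonneg hsp_add(2) hsp_diff(1) sob_contD[OF F] sob_contD[OF G])
qed

lemma sob_cont_jcont:
  assumes F: "jcont F" and per: "\<And>t. periodic1 (F t)"
  shows "sob_cont 0 F"
  unfolding sob_cont_def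
proof (intro conjI allI)
  have L: "L2fun (F t)" for t by (intro L2fun_continuous jcont_x F per)
  fix t
  show "hsp 0 (F t)" using L by (simp add: hsp_0)
  show "((\<lambda>\<tau>. sob_sq 0 (\<lambda>x. F \<tau> x - F t x)) \<longlongrightarrow> 0) (at t)"
  proof (rule tendstoI)
    fix e :: real assume e: "e > 0"
    then have "sqrt (e/2) > 0" by simp
    from jcont_uniform[OF F per this, of t]
    show "\<forall>\<^sub>F \<tau> in at t. dist (sob_sq 0 (\<lambda>x. F \<tau> x - F t x)) 0 < e"
    proof eventually_elim
      case (elim \<tau>)
      have "sob_sq 0 (\<lambda>x. F \<tau> x - F t x) = integral {0..1} (\<lambda>x. (F \<tau> x - F t x)\<^sup>2)"
        by (intro sob_sq_0 L2fun_diff L)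
      also have "\<dots> \<le> integral {0..1} (\<lambda>x::real. e/2)"
      proof (rule integral_le)
        fix x :: real
        have "\<bar>F \<tau> x - F t x\<bar>\<^sup>2 \<le> (sqrt (e/2))\<^sup>2" using elim by (intro power_mono) auto
        then show "(F \<tau> x - F t x)\<^sup>2 \<le> e/2" using e by simp
      qed (use L2fun_sq[OF L2fun_diff[OF L L]] in auto)
      finally show ?case using e sob_sq_nonneg[of 0 "\<lambda>x. F \<tau> x - F t x"] by simp
    qed
  qed
qed

text \<open>The variance of \<open>\<bar>f\<bar>\<close> over the unit interval is nonnegative.\<close>

lemma square_integral_le:
  assumes f: "L2fun f" and x: "x \<in> {0..1}"
  shows "(integral {0..x} f)\<^sup>2 \<le> integral {0..1} (\<lambda>x. (f x)\<^sup>2)"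
proof -
  define m where "m = integral {0..1} (\<lambda>x. \<bar>f x\<bar>)"
  have ai: "f absolutely_integrable_on {0..1}" using L2fun_circle_integrable[OF f] by (simp add: circle_integrable_def)
  then have i: "(\<lambda>x. \<bar>f x\<bar>) integrable_on {0..1}" by (auto simp: absolutely_integrable_on_def)
  have i': "f integrable_on {0..x}" "(\<lambda>x. \<bar>f x\<bar>) integrable_on {0..x}"
    using integrable_on_subinterval[OF abs_integrable_imp[OF ai], of 0 x] integrable_on_subinterval[OF i, of 0 x] x by auto
  have "\<bar>integral {0..x} f\<bar> \<le> integral {0..x} (\<lambda>x. \<bar>f x\<bar>)"
    by (rule integral_norm_bound_real[OF i']) simp
  also have "\<dots> \<le> m" unfolding m_def
    by (rule integral_subset_le[OF _ i'(2) i]) (use x in auto)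
  finally have "(integral {0..x} f)\<^sup>2 \<le> m\<^sup>2" by (rule abs_le_square_iff[THEN iffD1, OF order_trans]) simp
  also have "m\<^sup>2 \<le> integral {0..1} (\<lambda>x. (f x)\<^sup>2)"
  proof -
    have "(\<lambda>x. (\<bar>f x\<bar> - m)\<^sup>2) = (\<lambda>x. (f x)\<^sup>2 - 2 * m * \<bar>f x\<bar> + m\<^sup>2)"
      by (auto simp: power2_diff)
    moreover have j: "(\<lambda>x. (f x)\<^sup>2 - 2 * m * \<bar>f x\<bar>) integrable_on {0..1}"
      by (intro integrable_diff L2fun_sq f integrable_on_mult_right i)
    ultimately have "integral {0..1} (\<lambda>x. (\<bar>f x\<bar> - m)\<^sup>2) = integral {0..1} (\<lambda>x. (f x)\<^sup>2 - 2 * m * \<bar>f x\<bar>) + m\<^sup>2"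
      using Henstock_Kurzweil_Integration.integral_add[OF j integrable_const_ivl[of "m\<^sup>2"]] by simp
    also have "integral {0..1} (\<lambda>x. (f x)\<^sup>2 - 2 * m * \<bar>f x\<bar>) = integral {0..1} (\<lambda>x. (f x)\<^sup>2) - 2 * m * m"
      using L2fun_sq[OF f] integrable_on_mult_right[OF i, of "2 * m"]
      by (simp add: Henstock_Kurzweil_Integration.integral_diff m_def)
    finally have "integral {0..1} (\<lambda>x. (\<bar>f x\<bar> - m)\<^sup>2) = integral {0..1} (\<lambda>x. (f x)\<^sup>2) - m\<^sup>2"
      by (simp add: power2_eq_square)
    moreover have "0 \<le> integral {0..1} (\<lambda>x. (\<bar>f x\<bar> - m)\<^sup>2)"
      using \<open>(\<lambda>x. (\<bar>f x\<bar> - m)\<^sup>2) = _\<close> j by (intro Henstock_Kurzweil_Integration.integral_nonneg) (auto intro: integrable_add)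
    ultimately show ?thesis by simp
  qed
  finally show ?thesis .
qed

lemma ac_deriv_oscillation:
  assumes D: "ac_deriv D D'" and per: "periodic1 D" and D': "L2fun D'"
  shows "(D x - D 0)\<^sup>2 \<le> integral {0..1} (\<lambda>x. (D' x)\<^sup>2)"
proof -
  have "D (frac x) - D 0 = integral {0..frac x} D'" by (rule ac_derivD(3)[OF D]) simp
  then show ?thesis using square_integral_le[OF D' frac_unit[of x]] periodic_frac[OF per, of x] by simp
qed

lemma square_add_le: "(a + b)\<^sup>2 \<le> 2 * a\<^sup>2 + 2 * (b::real)\<^sup>2"
  using sum_squares_bound[of a b] by (simp add: power2_sum)

text \<open>The one-dimensional Sobolev inequality: averaging over \<open>y\<close> a bound of \<open>D x\<close> by \<open>D y\<close> and the
oscillation of \<open>D\<close>.\<close>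

lemma ac_deriv_sup_bound:
  assumes D: "ac_deriv D D'" and per: "periodic1 D" and D': "L2fun D'"
  shows "(D x)\<^sup>2 \<le> 2 * integral {0..1} (\<lambda>x. (D x)\<^sup>2) + 8 * integral {0..1} (\<lambda>x. (D' x)\<^sup>2)"
proof -
  let ?I = "integral {0..1} (\<lambda>x. (D' x)\<^sup>2)"
  have L: "L2fun D" using L2fun_continuous[OF ac_deriv_continuous[OF D] per] .
  have "(D x)\<^sup>2 \<le> 2 * (D y)\<^sup>2 + 8 * ?I" for y
  proof -
    have "(D x)\<^sup>2 \<le> 2 * (D y)\<^sup>2 + 2 * (D x - D y)\<^sup>2" using square_add_le[of "D y" "D x - D y"] by simp
    moreover have "(D x - D y)\<^sup>2 \<le> 2 * (D x - D 0)\<^sup>2 + 2 * (D y - D 0)\<^sup>2"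
      using square_add_le[of "D x - D 0" "- (D y - D 0)"] by (simp add: power2_commute[of "D 0"])
    ultimately show ?thesis
      using ac_deriv_oscillation[OF assms, of x] ac_deriv_oscillation[OF assms, of y] by linarith
  qed
  then have "integral {0..1} (\<lambda>y::real. (D x)\<^sup>2) \<le> integral {0..1} (\<lambda>y. 2 * (D y)\<^sup>2 + 8 * ?I)"
    using L2fun_sq[OF L] by (intro integral_le integrable_add integrable_on_mult_right) auto
  also have "\<dots> = 2 * integral {0..1} (\<lambda>x. (D x)\<^sup>2) + 8 * ?I"
    using L2fun_sq[OF L] by (subst Henstock_Kurzweil_Integration.integral_add) (auto intro: integrable_on_mult_right)
  finally show ?thesis by simp
qed

text \<open>A continuous curve in \<open>H\<^bsup>m+\<sigma>\<^esup>\<close>, described through its derivatives.  The condition at the point 0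
fixes the constant of integration continuously in time.  This form reduces every closure
property to the bottom level by induction on \<open>m\<close>.\<close>

primrec sob_family :: "real \<Rightarrow> nat \<Rightarrow> (real \<Rightarrow> real \<Rightarrow> real) \<Rightarrow> bool" where
  "sob_family \<sigma> 0 F = sob_cont \<sigma> F"
| "sob_family \<sigma> (Suc m) F = (\<exists>F'. sob_family \<sigma> m F' \<and> (\<forall>t. ac_deriv (F t) (F' t) \<and> periodic1 (F t))
      \<and> continuous_on UNIV (\<lambda>t. F t 0))"

text \<open>A derivative that is continuous in time in \<open>L\<^sup>2\<close> controls the oscillation uniformly in space, so the
functions themselves vary continuously in the supremum norm.\<close>

lemma sob_family_1_jcont:
  assumes "sob_family 0 (Suc 0) F" shows "jcont F"
proof -
  obtain F' where F': "sob_cont 0 F'" "\<And>t. ac_deriv (F t) (F' t)" "\<And>t. periodic1 (F t)" "continuous_on UNIV (\<lambda>t. F t 0)"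
    using assms by auto
  have L: "L2fun (F' t)" for t using sob_contD(2)[OF F'(1)] .
  define h where "h t \<tau> = 2 * (F \<tau> 0 - F t 0)\<^sup>2 + 2 * sob_sq 0 (\<lambda>x. F' \<tau> x - F' t x)" for t \<tau>
  have sup: "(F \<tau> x - F t x)\<^sup>2 \<le> h t \<tau>" for \<tau> t x
  proof -
    have p: "periodic1 (\<lambda>x. F \<tau> x - F t x)" using F'(3) by (simp add: periodic1_def)
    have "(F \<tau> x - F t x)\<^sup>2 \<le> 2 * (F \<tau> 0 - F t 0)\<^sup>2 + 2 * ((F \<tau> x - F t x) - (F \<tau> 0 - F t 0))\<^sup>2"
      using square_add_le[of "F \<tau> 0 - F t 0" "(F \<tau> x - F t x) - (F \<tau> 0 - F t 0)"] by simp
    then show ?thesis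
      using ac_deriv_oscillation[OF ac_deriv_diff[OF F'(2) F'(2)] p L2fun_diff[OF L L], of x]
      unfolding h_def by (simp add: sob_sq_0 L2fun_diff L)
  qed
  have h0: "(h t \<longlongrightarrow> 0) (at t)" for t
  proof -
    have "((\<lambda>\<tau>. F \<tau> 0) \<longlongrightarrow> F t 0) (at t)" using F'(4) by (simp add: continuous_on_def)
    then have "((\<lambda>\<tau>. 2 * (F \<tau> 0 - F t 0)\<^sup>2 + 2 * sob_sq 0 (\<lambda>x. F' \<tau> x - F' t x)) \<longlongrightarrow> 2 * (F t 0 - F t 0)\<^sup>2 + 2 * 0) (at t)"
      by (intro tendsto_intros sob_contD(3)[OF F'(1)])
    then show ?thesis by (simp add: h_def[abs_def])
  qed
  show ?thesis unfolding jcont_def continuous_on_eq_continuous_at[OF open_UNIV]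
  proof
    fix z :: "real \<times> real"
    obtain t x where z: "z = (t, x)" by (cases z)
    show "isCont (\<lambda>z. F (fst z) (snd z)) z"
      unfolding continuous_at_eps_delta
    proof (intro allI impI)
      fix e :: real assume e: "e > 0"
      have "\<forall>\<^sub>F \<tau> in at t. h t \<tau> < (e/2)\<^sup>2" by (rule order_tendstoD(2)[OF h0]) (use e in simp)
      then obtain d1 where d1: "d1 > 0" "\<And>\<tau>. \<tau> \<noteq> t \<Longrightarrow> dist \<tau> t < d1 \<Longrightarrow> h t \<tau> < (e/2)\<^sup>2"
        by (auto simp: eventually_at)
      have "isCont (F t) x" using ac_deriv_continuous[OF F'(2), of UNIV t] by (simp add: continuous_on_eq_continuous_at)
      then obtain d2 where d2: "d2 > 0" "\<And>y. dist y x < d2 \<Longrightarrow> dist (F t y) (F t x) < e/2"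
        unfolding continuous_at_eps_delta using e half_gt_zero by fast
      show "\<exists>d>0. \<forall>z'. dist z' z < d \<longrightarrow> dist (F (fst z') (snd z')) (F (fst z) (snd z)) < e"
      proof (intro exI[of _ "min d1 d2"] conjI allI impI)
        fix z' assume "dist z' z < min d1 d2"
        then have c: "dist (fst z') t < d1" "dist (snd z') x < d2"
          using dist_fst_le[of z' z] dist_snd_le[of z' z] by (auto simp: z)
        have "\<bar>F (fst z') (snd z') - F t (snd z')\<bar> < e/2"
        proof (cases "fst z' = t")
          case False
          have "(F (fst z') (snd z') - F t (snd z'))\<^sup>2 < (e/2)\<^sup>2"
            using sup[where \<tau>="fst z'" and x="snd z'" and t=t] d1(2)[OF False c(1)] by linarith
          then show ?thesis
            using power_less_imp_less_base[of "\<bar>F (fst z') (snd z') - F t (snd z')\<bar>" 2 "e/2"] e by simp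
        qed (use e in simp)
        then show "dist (F (fst z') (snd z')) (F (fst z) (snd z)) < e"
          using d2(2)[OF c(2)] unfolding z dist_real_def fst_conv snd_conv by linarith
      qed (use d1(1) d2(1) in simp)
    qed
  qed
qed

lemma sob_family_1_sob_cont:
  assumes "sob_family 0 (Suc 0) F" shows "sob_cont 1 F"
proof -
  obtain F' where F': "sob_cont 0 F'" "\<And>t. ac_deriv (F t) (F' t)" "\<And>t. periodic1 (F t)" "continuous_on UNIV (\<lambda>t. F t 0)"
    using assms by auto
  have L: "L2fun (F' t)" for t using sob_contD(2)[OF F'(1)] .
  have c0: "sob_cont 0 F" by (intro sob_cont_jcont sob_family_1_jcont assms F')
  show ?thesis unfolding sob_cont_def
  proof (intro conjI allI)
    fix t
    show "hsp 1 (F t)" by (rule hsp_1(1)[OF F'(2,3) L])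
    have p: "periodic1 (\<lambda>x. F \<tau> x - F t x)" for \<tau> using F'(3) by (simp add: periodic1_def)
    have e: "sob_sq 1 (\<lambda>x. F \<tau> x - F t x) = sob_sq 0 (\<lambda>x. F \<tau> x - F t x) + 1 / (4 * pi\<^sup>2) * sob_sq 0 (\<lambda>x. F' \<tau> x - F' t x)" for \<tau>
      using hsp_1(2)[OF ac_deriv_diff[OF F'(2) F'(2)] p L2fun_diff[OF L L]]
      by (simp add: sob_sq_0 L2fun_diff L sob_contD(2)[OF c0])
    have "((\<lambda>\<tau>. sob_sq 0 (\<lambda>x. F \<tau> x - F t x) + 1 / (4 * pi\<^sup>2) * sob_sq 0 (\<lambda>x. F' \<tau> x - F' t x)) \<longlongrightarrow> 0 + 1 / (4 * pi\<^sup>2) * 0) (at t)"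
      by (intro tendsto_intros sob_contD(3)[OF F'(1)] sob_contD(3)[OF c0])
    then show "((\<lambda>\<tau>. sob_sq 1 (\<lambda>x. F \<tau> x - F t x)) \<longlongrightarrow> 0) (at t)" by (simp only: e) simp
  qed
qed

section \<open>Weighted composition operators\<close>

lemma L2fun_mult_continuous:
  assumes f: "L2fun f" and h: "continuous_on UNIV h" "periodic1 h"
  shows "L2fun (\<lambda>x. h x * f x)"
  unfolding L2fun_def
proof (intro conjI)
  show "periodic1 (\<lambda>x. h x * f x)" using f h by (simp add: L2fun_def periodic1_def)
  show "(\<lambda>x. h x * f x) \<in> borel_measurable borel"
    using f borel_measurable_continuous_onI[OF h(1)] by (intro borel_measurable_times) (auto simp: L2fun_def)
  have A: "(\<lambda>x. f x * f x) absolutely_integrable_on {0..1}"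
    using L2fun_mult[OF f f] by (simp add: circle_integrable_def)
  have B: "continuous_on {0..1} (\<lambda>x. h x * h x)"
    by (intro continuous_on_mult continuous_on_subset[OF h(1)]) auto
  have "(\<lambda>x. (h x * h x) * (f x * f x)) integrable_on {0..1}"
    by (rule abs_integrable_imp[OF abs_integrable_mult_bounded(1)[OF A B]])
  then show "(\<lambda>x. (h x * f x)\<^sup>2) integrable_on {0..1}"
    by (simp add: power2_eq_square mult_ac)
qed

text \<open>The square of \<open>b \<cdot> (f \<circ> g)\<close> is \<open>b\<^sup>2 / \<gamma>\<close> times the integrand \<open>\<gamma> \<cdot> (f \<circ> g)\<^sup>2\<close>, which the substitution
\<open>y = g x\<close> turns into \<open>f\<^sup>2\<close> over one period.\<close>

lemma weighted_composition_L2: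
  assumes b: "continuous_on UNIV b" "periodic1 b" "\<And>x. \<bar>b x\<bar> \<le> K"
    and g: "\<And>x. (g has_real_derivative \<gamma> x) (at x)" "\<And>x. g (x + 1) = g x + 1"
    and \<gamma>: "continuous_on UNIV \<gamma>" "0 < \<delta>" "\<And>x. \<delta> \<le> \<gamma> x"
    and f: "L2fun f"
  shows "L2fun (\<lambda>x. b x * f (g x))"
    and "integral {0..1} (\<lambda>x. (b x * f (g x))\<^sup>2) \<le> K\<^sup>2 / \<delta> * integral {0..1} (\<lambda>x. (f x)\<^sup>2)"
proof -
  have pos: "\<gamma> x > 0" for x using \<gamma>(2) \<gamma>(3)[of x] by linarith
  have K: "0 \<le> K" using b(3)[of 0] by linarith
  have gc: "continuous_on UNIV g" using g(1) by (meson DERIV_isCont continuous_at_imp_continuous_on)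
  have per: "f (x + 1) = f x" for x using f by (simp add: L2fun_def periodic1_def)
  have fm: "f \<in> borel_measurable borel" using f by (simp add: L2fun_def)
  have f2: "(\<lambda>x. (f x)\<^sup>2) absolutely_integrable_on {0..1}"
    using L2fun_mult[OF f f] by (simp add: circle_integrable_def power2_eq_square)
  have per2: "(f (x + 1))\<^sup>2 = (f x)\<^sup>2" for x by (simp add: per)
  note f2a = periodic_abs_integrable[OF per2 f2]
  have g1: "g 1 = g 0 + 1" using g(2)[of 0] by simp
  note sub = integral_substitution_increasing[OF g(1) pos f2a, of 0 1]
  have si: "(\<lambda>x. \<gamma> x * (f (g x))\<^sup>2) absolutely_integrable_on {0..1}" using sub(1) by simp
  have eq: "integral {0..1} (\<lambda>x. \<gamma> x * (f (g x))\<^sup>2) = integral {0..1} (\<lambda>x. (f x)\<^sup>2)"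
    using sub(2) periodic_integral[OF per2 f2, of "g 0"] by (simp add: g1)
  have cw: "continuous_on {0..1} (\<lambda>x. (b x)\<^sup>2 / \<gamma> x)"
    using pos by (intro continuous_intros continuous_on_subset[OF b(1)] continuous_on_subset[OF \<gamma>(1)]) (auto simp: less_imp_neq[symmetric])
  have e: "(b x)\<^sup>2 / \<gamma> x * (\<gamma> x * (f (g x))\<^sup>2) = (b x * f (g x))\<^sup>2" for x
    using pos[of x] by (simp add: power_mult_distrib)
  have i: "(\<lambda>x. (b x * f (g x))\<^sup>2) integrable_on {0..1}"
    using abs_integrable_imp[OF abs_integrable_mult_bounded(1)[OF si cw]] unfolding e .
  show "L2fun (\<lambda>x. b x * f (g x))"
    unfolding L2fun_def
  proof (intro conjI i)
    show "periodic1 (\<lambda>x. b x * f (g x))" using b(2) by (simp add: periodic1_def g(2) per)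
    show "(\<lambda>x. b x * f (g x)) \<in> borel_measurable borel"
      by (intro borel_measurable_times borel_measurable_continuous_onI b(1) measurable_compose[OF borel_measurable_continuous_onI[OF gc] fm])
  qed
  have "integral {0..1} (\<lambda>x. (b x * f (g x))\<^sup>2) \<le> integral {0..1} (\<lambda>x. K\<^sup>2 / \<delta> * (\<gamma> x * (f (g x))\<^sup>2))"
  proof (rule integral_le[OF i])
    show "(\<lambda>x. K\<^sup>2 / \<delta> * (\<gamma> x * (f (g x))\<^sup>2)) integrable_on {0..1}"
      by (intro integrable_on_mult_right abs_integrable_imp[OF si])
    fix x
    have "(b x)\<^sup>2 \<le> K\<^sup>2" using b(3)[of x] K by (simp add: abs_le_square_iff[symmetric])
    then have "(b x)\<^sup>2 / \<gamma> x \<le> K\<^sup>2 / \<delta>" using \<gamma>(2) \<gamma>(3)[of x] by (intro frac_le) auto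
    then have "(b x)\<^sup>2 / \<gamma> x * (\<gamma> x * (f (g x))\<^sup>2) \<le> K\<^sup>2 / \<delta> * (\<gamma> x * (f (g x))\<^sup>2)"
      using pos[of x] by (intro mult_right_mono) auto
    then show "(b x * f (g x))\<^sup>2 \<le> K\<^sup>2 / \<delta> * (\<gamma> x * (f (g x))\<^sup>2)" unfolding e .
  qed
  then show "integral {0..1} (\<lambda>x. (b x * f (g x))\<^sup>2) \<le> K\<^sup>2 / \<delta> * integral {0..1} (\<lambda>x. (f x)\<^sup>2)"
    by (simp add: eq)
qed

lemma integral_square_add_le:
  assumes "L2fun f" "L2fun g"
  shows "integral {0..1} (\<lambda>x. (f x + g x)\<^sup>2) \<le> 2 * integral {0..1} (\<lambda>x. (f x)\<^sup>2) + 2 * integral {0..1} (\<lambda>x. (g x)\<^sup>2)"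
proof -
  have i: "(\<lambda>x. 2 * (f x)\<^sup>2) integrable_on {0..1}" "(\<lambda>x. 2 * (g x)\<^sup>2) integrable_on {0..1}"
    by (intro integrable_on_mult_right L2fun_sq assms)+
  have "integral {0..1} (\<lambda>x. (f x + g x)\<^sup>2) \<le> integral {0..1} (\<lambda>x. 2 * (f x)\<^sup>2 + 2 * (g x)\<^sup>2)"
    by (intro integral_le L2fun_sq L2fun_add assms integrable_add i square_add_le)
  also have "\<dots> = 2 * integral {0..1} (\<lambda>x. (f x)\<^sup>2) + 2 * integral {0..1} (\<lambda>x. (g x)\<^sup>2)"
    using Henstock_Kurzweil_Integration.integral_add[OF i] by simp
  finally show ?thesis .
qed

text \<open>In the product rule, \<open>b'\<close> is only square integrable and is paired with the supremum bound of \<open>f\<close>;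
the other term is again a weighted composition, with weight \<open>b \<cdot> \<gamma>\<close>.\<close>

lemma weighted_composition_H1:
  assumes b: "ac_deriv b b'" "periodic1 b" "L2fun b'" "\<And>x. \<bar>b x\<bar> \<le> K" "integral {0..1} (\<lambda>x. (b' x)\<^sup>2) \<le> K"
    and g: "\<And>x. (g has_real_derivative \<gamma> x) (at x)" "\<And>x. g (x + 1) = g x + 1"
    and \<gamma>: "continuous_on UNIV \<gamma>" "periodic1 \<gamma>" "0 < \<delta>" "\<And>x. \<delta> \<le> \<gamma> x" "\<And>x. \<gamma> x \<le> K"
    and f: "ac_deriv f f'" "periodic1 f" "L2fun f'"
  shows "hsp 1 (\<lambda>x. b x * f (g x))"
    and "sob_sq 1 (\<lambda>x. b x * f (g x)) \<le> (K\<^sup>2 / \<delta> + 20 * K + 2 * ((K\<^sup>2)\<^sup>2 / \<delta>)) * sob_sq 1 f"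
proof -
  let ?q' = "\<lambda>x. b' x * f (g x) + b x * (f' (g x) * \<gamma> x)"
  let ?I = "integral {0..1} (\<lambda>x. (f x)\<^sup>2)" and ?J = "integral {0..1} (\<lambda>x. (f' x)\<^sup>2)"
  let ?c = "1 / (4 * pi\<^sup>2)"
  have pos: "\<gamma> x > 0" for x using \<gamma>(3) \<gamma>(4)[of x] by linarith
  have K: "0 \<le> K" using b(4)[of 0] by linarith
  have bc: "continuous_on UNIV b" and fc: "continuous_on UNIV f" using ac_deriv_continuous b(1) f(1) by auto
  have fL: "L2fun f" by (rule L2fun_continuous[OF fc f(2)])
  have gc: "continuous_on UNIV g" using g(1) by (meson DERIV_isCont continuous_at_imp_continuous_on)
  have fgc: "continuous_on UNIV (\<lambda>x. f (g x))" by (rule continuous_on_compose2[OF fc gc]) simp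
  have fgp: "periodic1 (\<lambda>x. f (g x))" using f(2) by (simp add: periodic1_def g(2))
  have q: "ac_deriv (\<lambda>x. b x * f (g x)) ?q'"
    by (rule ac_deriv_mult[OF b(1) ac_deriv_compose[OF f(1) g(1) pos]])
  have qp: "periodic1 (\<lambda>x. b x * f (g x))" using b(2) fgp by (simp add: periodic1_def)
  note q0 = weighted_composition_L2[OF bc b(2,4) g \<gamma>(1,3,4) fL]
  have bgc: "continuous_on UNIV (\<lambda>x. b x * \<gamma> x)" by (intro continuous_on_mult bc \<gamma>(1))
  have bgp: "periodic1 (\<lambda>x. b x * \<gamma> x)" using b(2) \<gamma>(2) by (simp add: periodic1_def)
  have bgb: "\<bar>b x * \<gamma> x\<bar> \<le> K\<^sup>2" for x
    unfolding abs_mult power2_eq_square using b(4)[of x] \<gamma>(5)[of x] pos[of x] K by (intro mult_mono) auto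
  note r2 = weighted_composition_L2[OF bgc bgp bgb g \<gamma>(1,3,4) f(3)]
  have e: "b' x * f (g x) + b x * (f' (g x) * \<gamma> x) = f (g x) * b' x + (b x * \<gamma> x) * f' (g x)" for x
    by (simp add: algebra_simps)
  have r1: "L2fun (\<lambda>x. f (g x) * b' x)" by (rule L2fun_mult_continuous[OF b(3) fgc fgp])
  have q'L: "L2fun ?q'" unfolding e by (rule L2fun_add[OF r1 r2(1)])
  have IJ: "0 \<le> ?I" "0 \<le> ?J" by (auto intro!: Henstock_Kurzweil_Integration.integral_nonneg L2fun_sq fL f(3))
  have "integral {0..1} (\<lambda>x. (f (g x) * b' x)\<^sup>2) \<le> integral {0..1} (\<lambda>x. (2 * ?I + 8 * ?J) * (b' x)\<^sup>2)"
  proof (rule integral_le[OF L2fun_sq[OF r1] integrable_on_mult_right[OF L2fun_sq[OF b(3)]]])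
    fix x
    show "(f (g x) * b' x)\<^sup>2 \<le> (2 * ?I + 8 * ?J) * (b' x)\<^sup>2"
      unfolding power_mult_distrib by (intro mult_right_mono ac_deriv_sup_bound f) auto
  qed
  also have "\<dots> = (2 * ?I + 8 * ?J) * integral {0..1} (\<lambda>x. (b' x)\<^sup>2)" by simp
  also have "\<dots> \<le> (2 * ?I + 8 * ?J) * K" using IJ by (intro mult_left_mono b(5)) auto
  finally have 1: "integral {0..1} (\<lambda>x. (f (g x) * b' x)\<^sup>2) \<le> (2 * ?I + 8 * ?J) * K" .
  have 2: "integral {0..1} (\<lambda>x. (?q' x)\<^sup>2) \<le> 2 * ((2 * ?I + 8 * ?J) * K) + 2 * ((K\<^sup>2)\<^sup>2 / \<delta> * ?J)"
    unfolding e using integral_square_add_le[OF r1 r2(1)] 1 r2(2) by linarith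
  show "hsp 1 (\<lambda>x. b x * f (g x))" by (rule hsp_1(1)[OF q qp q'L])
  have alg: "k * I + c * (2 * ((2 * I + 8 * J) * K) + 2 * (Z * J)) = (k + c * (4 * K)) * I + (16 * K + 2 * Z) * (c * J)"
    for k I J c Z :: real by (simp add: algebra_simps)
  define H where "H = K\<^sup>2 / \<delta> + 20 * K + 2 * ((K\<^sup>2)\<^sup>2 / \<delta>)"
  have "1 \<le> pi\<^sup>2" using pi_ge_two by (intro one_le_power) simp
  then have "1 \<le> 4 * pi\<^sup>2" by simp
  then have c: "0 < ?c" "?c \<le> 1" by auto
  have "sob_sq 1 (\<lambda>x. b x * f (g x)) \<le> K\<^sup>2 / \<delta> * ?I + ?c * (2 * ((2 * ?I + 8 * ?J) * K) + 2 * ((K\<^sup>2)\<^sup>2 / \<delta> * ?J))"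
    unfolding hsp_1(2)[OF q qp q'L] using q0(2) 2 c by (intro add_mono mult_left_mono) auto
  also have "\<dots> = (K\<^sup>2 / \<delta> + ?c * (4 * K)) * ?I + (16 * K + 2 * ((K\<^sup>2)\<^sup>2 / \<delta>)) * (?c * ?J)"
    by (rule alg)
  also have "\<dots> \<le> H * ?I + H * (?c * ?J)"
  proof (intro add_mono mult_right_mono)
    have "?c * (4 * K) \<le> 1 * (4 * K)" using c K by (intro mult_right_mono) auto
    moreover have "0 \<le> 2 * ((K\<^sup>2)\<^sup>2 / \<delta>)" "0 \<le> K\<^sup>2 / \<delta>" using \<gamma>(3) by auto
    ultimately show "K\<^sup>2 / \<delta> + ?c * (4 * K) \<le> H" "16 * K + 2 * ((K\<^sup>2)\<^sup>2 / \<delta>) \<le> H"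
      unfolding H_def using K by linarith+
  qed (use IJ c in auto)
  also have "\<dots> = H * sob_sq 1 f" unfolding hsp_1(2)[OF f] by (simp add: distrib_left)
  finally show "sob_sq 1 (\<lambda>x. b x * f (g x)) \<le> (K\<^sup>2 / \<delta> + 20 * K + 2 * ((K\<^sup>2)\<^sup>2 / \<delta>)) * sob_sq 1 f"
    unfolding H_def .
qed

lemma ac_deriv_trig_poly:
  "ac_deriv (trig_poly N a) (trig_poly N (\<lambda>k. 2 * pi * real_of_int k * \<i> * a k))"
proof (rule ac_deriv_C1[OF _ trig_poly_continuous])
  fix x
  have "(trig_mode c k has_real_derivative trig_mode (2 * pi * real_of_int k * \<i> * c) k x) (at x)" for c k
    unfolding trig_mode_cos_sin[abs_def] by (auto intro!: derivative_eq_intros simp: algebra_simps)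
  then show "(trig_poly N a has_real_derivative trig_poly N (\<lambda>k. 2 * pi * real_of_int k * \<i> * a k) x) (at x)"
    unfolding trig_poly_def[abs_def] by (intro DERIV_sum)
qed

text \<open>The operator is linear, so it maps the high and low frequencies of \<open>f\<close> to the two parts required by
\<open>interpolation\<close>.\<close>

lemma weighted_composition_sobolev:
  assumes \<sigma>: "0 < \<sigma>" "\<sigma> < 1"
    and b: "ac_deriv b b'" "periodic1 b" "L2fun b'" "\<And>x. \<bar>b x\<bar> \<le> K" "integral {0..1} (\<lambda>x. (b' x)\<^sup>2) \<le> K"
    and g: "\<And>x. (g has_real_derivative \<gamma> x) (at x)" "\<And>x. g (x + 1) = g x + 1"
    and \<gamma>: "continuous_on UNIV \<gamma>" "periodic1 \<gamma>" "0 < \<delta>" "\<And>x. \<delta> \<le> \<gamma> x" "\<And>x. \<gamma> x \<le> K"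
    and f: "hsp \<sigma> f"
  shows "hsp \<sigma> (\<lambda>x. b x * f (g x))"
    and "sob_sq \<sigma> (\<lambda>x. b x * f (g x)) \<le>
      4 powr \<sigma> * interp_const \<sigma> * (4 * (K\<^sup>2 / \<delta> + 20 * K + 2 * ((K\<^sup>2)\<^sup>2 / \<delta>))) * sob_sq \<sigma> f"
proof -
  define H where "H = K\<^sup>2 / \<delta> + 20 * K + 2 * ((K\<^sup>2)\<^sup>2 / \<delta>)"
  have K: "0 \<le> K" using b(4)[of 0] by linarith
  have H: "0 \<le> H" "K\<^sup>2 / \<delta> \<le> H" using K \<gamma>(3) by (auto simp: H_def)
  have bc: "continuous_on UNIV b" using ac_deriv_continuous b(1) by auto
  have fL: "L2fun f" by (rule hsp_L2[OF f])
  have rL: "L2fun (\<lambda>x. f x - trunc N f x)" for N by (intro L2fun_diff fL L2fun_trig_poly)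
  note q = weighted_composition_L2[OF bc b(2,4) g \<gamma>(1,3,4)]
  have tp: "periodic1 (trunc N f)" for N by (simp add: periodic1_def trig_poly_periodic)
  note t = weighted_composition_H1[OF b g \<gamma> ac_deriv_trig_poly tp L2fun_trig_poly]
  have a: "sob_sq 0 (\<lambda>x. b x * (f (g x) - trunc N f (g x))) \<le> H * sob_sq 0 (\<lambda>x. f x - trunc N f x)" for N
  proof -
    have "sob_sq 0 (\<lambda>x. b x * (f (g x) - trunc N f (g x))) \<le> K\<^sup>2 / \<delta> * sob_sq 0 (\<lambda>x. f x - trunc N f x)"
      using q[OF rL[of N]] by (simp add: sob_sq_0 rL)
    also have "\<dots> \<le> H * sob_sq 0 (\<lambda>x. f x - trunc N f x)" by (intro mult_right_mono H sob_sq_nonneg)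
    finally show ?thesis .
  qed
  have s: "b x * f (g x) = b x * (f (g x) - trunc N f (g x)) + b x * trunc N f (g x)" for N x
    by (simp add: right_diff_distrib)
  note I = interpolation[OF \<sigma> f q(1)[OF fL] H(1) s q(1)[OF rL] a t(1) t(2)[folded H_def]]
  show "hsp \<sigma> (\<lambda>x. b x * f (g x))" by (rule I(1))
  show "sob_sq \<sigma> (\<lambda>x. b x * f (g x)) \<le>
      4 powr \<sigma> * interp_const \<sigma> * (4 * (K\<^sup>2 / \<delta> + 20 * K + 2 * ((K\<^sup>2)\<^sup>2 / \<delta>))) * sob_sq \<sigma> f"
    using I(2) unfolding H_def .
qed

text \<open>A family of orientation preserving diffeomorphisms of the circle, lifted to the line, with its
spatial derivative \<open>\<gamma>\<close>.\<close>

definition flow :: "(real \<Rightarrow> real \<Rightarrow> real) \<Rightarrow> (real \<Rightarrow> real \<Rightarrow> real) \<Rightarrow> bool" where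
  "flow g \<gamma> \<longleftrightarrow> jcont g \<and> jcont \<gamma> \<and> (\<forall>t x. (g t has_real_derivative \<gamma> t x) (at x) \<and> \<gamma> t x > 0 \<and> g t (x + 1) = g t x + 1
     \<and> \<gamma> t (x + 1) = \<gamma> t x)"

lemma flowD:
  assumes "flow g \<gamma>"
  shows "jcont g" "jcont \<gamma>" "\<And>t x. (g t has_real_derivative \<gamma> t x) (at x)" "\<And>t x. \<gamma> t x > 0" "\<And>t x. g t (x + 1) = g t x + 1"
    "\<And>t. periodic1 (\<gamma> t)"
  using assms by (auto simp: flow_def periodic1_def)

lemma flow_id: "flow (\<lambda>t x. x) (\<lambda>t x. 1)"
  by (auto simp: flow_def jcont_def intro!: continuous_intros)

lemma nested_double_bound:
  fixes a p q x y z w :: real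
  assumes "a \<le> 2 * p + 2 * q" "p \<le> 2 * x + 2 * y" "q \<le> 2 * z + 2 * w"
  shows "a \<le> 2 * (2 * x + 2 * y) + 2 * (2 * z + 2 * w)"
proof -
  have "a \<le> 2 * p + 2 * q" by fact
  also have "\<dots> \<le> 2 * (2 * x + 2 * y) + 2 * (2 * z + 2 * w)"
    by (intro add_mono mult_left_mono assms) simp_all
  finally show ?thesis .
qed

text \<open>Operators that are locally uniformly bounded and strongly continuous on a dense set are strongly
continuous; the dense set consists of trigonometric polynomials, the approximants being
truncations of \<open>F t\<close> at the time in question.\<close>

lemma weighted_composition_strongly_continuous:
  assumes F: "sob_cont r F"
    and bound: "\<And>t0. \<exists>C\<ge>0. \<exists>d>0. \<forall>t f. \<bar>t - t0\<bar> < d \<longrightarrow> hsp r f \<longrightarrow>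
      hsp r (\<lambda>x. b t x * f (g t x)) \<and> sob_sq r (\<lambda>x. b t x * f (g t x)) \<le> C * sob_sq r f"
    and trig: "\<And>N a. sob_cont r (\<lambda>t x. b t x * trig_poly N a (g t x))"
  shows "sob_cont r (\<lambda>t x. b t x * F t (g t x))"
  unfolding sob_cont_def
proof (intro conjI allI)
  have map: "hsp r (\<lambda>x. b t x * f (g t x))" if "hsp r f" for t f
  proof -
    obtain C d where "d > 0" "\<And>\<tau> f. \<bar>\<tau> - t\<bar> < d \<Longrightarrow> hsp r f \<Longrightarrow> hsp r (\<lambda>x. b \<tau> x * f (g \<tau> x))"
      using bound[of t] by blast
    then show ?thesis using that by (metis abs_zero diff_self)
  qed
  fix t
  show "hsp r (\<lambda>x. b t x * F t (g t x))" by (intro map sob_contD F)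
  obtain C d where C: "C \<ge> 0" "d > 0" "\<And>\<tau> f. \<bar>\<tau> - t\<bar> < d \<Longrightarrow> hsp r f \<Longrightarrow> sob_sq r (\<lambda>x. b \<tau> x * f (g \<tau> x)) \<le> C * sob_sq r f"
    using bound[of t] by blast
  let ?f = "F t"
  have f: "hsp r ?f" by (rule sob_contD(1)[OF F])
  show "((\<lambda>\<tau>. sob_sq r (\<lambda>x. b \<tau> x * F \<tau> (g \<tau> x) - b t x * F t (g t x))) \<longlongrightarrow> 0) (at t)"
  proof (rule tendstoI)
    fix e :: real assume e: "e > 0"
    have "((\<lambda>N. 8 * C * sob_sq r (\<lambda>x. ?f x - trunc N ?f x)) \<longlonglongrightarrow> 8 * C * 0)"
      by (intro tendsto_intros sob_sq_rest_tendsto f)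
    then have "\<forall>\<^sub>F N in sequentially. 8 * C * sob_sq r (\<lambda>x. ?f x - trunc N ?f x) < e / 2"
      using e by (intro order_tendstoD(2)) auto
    then obtain N where N: "8 * C * sob_sq r (\<lambda>x. ?f x - trunc N ?f x) < e / 2"
      using eventually_happens'[OF sequentially_bot] by blast
    let ?p = "trunc N ?f"
    let ?r = "\<lambda>x. ?f x - ?p x"
    have r: "hsp r ?r" by (rule hsp_rest[OF f])
    have "((\<lambda>\<tau>. 4 * C * sob_sq r (\<lambda>x. F \<tau> x - F t x) + 4 * sob_sq r (\<lambda>x. b \<tau> x * ?p (g \<tau> x) - b t x * ?p (g t x))) \<longlongrightarrow> 4 * C * 0 + 4 * 0) (at t)"
      by (intro tendsto_intros sob_contD(3)[OF F] sob_contD(3)[OF trig])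
    then have "\<forall>\<^sub>F \<tau> in at t. 4 * C * sob_sq r (\<lambda>x. F \<tau> x - F t x) + 4 * sob_sq r (\<lambda>x. b \<tau> x * ?p (g \<tau> x) - b t x * ?p (g t x)) < e / 2"
      using e by (intro order_tendstoD(2)) auto
    moreover have "\<forall>\<^sub>F \<tau> in at t. \<bar>\<tau> - t\<bar> < d"
      using eventually_at_ball[OF C(2), of t UNIV] by eventually_elim (simp add: dist_real_def abs_minus_commute)
    ultimately show "\<forall>\<^sub>F \<tau> in at t. dist (sob_sq r (\<lambda>x. b \<tau> x * F \<tau> (g \<tau> x) - b t x * F t (g t x))) 0 < e"
    proof eventually_elim
      case (elim \<tau>)
      let ?A = "\<lambda>x. b \<tau> x * (F \<tau> (g \<tau> x) - F t (g \<tau> x))" and ?B = "\<lambda>x. b \<tau> x * (?f (g \<tau> x) - ?p (g \<tau> x))"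
        and ?C = "\<lambda>x. b t x * (?f (g t x) - ?p (g t x))" and ?D = "\<lambda>x. b \<tau> x * ?p (g \<tau> x) - b t x * ?p (g t x)"
      have d: "hsp r (\<lambda>x. F \<tau> x - F t x)" by (intro hsp_diff sob_contD F)
      have h: "hsp r ?A" "hsp r ?B" "hsp r ?C" "hsp r ?D"
        using map[OF d] map[OF r] hsp_diff(1)[OF sob_contD(1)[OF trig] sob_contD(1)[OF trig]] by auto
      have A: "sob_sq r ?A \<le> C * sob_sq r (\<lambda>x. F \<tau> x - F t x)" using C(3)[OF elim(2) d] .
      have B: "sob_sq r ?B \<le> C * sob_sq r ?r" using C(3)[OF elim(2) r] .
      have C': "sob_sq r ?C \<le> C * sob_sq r ?r" using C(3)[OF _ r, of t] C(2) by simp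
      (* F \<tau> is replaced by F t, then F t by the polynomial ?p at both times. *)
      have eq: "(\<lambda>x. b \<tau> x * F \<tau> (g \<tau> x) - b t x * F t (g t x)) = (\<lambda>x. (?A x + ?D x) + (?B x - ?C x))"
        by (auto simp: algebra_simps)
      have "sob_sq r (\<lambda>x. (?A x + ?D x) + (?B x - ?C x)) \<le> 2 * (2 * sob_sq r ?A + 2 * sob_sq r ?D) + 2 * (2 * sob_sq r ?B + 2 * sob_sq r ?C)"
        by (rule nested_double_bound[OF hsp_add(2)[OF hsp_add(1)[OF h(1,4)] hsp_diff(1)[OF h(2,3)]] hsp_add(2)[OF h(1,4)] hsp_diff(2)[OF h(2,3)]])
      also have "\<dots> \<le> (4 * C * sob_sq r (\<lambda>x. F \<tau> x - F t x) + 4 * sob_sq r ?D) + 8 * C * sob_sq r ?r"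
        using A B C' by simp
      also have "\<dots> < e" using elim(1) N by linarith
      finally show ?case unfolding eq by (simp add: sob_sq_nonneg)
    qed
  qed
qed

text \<open>In \<open>L\<^sup>2\<close> joint continuity of the weight suffices.  This is used where the regularity of a weight
such as the derivative of the inverse flow is still to be established.\<close>

lemma sob_cont_0_weighted_composition:
  assumes F: "sob_cont 0 F" and g: "flow g \<gamma>" and b: "jcont b" "\<And>t. periodic1 (b t)"
  shows "sob_cont 0 (\<lambda>t x. b t x * F t (g t x))"
proof (rule weighted_composition_strongly_continuous[OF F, where b = b and g = g])
  note gD = flowD[OF g]
  show "\<exists>C\<ge>0. \<exists>d>0. \<forall>t f. \<bar>t - t0\<bar> < d \<longrightarrow> hsp 0 f \<longrightarrow>
      hsp 0 (\<lambda>x. b t x * f (g t x)) \<and> sob_sq 0 (\<lambda>x. b t x * f (g t x)) \<le> C * sob_sq 0 f" for t0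
  proof -
    (* Compactness in time and space gives the constants of the operator bound near t0. *)
    obtain K where K: "K > 0" "\<And>t x. \<bar>t - t0\<bar> \<le> 1 \<Longrightarrow> \<bar>b t x\<bar> \<le> K" using jcont_bound[OF b] by metis
    obtain \<delta> where \<delta>: "\<delta> > 0" "\<And>t x. \<bar>t - t0\<bar> \<le> 1 \<Longrightarrow> \<delta> \<le> \<gamma> t x" using jcont_lower_bound[OF gD(2,6,4)] by metis
    have "\<forall>t f. \<bar>t - t0\<bar> < 1 \<longrightarrow> hsp 0 f \<longrightarrow>
      hsp 0 (\<lambda>x. b t x * f (g t x)) \<and> sob_sq 0 (\<lambda>x. b t x * f (g t x)) \<le> K\<^sup>2 / \<delta> * sob_sq 0 f"
    proof (intro conjI allI impI)
      fix t f assume "\<bar>t - t0\<bar> < 1" and f: "hsp 0 f"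
      then have t: "\<bar>t - t0\<bar> \<le> 1" by simp
      have fL: "L2fun f" using f by (simp add: hsp_0)
      note W = weighted_composition_L2[OF jcont_x[OF b(1)] b(2) K(2)[OF t] gD(3,5) jcont_x[OF gD(2)] \<delta>(1) \<delta>(2)[OF t] fL]
      show "hsp 0 (\<lambda>x. b t x * f (g t x))" using W(1) by (simp add: hsp_0)
      show "sob_sq 0 (\<lambda>x. b t x * f (g t x)) \<le> K\<^sup>2 / \<delta> * sob_sq 0 f" using W by (simp add: sob_sq_0 fL)
    qed
    moreover have "0 \<le> K\<^sup>2 / \<delta>" using \<delta> by simp
    ultimately show ?thesis using zero_less_one by blast
  qed
  fix N a
  show "sob_cont 0 (\<lambda>t x. b t x * trig_poly N a (g t x))"
  proof (rule sob_cont_jcont)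
    show "jcont (\<lambda>t x. b t x * trig_poly N a (g t x))"
      by (intro jcont_mult b jcont_comp[OF jcont_const_t gD(1)] trig_poly_continuous)
    show "periodic1 (\<lambda>x. b t x * trig_poly N a (g t x))" for t
      using b(2)[of t] by (simp add: periodic1_def gD(5) trig_poly_periodic)
  qed
qed

text \<open>For \<open>\<sigma> > 0\<close> the weight has to act on \<open>H\<^sup>1\<close> as well, which is why \<open>b\<close> carries one derivative, continuous
in time in \<open>L\<^sup>2\<close>.\<close>

lemma sob_cont_weighted_composition:
  assumes \<sigma>: "0 \<le> \<sigma>" "\<sigma> < 1" and F: "sob_cont \<sigma> F" and g: "flow g \<gamma>" and b: "sob_family 0 (Suc 0) b"
  shows "sob_cont \<sigma> (\<lambda>t x. b t x * F t (g t x))"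
proof -
  obtain b' where b': "sob_cont 0 b'" "\<And>t. ac_deriv (b t) (b' t)" "\<And>t. periodic1 (b t)" "continuous_on UNIV (\<lambda>t. b t 0)"
    using b by auto
  have bj: "jcont b" by (rule sob_family_1_jcont[OF b])
  note gD = flowD[OF g]
  show ?thesis
  proof (cases "\<sigma> = 0")
    case True
    then show ?thesis using sob_cont_0_weighted_composition[OF _ g bj b'(3)] F by simp
  next
    case False
    then have s: "0 < \<sigma>" using \<sigma> by simp
    show ?thesis
    proof (rule weighted_composition_strongly_continuous[OF F, where b = b and g = g])
      fix t0
      show "\<exists>C\<ge>0. \<exists>d>0. \<forall>t f. \<bar>t - t0\<bar> < d \<longrightarrow> hsp \<sigma> f \<longrightarrow>
        hsp \<sigma> (\<lambda>x. b t x * f (g t x)) \<and> sob_sq \<sigma> (\<lambda>x. b t x * f (g t x)) \<le> C * sob_sq \<sigma> f"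
      proof -
        have L: "L2fun (b' t)" for t by (rule sob_contD(2)[OF b'(1)])
        have "\<forall>\<^sub>F t in at t0. sob_sq 0 (\<lambda>x. b' t x - b' t0 x) < 1"
          by (rule order_tendstoD(2)[OF sob_contD(3)[OF b'(1)]]) simp
        then obtain d where d: "d > 0" "\<And>t. t \<noteq> t0 \<Longrightarrow> dist t t0 < d \<Longrightarrow> sob_sq 0 (\<lambda>x. b' t x - b' t0 x) < 1"
          by (auto simp: eventually_at)
        define B where "B = 2 + 2 * integral {0..1} (\<lambda>x. (b' t0 x)\<^sup>2)"
        have Bd: "integral {0..1} (\<lambda>x. (b' t x)\<^sup>2) \<le> B" if t: "\<bar>t - t0\<bar> < d" for t
        proof -
          have "sob_sq 0 (\<lambda>x. b' t x - b' t0 x) < 1"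
          proof (cases "t = t0")
            case True
            then show ?thesis using hsp_cmult(2)[OF sob_contD(1)[OF b'(1), of t0], of 0] by simp
          next
            case False
            then show ?thesis using d(2)[of t] t by (simp add: dist_real_def)
          qed
          then show ?thesis
            using integral_square_add_le[OF L2fun_diff[OF L L] L, of t t0 t0]
            by (simp add: B_def sob_sq_0 L2fun_diff L)
        qed
        obtain K1 where K1: "K1 > 0" "\<And>t x. \<bar>t - t0\<bar> \<le> 1 \<Longrightarrow> \<bar>b t x\<bar> \<le> K1" using jcont_bound[OF bj b'(3)] by metis
        obtain K2 where K2: "K2 > 0" "\<And>t x. \<bar>t - t0\<bar> \<le> 1 \<Longrightarrow> \<bar>\<gamma> t x\<bar> \<le> K2" using jcont_bound[OF gD(2,6)] by metis
        obtain \<delta> where \<delta>: "\<delta> > 0" "\<And>t x. \<bar>t - t0\<bar> \<le> 1 \<Longrightarrow> \<delta> \<le> \<gamma> t x" using jcont_lower_bound[OF gD(2,6,4)] by metis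
        define K where "K = max B (max K1 K2)"
        define C where "C = 4 powr \<sigma> * interp_const \<sigma> * (4 * (K\<^sup>2 / \<delta> + 20 * K + 2 * ((K\<^sup>2)\<^sup>2 / \<delta>)))"
        have "K > 0" using K1(1) by (simp add: K_def)
        then have C0: "C \<ge> 0" unfolding C_def using interp_base(3)[OF s \<sigma>(2)] \<delta>(1) by simp
        have "\<forall>t f. \<bar>t - t0\<bar> < min d 1 \<longrightarrow> hsp \<sigma> f \<longrightarrow>
          hsp \<sigma> (\<lambda>x. b t x * f (g t x)) \<and> sob_sq \<sigma> (\<lambda>x. b t x * f (g t x)) \<le> C * sob_sq \<sigma> f"
        proof (intro conjI allI impI)
          fix t f assume t: "\<bar>t - t0\<bar> < min d 1" and f: "hsp \<sigma> f"
          then have t1: "\<bar>t - t0\<bar> \<le> 1" by simp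
          have c1: "\<bar>b t x\<bar> \<le> K" for x using K1(2)[OF t1, of x] by (simp add: K_def)
          have c2: "\<gamma> t x \<le> K" for x using K2(2)[OF t1, of x] by (simp add: K_def)
          have c3: "integral {0..1} (\<lambda>x. (b' t x)\<^sup>2) \<le> K" using Bd[of t] t by (simp add: K_def)
          note W = weighted_composition_sobolev[OF s \<sigma>(2) b'(2,3) L c1 c3 gD(3,5) jcont_x[OF gD(2)] gD(6) \<delta>(1) \<delta>(2)[OF t1] c2 f]
          show "hsp \<sigma> (\<lambda>x. b t x * f (g t x))" by (rule W(1))
          show "sob_sq \<sigma> (\<lambda>x. b t x * f (g t x)) \<le> C * sob_sq \<sigma> f" using W(2) unfolding C_def .
        qed
        moreover have "0 < min d 1" using d(1) by simp
        ultimately show ?thesis using C0 by blast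
      qed
    next
      fix N a
      let ?p = "trig_poly N a" and ?p' = "trig_poly N (\<lambda>k. 2 * pi * real_of_int k * \<i> * a k)"
      have pg: "jcont (\<lambda>t x. ?p (g t x))" "jcont (\<lambda>t x. ?p' (g t x))"
        by (intro jcont_comp[OF jcont_const_t gD(1)] trig_poly_continuous)+
      have pp: "periodic1 (\<lambda>x. ?p (g t x))" for t by (simp add: periodic1_def gD(5) trig_poly_periodic)
      have "sob_cont 0 (\<lambda>t x. ?p (g t x) * b' t x + b t x * (?p' (g t x) * \<gamma> t x))"
      proof (rule sob_cont_add)
        show "sob_cont 0 (\<lambda>t x. ?p (g t x) * b' t x)"
          by (rule sob_cont_0_weighted_composition[OF b'(1) flow_id pg(1) pp])
        show "sob_cont 0 (\<lambda>t x. b t x * (?p' (g t x) * \<gamma> t x))"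
        proof (rule sob_cont_jcont)
          show "jcont (\<lambda>t x. b t x * (?p' (g t x) * \<gamma> t x))" by (intro jcont_mult bj pg gD(2))
          show "periodic1 (\<lambda>x. b t x * (?p' (g t x) * \<gamma> t x))" for t
            using b'(3)[of t] gD(6)[of t] by (simp add: periodic1_def gD(5) trig_poly_periodic)
        qed
      qed
      moreover have "ac_deriv (\<lambda>x. b t x * ?p (g t x)) (\<lambda>x. ?p (g t x) * b' t x + b t x * (?p' (g t x) * \<gamma> t x))" for t
        using ac_deriv_mult[OF b'(2) ac_deriv_compose[OF ac_deriv_trig_poly gD(3,4)], of t N a t] by (simp add: mult.commute)
      moreover have "periodic1 (\<lambda>x. b t x * ?p (g t x))" for t
        using b'(3)[of t] pp[of t] by (simp add: periodic1_def)
      moreover have "continuous_on UNIV (\<lambda>t. b t 0 * ?p (g t 0))"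
        by (rule jcont_t[OF jcont_mult[OF bj pg(1)]])
      ultimately have "sob_family 0 (Suc 0) (\<lambda>t x. b t x * ?p (g t x))"
        unfolding sob_family.simps
        by (intro exI[of _ "\<lambda>t x. ?p (g t x) * b' t x + b t x * (?p' (g t x) * \<gamma> t x)"]) blast
      then show "sob_cont \<sigma> (\<lambda>t x. b t x * ?p (g t x))"
        by (intro sob_cont_mono[OF sob_family_1_sob_cont]) (use \<sigma> in auto)
    qed
  qed
qed

section \<open>Algebra of Sobolev families\<close>

lemma sob_familyI:
  assumes "sob_family \<sigma> m F'" "\<And>t. ac_deriv (F t) (F' t)" "\<And>t. periodic1 (F t)" "continuous_on UNIV (\<lambda>t. F t 0)"
  shows "sob_family \<sigma> (Suc m) F"
  unfolding sob_family.simps using assms by blast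

lemma sob_familyE:
  assumes "sob_family \<sigma> (Suc m) F"
  obtains F' where "sob_family \<sigma> m F'" "\<And>t. ac_deriv (F t) (F' t)" "\<And>t. periodic1 (F t)" "continuous_on UNIV (\<lambda>t. F t 0)"
  using assms unfolding sob_family.simps by blast

lemma sob_family_sigma_mono: "sob_family \<sigma> m F \<Longrightarrow> \<sigma>' \<le> \<sigma> \<Longrightarrow> sob_family \<sigma>' m F"
proof (induction m arbitrary: F)
  case 0
  then show ?case by (simp add: sob_cont_mono)
next
  case (Suc m)
  from Suc.prems(1) obtain F' where F': "sob_family \<sigma> m F'" "\<And>t. ac_deriv (F t) (F' t)" "\<And>t. periodic1 (F t)" "continuous_on UNIV (\<lambda>t. F t 0)"
    by (rule sob_familyE) blast
  show ?case by (rule sob_familyI[OF Suc.IH[OF F'(1) Suc.prems(2)] F'(2-4)])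
qed

lemma sob_family_Suc: "sob_family \<sigma> (Suc m) F \<Longrightarrow> 0 \<le> \<sigma> \<Longrightarrow> \<sigma> \<le> 1 \<Longrightarrow> sob_family \<sigma> m F"
proof (induction m arbitrary: F)
  case 0
  then have "sob_family 0 (Suc 0) F" using sob_family_sigma_mono by blast
  then show ?case using sob_cont_mono[OF sob_family_1_sob_cont] 0 by simp
next
  case (Suc m)
  from Suc.prems(1) obtain F' where F': "sob_family \<sigma> (Suc m) F'" "\<And>t. ac_deriv (F t) (F' t)" "\<And>t. periodic1 (F t)" "continuous_on UNIV (\<lambda>t. F t 0)"
    by (rule sob_familyE) blast
  show ?case by (rule sob_familyI[OF Suc.IH[OF F'(1) Suc.prems(2,3)] F'(2-4)])
qed

lemma sob_family_le:
  assumes "sob_family \<sigma> m F" "n \<le> m" "0 \<le> \<sigma>" "\<sigma> \<le> 1" shows "sob_family \<sigma> n F"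
  using assms(2,1) by (induction rule: inc_induct) (auto intro: sob_family_Suc assms(3,4) simp del: sob_family.simps)

lemma sob_family_01: "sob_family \<sigma> (Suc m) F \<Longrightarrow> 0 \<le> \<sigma> \<Longrightarrow> \<sigma> \<le> 1 \<Longrightarrow> sob_family 0 (Suc 0) F"
  using sob_family_sigma_mono[OF sob_family_le[of \<sigma> "Suc m" F "Suc 0"]] by simp

lemma sob_family_jcont: "sob_family \<sigma> (Suc m) F \<Longrightarrow> 0 \<le> \<sigma> \<Longrightarrow> \<sigma> \<le> 1 \<Longrightarrow> jcont F"
  using sob_family_1_jcont sob_family_01 by blast

lemma sob_family_periodic: "sob_family \<sigma> (Suc m) F \<Longrightarrow> periodic1 (F t)"
  by (erule sob_familyE) blast

lemma sob_family_add: "sob_family \<sigma> m F \<Longrightarrow> sob_family \<sigma> m G \<Longrightarrow> sob_family \<sigma> m (\<lambda>t x. F t x + G t x)"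
proof (induction m arbitrary: F G)
  case 0
  then show ?case by (simp add: sob_cont_add)
next
  case (Suc m)
  from Suc.prems(1) obtain F' where F': "sob_family \<sigma> m F'" "\<And>t. ac_deriv (F t) (F' t)" "\<And>t. periodic1 (F t)" "continuous_on UNIV (\<lambda>t. F t 0)"
    by (rule sob_familyE) blast
  from Suc.prems(2) obtain G' where G': "sob_family \<sigma> m G'" "\<And>t. ac_deriv (G t) (G' t)" "\<And>t. periodic1 (G t)" "continuous_on UNIV (\<lambda>t. G t 0)"
    by (rule sob_familyE) blast
  show ?case
  proof (rule sob_familyI[OF Suc.IH[OF F'(1) G'(1)] ac_deriv_add[OF F'(2) G'(2)]])
    show "periodic1 (\<lambda>x. F t x + G t x)" for t using F'(3)[of t] G'(3)[of t] by (simp add: periodic1_def)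
    show "continuous_on UNIV (\<lambda>t. F t 0 + G t 0)" by (intro continuous_on_add F' G')
  qed
qed

lemma hsp_zero: "hsp r (\<lambda>x. 0)" and sob_sq_zero: "sob_sq r (\<lambda>x. 0) = 0"
proof -
  have "hermitian (\<lambda>_. 0)" by (simp add: hermitian_def)
  from hsp_cmult[OF hsp_trig_poly[OF this, of r 0], of 0]
  show "hsp r (\<lambda>x. 0)" "sob_sq r (\<lambda>x. 0) = 0" by simp_all
qed

lemma sob_cont_const: "hsp r f \<Longrightarrow> sob_cont r (\<lambda>t. f)"
  by (simp add: sob_cont_def sob_sq_zero)

lemma sob_family_zero: "sob_family \<sigma> m (\<lambda>t x. 0)"
proof (induction m)
  case 0
  show ?case by (simp add: sob_cont_const hsp_zero)
next
  case (Suc m)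
  show ?case by (rule sob_familyI[OF Suc ac_deriv_const]) (auto simp: periodic1_def)
qed

lemma sob_family_time:
  assumes "continuous_on UNIV a" "0 \<le> \<sigma>" "\<sigma> \<le> 1" shows "sob_family \<sigma> m (\<lambda>t x. a t)"
proof -
  have "sob_family \<sigma> (Suc m) (\<lambda>t x. a t)"
    by (rule sob_familyI[OF sob_family_zero ac_deriv_const]) (use assms in \<open>auto simp: periodic1_def\<close>)
  then show ?thesis using assms by (rule_tac sob_family_Suc)
qed

text \<open>The factor \<open>G\<close> has one derivative more, so it is always smooth enough to act as a weight.  With this
asymmetric form the two terms of the product rule are covered by the same induction
hypothesis, with the roles of the factors exchanged in the second one.\<close>

lemma sob_family_mult_aux:
  assumes \<sigma>: "0 \<le> \<sigma>" "\<sigma> < 1"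
  shows "sob_family \<sigma> m F \<Longrightarrow> sob_family \<sigma> (Suc m) G \<Longrightarrow> sob_family \<sigma> m (\<lambda>t x. F t x * G t x)"
proof (induction m arbitrary: F G)
  case 0
  then have "sob_family 0 (Suc 0) G" using \<sigma> sob_family_01[of \<sigma> 0 G] by (simp del: sob_family.simps)
  from sob_cont_weighted_composition[OF \<sigma> _ flow_id this, of F] 0(1)
  show ?case by (simp add: mult.commute)
next
  case (Suc m)
  have s1: "\<sigma> \<le> 1" using \<sigma> by simp
  from Suc.prems(1) obtain F' where F': "sob_family \<sigma> m F'" "\<And>t. ac_deriv (F t) (F' t)" "\<And>t. periodic1 (F t)" "continuous_on UNIV (\<lambda>t. F t 0)"
    by (rule sob_familyE) blast
  from Suc.prems(2) obtain G' where G': "sob_family \<sigma> (Suc m) G'" "\<And>t. ac_deriv (G t) (G' t)" "\<And>t. periodic1 (G t)" "continuous_on UNIV (\<lambda>t. G t 0)"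
    by (rule sob_familyE) blast
  have 1: "sob_family \<sigma> m (\<lambda>t x. F' t x * G t x)"
    by (rule Suc.IH[OF F'(1) sob_family_Suc[OF Suc.prems(2) \<sigma>(1) s1]])
  have "sob_family \<sigma> m (\<lambda>t x. G' t x * F t x)"
    by (rule Suc.IH[OF sob_family_Suc[OF G'(1) \<sigma>(1) s1] Suc.prems(1)])
  then have 2: "sob_family \<sigma> m (\<lambda>t x. F t x * G' t x)" by (simp add: mult.commute)
  show ?case
  proof (rule sob_familyI[OF sob_family_add[OF 1 2] ac_deriv_mult[OF F'(2) G'(2)]])
    show "periodic1 (\<lambda>x. F t x * G t x)" for t using F'(3)[of t] G'(3)[of t] by (simp add: periodic1_def)
    show "continuous_on UNIV (\<lambda>t. F t 0 * G t 0)" by (intro continuous_on_mult F' G')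
  qed
qed

lemma sob_family_mult:
  assumes \<sigma>: "0 \<le> \<sigma>" "\<sigma> < 1" and F: "sob_family \<sigma> (Suc m) F" and G: "sob_family \<sigma> (Suc m) G"
  shows "sob_family \<sigma> (Suc m) (\<lambda>t x. F t x * G t x)"
proof -
  from F obtain F' where F': "sob_family \<sigma> m F'" "\<And>t. ac_deriv (F t) (F' t)" "\<And>t. periodic1 (F t)" "continuous_on UNIV (\<lambda>t. F t 0)"
    by (rule sob_familyE) blast
  from G obtain G' where G': "sob_family \<sigma> m G'" "\<And>t. ac_deriv (G t) (G' t)" "\<And>t. periodic1 (G t)" "continuous_on UNIV (\<lambda>t. G t 0)"
    by (rule sob_familyE) blast
  have 1: "sob_family \<sigma> m (\<lambda>t x. F' t x * G t x)" by (rule sob_family_mult_aux[OF \<sigma> F'(1) G])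
  have "sob_family \<sigma> m (\<lambda>t x. G' t x * F t x)" by (rule sob_family_mult_aux[OF \<sigma> G'(1) F])
  then have 2: "sob_family \<sigma> m (\<lambda>t x. F t x * G' t x)" by (simp add: mult.commute)
  show ?thesis
  proof (rule sob_familyI[OF sob_family_add[OF 1 2] ac_deriv_mult[OF F'(2) G'(2)]])
    show "periodic1 (\<lambda>x. F t x * G t x)" for t using F'(3)[of t] G'(3)[of t] by (simp add: periodic1_def)
    show "continuous_on UNIV (\<lambda>t. F t 0 * G t 0)" by (intro continuous_on_mult F' G')
  qed
qed

lemma sob_family_time_mult:
  assumes "continuous_on UNIV a" "0 \<le> \<sigma>" "\<sigma> < 1" "sob_family \<sigma> m F"
  shows "sob_family \<sigma> m (\<lambda>t x. a t * F t x)"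
  using sob_family_mult_aux[OF assms(2,3,4) sob_family_time[OF assms(1,2)]] assms(3) by (simp add: mult.commute)

text \<open>The derivative of \<open>1 / F\<close> contains \<open>1 / F\<close> again, so the regularity is raised step by step,
starting from joint continuity.\<close>

lemma sob_family_inverse:
  assumes \<sigma>: "0 \<le> \<sigma>" "\<sigma> < 1" and nz: "\<And>t x. F t x \<noteq> 0"
  shows "sob_family \<sigma> (Suc m) F \<Longrightarrow> sob_family \<sigma> (Suc m) (\<lambda>t x. inverse (F t x))"
proof (induction m)
  have s1: "\<sigma> \<le> 1" using \<sigma> by simp
  let ?i = "\<lambda>t x. inverse (F t x)"
  (* One differentiation step.  It is needed for s = 0 first, where multiplication by continuous
     functions is available, and only then for \<sigma>. *)
  have main: "sob_family s (Suc n) ?i"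
    if s: "0 \<le> s" "s < 1" and F: "sob_family s (Suc n) F"
      and i: "\<And>F'. sob_family s n F' \<Longrightarrow> sob_family s n (\<lambda>t x. (- 1) * ((?i t x * ?i t x) * F' t x))" for n s
  proof -
    from F obtain F' where F': "sob_family s n F'" "\<And>t. ac_deriv (F t) (F' t)" "\<And>t. periodic1 (F t)" "continuous_on UNIV (\<lambda>t. F t 0)"
      by (rule sob_familyE) blast
    show ?thesis
    proof (rule sob_familyI[OF i[OF F'(1)]])
      show "ac_deriv (?i t) (\<lambda>x. (- 1) * ((?i t x * ?i t x) * F' t x))" for t
        using ac_deriv_inverse[OF F'(2) nz, of t] by (simp add: power2_eq_square mult_ac)
      show "periodic1 (?i t)" for t using F'(3)[of t] by (simp add: periodic1_def)
      show "continuous_on UNIV (\<lambda>t. ?i t 0)" by (intro continuous_intros F'(4)) (simp add: nz)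
    qed
  qed
  {
    case 0
    then have F01: "sob_family 0 (Suc 0) F" using sob_family_01[OF _ \<sigma>(1) s1] by blast
    have per: "periodic1 (F t)" for t by (rule sob_family_periodic[OF F01])
    have ji: "jcont ?i" by (rule jcont_inverse[OF sob_family_1_jcont[OF F01] nz])
    have i01: "sob_family 0 (Suc 0) ?i"
    proof (rule main[OF _ _ F01])
      fix F' assume "sob_family 0 0 F'"
      then have "sob_cont 0 F'" by simp
      from sob_cont_0_weighted_composition[OF this flow_id, of "\<lambda>t x. (-1) * (?i t x * ?i t x)"]
      show "sob_family 0 0 (\<lambda>t x. (- 1) * ((?i t x * ?i t x) * F' t x))"
        using jcont_mult[OF jcont_const_t[of "\<lambda>_. -1"] jcont_mult[OF ji ji]] per
        by (simp add: periodic1_def)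
    qed auto
    have "sob_family 0 (Suc 0) (\<lambda>t x. (-1) * (?i t x * ?i t x))"
      by (rule sob_family_time_mult[OF _ _ _ sob_family_mult[OF _ _ i01 i01]]) auto
    note W = sob_cont_weighted_composition[OF \<sigma> _ flow_id this]
    show ?case by (rule main[OF \<sigma> 0]) (use W in simp)
  next
    case (Suc m)
    have i: "sob_family \<sigma> (Suc m) ?i" by (rule Suc.IH[OF sob_family_Suc[OF Suc.prems \<sigma>(1) s1]])
    show ?case
      by (rule main[OF \<sigma> Suc.prems], rule sob_family_time_mult[OF _ \<sigma>], simp)
        (intro sob_family_mult \<sigma> i)
  }
qed

text \<open>By induction from \<open>(F \<circ> g)' = (F' \<circ> g) \<cdot> \<gamma>\<close>.\<close>

lemma sob_family_compose:
  assumes \<sigma>: "0 \<le> \<sigma>" "\<sigma> < 1" and g: "flow g \<gamma>"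
  shows "sob_family \<sigma> m F \<Longrightarrow> sob_family \<sigma> m \<gamma> \<Longrightarrow> sob_family \<sigma> m (\<lambda>t x. F t (g t x))"
proof (induction m arbitrary: F)
  case 0
  have "sob_family 0 (Suc 0) (\<lambda>t x. 1)" by (rule sob_family_time) auto
  from sob_cont_weighted_composition[OF \<sigma> _ g this, of F] 0(1) show ?case by simp
next
  case (Suc m)
  have s1: "\<sigma> \<le> 1" using \<sigma> by simp
  note gD = flowD[OF g]
  from Suc.prems(1) obtain F' where F': "sob_family \<sigma> m F'" "\<And>t. ac_deriv (F t) (F' t)" "\<And>t. periodic1 (F t)" "continuous_on UNIV (\<lambda>t. F t 0)"
    by (rule sob_familyE) blast
  have "sob_family \<sigma> m (\<lambda>t x. F' t (g t x))"
    by (rule Suc.IH[OF F'(1) sob_family_Suc[OF Suc.prems(2) \<sigma>(1) s1]])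
  then have "sob_family \<sigma> m (\<lambda>t x. F' t (g t x) * \<gamma> t x)" by (rule sob_family_mult_aux[OF \<sigma> _ Suc.prems(2)])
  then show ?case
  proof (rule sob_familyI[OF _ ac_deriv_compose[OF F'(2) gD(3,4)]])
    show "periodic1 (\<lambda>x. F t (g t x))" for t using F'(3)[of t] by (simp add: periodic1_def gD(5))
    show "continuous_on UNIV (\<lambda>t. F t (g t 0))"
      by (rule jcont_t[OF jcont_comp[OF sob_family_jcont[OF Suc.prems(1) \<sigma>(1) s1] gD(1)]])
  qed
qed

text \<open>Bootstrapping for the inverse flow, whose derivative solves \<open>\<gamma> = I \<circ> g\<close>: if \<open>\<gamma>\<close> has \<open>j\<close> derivatives
then the right-hand side has one more.\<close>

lemma sob_family_flow_derivative:
  assumes \<sigma>: "0 \<le> \<sigma>" "\<sigma> < 1" and g: "flow g \<gamma>" and I: "sob_family \<sigma> (Suc k) I"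
    and \<gamma>: "\<And>t x. \<gamma> t x = I t (g t x)"
  shows "sob_family \<sigma> (Suc k) \<gamma>"
proof -
  have s1: "\<sigma> \<le> 1" using \<sigma> by simp
  note gD = flowD[OF g]
  have \<gamma>': "\<gamma> t = (\<lambda>x. I t (g t x))" for t by (rule ext) (rule \<gamma>)
  have step: "sob_family s (Suc n) \<gamma>"
    if "sob_family s (Suc n) I" and *: "\<And>I'. sob_family s n I' \<Longrightarrow> sob_family s n (\<lambda>t x. I' t (g t x) * \<gamma> t x)" for s n
  proof -
    from that(1) obtain I' where I': "sob_family s n I'" "\<And>t. ac_deriv (I t) (I' t)" "\<And>t. periodic1 (I t)" "continuous_on UNIV (\<lambda>t. I t 0)"
      by (rule sob_familyE) blast
    show ?thesis
    proof (rule sob_familyI[OF *[OF I'(1)]])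
      show "ac_deriv (\<gamma> t) (\<lambda>x. I' t (g t x) * \<gamma> t x)" for t
        using ac_deriv_compose[OF I'(2)[of t] gD(3,4), of t] unfolding \<gamma>'[symmetric] .
    qed (rule gD(6), rule jcont_t[OF gD(2)])
  qed
  have \<gamma>01: "sob_family 0 (Suc 0) \<gamma>"
  proof (rule step[OF sob_family_01[OF I \<sigma>(1) s1]])
    fix I' assume "sob_family 0 0 I'"
    then show "sob_family 0 0 (\<lambda>t x. I' t (g t x) * \<gamma> t x)"
      using sob_cont_0_weighted_composition[OF _ g gD(2,6), of I'] by (simp add: mult.commute)
  qed
  have \<gamma>1: "sob_family \<sigma> (Suc 0) \<gamma>"
  proof (rule step)
    show "sob_family \<sigma> (Suc 0) I" by (rule sob_family_le[OF I _ \<sigma>(1) s1]) simp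
    fix I' assume "sob_family \<sigma> 0 I'"
    then show "sob_family \<sigma> 0 (\<lambda>t x. I' t (g t x) * \<gamma> t x)"
      using sob_cont_weighted_composition[OF \<sigma> _ g \<gamma>01, of I'] by (simp add: mult.commute)
  qed
  have "j \<le> k \<Longrightarrow> sob_family \<sigma> (Suc j) \<gamma>" for j
  proof (induction j)
    case 0
    show ?case by (rule \<gamma>1)
  next
    case (Suc j)
    then have IH: "sob_family \<sigma> (Suc j) \<gamma>" by simp
    show ?case
    proof (rule step)
      show "sob_family \<sigma> (Suc (Suc j)) I" by (rule sob_family_le[OF I _ \<sigma>(1) s1]) (use Suc.prems in simp)
      fix I' assume "sob_family \<sigma> (Suc j) I'"
      then show "sob_family \<sigma> (Suc j) (\<lambda>t x. I' t (g t x) * \<gamma> t x)"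
        by (intro sob_family_mult[OF \<sigma> _ IH] sob_family_compose[OF \<sigma> g _ IH])
    qed
  qed
  then show ?thesis by simp
qed

lemma sob_family_sob_cont:
  assumes \<sigma>: "0 \<le> \<sigma>" "\<sigma> \<le> 1"
  shows "sob_family \<sigma> m F \<Longrightarrow> sob_cont (real m + \<sigma>) F"
proof (induction m arbitrary: F)
  case 0
  then show ?case by simp
next
  case (Suc m)
  from Suc.prems(1) obtain F' where F': "sob_family \<sigma> m F'" "\<And>t. ac_deriv (F t) (F' t)" "\<And>t. periodic1 (F t)" "continuous_on UNIV (\<lambda>t. F t 0)"
    by (rule sob_familyE) blast
  let ?r = "real m + \<sigma>"
  have c: "sob_cont ?r F" by (rule Suc.IH[OF sob_family_Suc[OF Suc.prems \<sigma>]])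
  have c': "sob_cont ?r F'" by (rule Suc.IH[OF F'(1)])
  have "sob_cont (?r + 1) F" unfolding sob_cont_def
  proof (intro conjI allI)
    fix t
    show "hsp (?r + 1) (F t)" by (rule hsp_deriv(1)[OF F'(2,3) sob_contD(1)[OF c] sob_contD(1)[OF c']])
    have p: "periodic1 (\<lambda>x. F \<tau> x - F t x)" for \<tau> using F'(3) by (simp add: periodic1_def)
    have e: "sob_sq (?r + 1) (\<lambda>x. F \<tau> x - F t x) = sob_sq ?r (\<lambda>x. F \<tau> x - F t x) + 1 / (4 * pi\<^sup>2) * sob_sq ?r (\<lambda>x. F' \<tau> x - F' t x)" for \<tau>
      by (rule hsp_deriv(2)[OF ac_deriv_diff[OF F'(2) F'(2)] p hsp_diff(1)[OF sob_contD(1)[OF c] sob_contD(1)[OF c]]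
        hsp_diff(1)[OF sob_contD(1)[OF c'] sob_contD(1)[OF c']]])
    have "((\<lambda>\<tau>. sob_sq ?r (\<lambda>x. F \<tau> x - F t x) + 1 / (4 * pi\<^sup>2) * sob_sq ?r (\<lambda>x. F' \<tau> x - F' t x)) \<longlongrightarrow> 0 + 1 / (4 * pi\<^sup>2) * 0) (at t)"
      by (intro tendsto_intros sob_contD(3)[OF c'] sob_contD(3)[OF c])
    then show "((\<lambda>\<tau>. sob_sq (?r + 1) (\<lambda>x. F \<tau> x - F t x)) \<longlongrightarrow> 0) (at t)" by (simp only: e) simp
  qed
  then show ?case by (simp add: add_ac)
qed

lemma sobolev_norm_sob_sq: "sobolev_norm r f = sqrt (sob_sq r f)"
  by (simp add: sobolev_norm_def sob_sq_def)

lemma sobolev_memberI: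
  assumes "hsp r f" "1/2 < r \<Longrightarrow> continuous_on UNIV f" shows "f \<in> sobolev r"
proof -
  have L: "L2fun f" by (rule hsp_L2[OF assms(1)])
  have "f \<in> borel_measurable lebesgue" using L by (auto simp: L2fun_def intro: measurable_completion)
  moreover have "(\<lambda>x. (f x)\<^sup>2) absolutely_integrable_on {0..1}"
    using L2fun_mult[OF L L] by (simp add: circle_integrable_def power2_eq_square)
  ultimately show ?thesis using assms L by (auto simp: sobolev_def hsp_def L2fun_def)
qed

lemma sob_family_continuous_in_sobolev:
  assumes \<sigma>: "0 \<le> \<sigma>" "\<sigma> \<le> 1" and F: "sob_family \<sigma> m F" and m: "m > 0 \<or> \<sigma> = 0"
  shows "continuous_in_sobolev T (real m + \<sigma>) F"
  unfolding continuous_in_sobolev_def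
proof (intro ballI conjI)
  fix t
  note c = sob_family_sob_cont[OF \<sigma> F]
  show "F t \<in> sobolev (real m + \<sigma>)"
  proof (rule sobolev_memberI[OF sob_contD(1)[OF c]])
    assume "1/2 < real m + \<sigma>"
    then have "m > 0" using m by auto
    then obtain n where "m = Suc n" by (cases m) auto
    then show "continuous_on UNIV (F t)" using F jcont_x[OF sob_family_jcont[OF _ \<sigma>]] by blast
  qed
  have "((\<lambda>\<tau>. sqrt (sob_sq (real m + \<sigma>) (\<lambda>x. F \<tau> x - F t x))) \<longlongrightarrow> sqrt 0) (at t)"
    by (intro tendsto_real_sqrt sob_contD(3)[OF c])
  then show "((\<lambda>\<tau>. sobolev_norm (real m + \<sigma>) (\<lambda>x. F \<tau> x - F t x)) \<longlongrightarrow> 0) (at t within time_interval T)"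
    unfolding sobolev_norm_sob_sq real_sqrt_zero by (rule tendsto_within_subset) simp
qed

section \<open>Initial data\<close>

text \<open>The derivative is rebuilt from the coefficients \<open>2 \<pi> \<i> n\<close> times those of \<open>f\<close>, and then integrated.\<close>

lemma hsp_primitive:
  assumes f: "hsp (r + 1) f" and r: "0 \<le> r"
  shows "\<exists>F f'. (\<forall>n. fc F n = fc f n) \<and> ac_deriv F f' \<and> periodic1 F \<and> hsp r f'"
proof -
  have fL: "L2fun f" by (rule hsp_L2[OF f])
  define a where "a n = \<i> * of_real (2 * pi * real_of_int n) * fc f n" for n
  have a: "hermitian a" using fc_minus[OF L2fun_circle_integrable[OF fL]] by (simp add: hermitian_def a_def)
  have an: "(cmod (a n))\<^sup>2 = 4 * pi\<^sup>2 * ((real_of_int n)\<^sup>2 * (cmod (fc f n))\<^sup>2)" for n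
    by (simp add: a_def norm_mult power_mult_distrib)
  have bd: "(1 + (real_of_int n)\<^sup>2) powr r * (cmod (a n))\<^sup>2 \<le> 4 * pi\<^sup>2 * sobolev_term (r + 1) f n" for n
  proof -
    have "(1 + (real_of_int n)\<^sup>2) powr (r + 1) = (1 + (real_of_int n)\<^sup>2) powr r * (1 + (real_of_int n)\<^sup>2)"
      using weight_pos[of n] by (simp add: powr_add)
    moreover have "(real_of_int n)\<^sup>2 * (cmod (fc f n))\<^sup>2 \<le> (1 + (real_of_int n)\<^sup>2) * (cmod (fc f n))\<^sup>2"
      by (intro mult_right_mono) auto
    then have "4 * pi\<^sup>2 * ((1 + (real_of_int n)\<^sup>2) powr r * ((real_of_int n)\<^sup>2 * (cmod (fc f n))\<^sup>2))
      \<le> 4 * pi\<^sup>2 * ((1 + (real_of_int n)\<^sup>2) powr r * ((1 + (real_of_int n)\<^sup>2) * (cmod (fc f n))\<^sup>2))"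
      by (intro mult_left_mono) auto
    ultimately show ?thesis unfolding an sobolev_term_def by (simp only: mult_ac)
  qed
  have sb: "(\<lambda>n. 4 * pi\<^sup>2 * sobolev_term (r + 1) f n) summable_on UNIV"
    by (intro summable_on_cmult_right hsp_summable f)
  have "(\<lambda>n. (cmod (a n))\<^sup>2) summable_on UNIV"
  proof (rule summable_on_comparison_test[OF sb])
    fix n
    have "1 \<le> (1 + (real_of_int n)\<^sup>2) powr r" using weight_ge_1[of n] r by (intro ge_one_powr_ge_zero) auto
    then have "1 * (cmod (a n))\<^sup>2 \<le> (1 + (real_of_int n)\<^sup>2) powr r * (cmod (a n))\<^sup>2" by (intro mult_right_mono) auto
    then show "(cmod (a n))\<^sup>2 \<le> 4 * pi\<^sup>2 * sobolev_term (r + 1) f n" using bd[of n] by linarith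
  qed simp
  from riesz_fischer[OF a this] obtain f' where f': "L2fun f'" "\<And>n. fc f' n = a n" by blast
  have i': "circle_integrable f'" by (rule L2fun_circle_integrable[OF f'(1)])
  have per': "periodic1 f'" using f'(1) by (simp add: L2fun_def)
  have h': "hsp r f'" by (rule hsp_bound(1)[OF f'(1) sb]) (simp only: sobolev_term_def[of r f'] f'(2) bd)
  have ab: "f' absolutely_integrable_on {x..y}" for x y
  proof (rule periodic_abs_integrable)
    show "f' (x + 1) = f' x" for x using per' by (simp add: periodic1_def)
    show "f' absolutely_integrable_on {0..1}" using i' by (simp add: circle_integrable_def)
  qed
  obtain G where G: "ac_deriv G f'" using ac_deriv_exists[OF ab] by blast
  have "integral {0..1} f' = 0" using f'(2)[of 0] by (simp add: fc_eq_Complex[OF i'] complex_eq_iff a_def)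
  then have Gp: "periodic1 G" by (rule ac_deriv_periodic[OF G per'])
  have Gi: "circle_integrable G" by (intro circle_integrable_continuous ac_deriv_continuous[OF G])
  define c where "c = fc f 0 - fc G 0"
  have Imc: "Im c = 0" by (simp add: c_def fc_eq_Complex[OF Gi] fc_eq_Complex[OF L2fun_circle_integrable[OF fL]])
  define F where "F x = G x + trig_mode c 0 x" for x
  have tw0: "trig_mode c 0 = (\<lambda>x. Re c)" by (simp add: trig_mode_def[abs_def])
  have "ac_deriv F f'" using ac_deriv_add[OF G ac_deriv_const[of "Re c"]] by (simp add: F_def[abs_def] tw0)
  moreover have Fp: "periodic1 F" using Gp by (simp add: F_def periodic1_def trig_mode_periodic)
  moreover have "fc F n = fc f n" for n
  proof -
    have "cnj c = c" using Imc by (simp add: complex_eq_iff)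
    then have *: "fc F n = fc G n + (if n = 0 then c else 0)"
      unfolding F_def[abs_def] by (simp add: fc_add Gi circle_integrable_tw fc_trig_mode)
    show ?thesis
    proof (cases "n = 0")
      case True
      then show ?thesis using * by (simp add: c_def)
    next
      case False
      have "a n = \<i> * of_real (2 * pi * real_of_int n) * fc G n" using fc_deriv[OF G Gp i', of n] f'(2) by simp
      then show ?thesis using * False by (simp add: a_def)
    qed
  qed
  ultimately show ?thesis using h' by blast
qed

text \<open>For constant curves, membership in \<open>H\<^bsup>m+\<sigma>\<^esup>\<close> gives the chain of derivatives, for a suitable
representative of the class of \<open>f\<close>.\<close>

lemma hsp_sob_family:
  assumes \<sigma>: "0 \<le> \<sigma>"
  shows "hsp (real m + \<sigma>) f \<Longrightarrow> \<exists>F. sob_family \<sigma> m (\<lambda>t. F) \<and> L2fun F \<and> (\<forall>n. fc F n = fc f n)"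
proof (induction m arbitrary: f)
  case 0
  then show ?case using sob_cont_const[of \<sigma> f] hsp_L2 by auto
next
  case (Suc m)
  have "hsp ((real m + \<sigma>) + 1) f" using Suc.prems by (simp add: add_ac)
  from hsp_primitive[OF this] \<sigma> obtain F f' where F: "\<And>n. fc F n = fc f n" "ac_deriv F f'" "periodic1 F" "hsp (real m + \<sigma>) f'"
    by auto
  from Suc.IH[OF F(4)] obtain F' where F': "sob_family \<sigma> m (\<lambda>t. F')" "L2fun F'" "\<And>n. fc F' n = fc f' n" by blast
  have "ac_deriv (\<lambda>_. 0) (\<lambda>x. f' x - F' x)"
    by (rule fc_zero(1)[OF L2fun_diff[OF hsp_L2[OF F(4)] F'(2)]]) (simp add: fc_diff L2fun_circle_integrable F'(2,3) hsp_L2[OF F(4)])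
  from ac_deriv_diff[OF F(2) this] have "ac_deriv F F'" by simp
  then have "sob_family \<sigma> (Suc m) (\<lambda>t. F)" by (intro sob_familyI[OF F'(1)] F(3)) simp_all
  moreover have "L2fun F" by (rule L2fun_continuous[OF ac_deriv_continuous[OF F(2)] F(3)])
  ultimately show ?case using F(1) by blast
qed

lemma sobolev_sob_family:
  assumes \<sigma>: "0 \<le> \<sigma>" and f: "f \<in> sobolev (real (Suc m) + \<sigma>)"
  shows "sob_family \<sigma> (Suc m) (\<lambda>t. f)"
proof -
  have fc: "continuous_on UNIV f" "periodic1 f" using f \<sigma> by (auto simp: sobolev_def)
  have fL: "L2fun f" by (rule L2fun_continuous[OF fc])
  then have "hsp (real (Suc m) + \<sigma>) f" using f by (auto simp: hsp_def sobolev_def)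
  from hsp_sob_family[OF \<sigma> this] obtain F where F: "sob_family \<sigma> (Suc m) (\<lambda>t. F)" "L2fun F" "\<And>n. fc F n = fc f n" by blast
  from F(1) obtain F' where "ac_deriv F F'" "periodic1 F" by (rule sob_familyE) blast
  then have Fc: "continuous_on UNIV (\<lambda>x. F x - f x)" "periodic1 (\<lambda>x. F x - f x)"
    using fc by (auto simp: periodic1_def intro: continuous_on_diff ac_deriv_continuous)
  have "F x - f x = 0" for x
    by (rule fc_zero_continuous[OF Fc]) (simp add: fc_diff L2fun_circle_integrable F(2,3) fL)
  then have "F = f" by auto
  then show ?thesis using F(1) by simp
qed

section \<open>Differentiability in time\<close>

text \<open>Differentiability of all Fourier coefficients is upgraded to differentiability in norm.  The mean
value theorem is applied to one scalar function, the weighted inner product of the curve with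
the error \<open>v\<close> itself; this bounds the norm of \<open>v\<close> by that of \<open>F' \<xi> - F' t\<close> at a single time \<open>\<xi>\<close>,
uniformly over finite sets of frequencies.\<close>

lemma sob_sq_difference_quotient:
  assumes F: "\<And>t. L2fun (F t)" and F': "sob_cont r F'"
    and der: "\<And>n t. ((\<lambda>\<tau>. fc (F \<tau>) n) has_vector_derivative fc (F' t) n) (at t)"
  shows "((\<lambda>\<tau>. sob_sq r (\<lambda>x. (F \<tau> x - F t x) / (\<tau> - t) - F' t x)) \<longlongrightarrow> 0) (at t)"
proof (rule tendstoI)
  fix e :: real assume e: "e > 0"
  have "\<forall>\<^sub>F \<xi> in at t. sob_sq r (\<lambda>x. F' \<xi> x - F' t x) < e / 2"
    by (rule order_tendstoD(2)[OF sob_contD(3)[OF F']]) (use e in simp)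
  then obtain d where d: "d > 0" "\<And>\<xi>. \<xi> \<noteq> t \<Longrightarrow> dist \<xi> t < d \<Longrightarrow> sob_sq r (\<lambda>x. F' \<xi> x - F' t x) < e / 2"
    by (auto simp: eventually_at)
  have i: "circle_integrable (F t)" "circle_integrable (F' t)" for t using F sob_contD(2)[OF F'] by (auto intro: L2fun_circle_integrable)
  have "dist (sob_sq r (\<lambda>x. (F \<tau> x - F t x) / (\<tau> - t) - F' t x)) 0 < e" if \<tau>: "\<tau> \<noteq> t" "dist \<tau> t < d" for \<tau>
  proof -
    define v where "v n = (fc (F \<tau>) n - fc (F t) n) / of_real (\<tau> - t) - fc (F' t) n" for n
    define w where "w n = (1 + (real_of_int n)\<^sup>2) powr r" for n
    have w0: "w n \<ge> 0" for n by (simp add: w_def)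
    have fv: "fc (\<lambda>x. (F \<tau> x - F t x) / (\<tau> - t) - F' t x) n = v n" for n
    proof -
      have "(\<lambda>x. (F \<tau> x - F t x) / (\<tau> - t) - F' t x) = (\<lambda>x. inverse (\<tau> - t) * (F \<tau> x - F t x) - F' t x)"
        by (simp add: divide_inverse mult.commute)
      then show ?thesis
        by (simp add: fc_diff fc_cmult circle_integrable_diff circle_integrable_cmult i v_def divide_inverse mult.commute)
    qed
    have bound: "(\<Sum>n\<in>A. w n * (cmod (v n))\<^sup>2) \<le> e / 2" if A: "finite A" for A
    proof -
      (* The linear term makes the derivative of \<theta> vanish at t, and \<theta> \<tau> - \<theta> t is \<tau> - t times the sum
         to be bounded. *)
      define \<theta> where "\<theta> \<xi> = (\<Sum>n\<in>A. w n * Re (cnj (v n) * (fc (F \<xi>) n - of_real \<xi> * fc (F' t) n)))" for \<xi>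
      define \<theta>' where "\<theta>' \<xi> = (\<Sum>n\<in>A. w n * Re (cnj (v n) * (fc (F' \<xi>) n - fc (F' t) n)))" for \<xi>
      have D: "(\<theta> has_real_derivative \<theta>' \<xi>) (at \<xi>)" for \<xi>
      proof -
        have "((\<lambda>\<xi>. w n * Re (cnj (v n) * (fc (F \<xi>) n - of_real \<xi> * fc (F' t) n))) has_vector_derivative
            w n * Re (cnj (v n) * (fc (F' \<xi>) n - 1 * fc (F' t) n))) (at \<xi>)" for n
        proof -
          have "((\<lambda>\<xi>. complex_of_real \<xi>) has_vector_derivative 1) (at \<xi>)"
            using has_vector_derivative_of_real[OF DERIV_ident] by simp
          then show ?thesis
            by (intro has_vector_derivative_mult_right bounded_linear.has_vector_derivative[OF bounded_linear_Re]
               has_vector_derivative_diff der has_vector_derivative_mult_left)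
        qed
        then show ?thesis unfolding \<theta>_def[abs_def] \<theta>'_def has_real_derivative_iff_has_vector_derivative
          by (intro has_vector_derivative_sum) simp
      qed
      obtain \<xi> where \<xi>: "\<xi> \<noteq> t" "dist \<xi> t < d" "\<theta> \<tau> - \<theta> t = (\<tau> - t) * \<theta>' \<xi>"
      proof (cases "t < \<tau>")
        case True
        from MVT2[OF True, of \<theta> \<theta>'] D obtain z where "t < z" "z < \<tau>" "\<theta> \<tau> - \<theta> t = (\<tau> - t) * \<theta>' z" by blast
        then show thesis using that[of z] \<tau> by (auto simp: dist_real_def)
      next
        case False
        then have "\<tau> < t" using \<tau> by simp
        from MVT2[OF this, of \<theta> \<theta>'] D obtain z where "\<tau> < z" "z < t" "\<theta> t - \<theta> \<tau> = (t - \<tau>) * \<theta>' z" by blast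
        then show thesis using that[of z] \<tau> by (auto simp: dist_real_def algebra_simps)
      qed
      have "\<theta> \<tau> - \<theta> t = (\<tau> - t) * (\<Sum>n\<in>A. w n * (cmod (v n))\<^sup>2)"
        unfolding \<theta>_def sum_subtractf[symmetric] sum_distrib_left
      proof (rule sum.cong[OF refl])
        fix n
        have "(fc (F \<tau>) n - of_real \<tau> * fc (F' t) n) - (fc (F t) n - of_real t * fc (F' t) n) = of_real (\<tau> - t) * v n"
          using \<tau>(1) by (simp add: v_def field_simps)
        then have "Re (cnj (v n) * (fc (F \<tau>) n - of_real \<tau> * fc (F' t) n)) - Re (cnj (v n) * (fc (F t) n - of_real t * fc (F' t) n))
          = Re (cnj (v n) * (of_real (\<tau> - t) * v n))"
          unfolding minus_complex.simps(1)[symmetric] right_diff_distrib[symmetric] by simp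
        also have "\<dots> = (\<tau> - t) * (cmod (v n))\<^sup>2"
          unfolding cmod_power2 by (simp add: power2_eq_square algebra_simps)
        finally show "w n * Re (cnj (v n) * (fc (F \<tau>) n - of_real \<tau> * fc (F' t) n)) -
           w n * Re (cnj (v n) * (fc (F t) n - of_real t * fc (F' t) n)) = (\<tau> - t) * (w n * (cmod (v n))\<^sup>2)"
          by (simp add: right_diff_distrib[symmetric])
      qed
      then have "(\<Sum>n\<in>A. w n * (cmod (v n))\<^sup>2) = \<theta>' \<xi>" using \<xi>(3) \<tau>(1) by simp
      also have "\<dots> \<le> (\<Sum>n\<in>A. w n * (cmod (v n))\<^sup>2 / 2 + w n * (cmod (fc (F' \<xi>) n - fc (F' t) n))\<^sup>2 / 2)"
        unfolding \<theta>'_def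
      proof (rule sum_mono)
        fix n
        let ?z = "fc (F' \<xi>) n - fc (F' t) n"
        have "Re (cnj (v n) * ?z) \<le> cmod (v n) * cmod ?z" using complex_Re_le_cmod[of "cnj (v n) * ?z"] by (simp add: norm_mult)
        also have "\<dots> \<le> ((cmod (v n))\<^sup>2 + (cmod ?z)\<^sup>2) / 2" using abs_mult_le_squares[of "cmod (v n)" "cmod ?z"] by simp
        finally have "w n * Re (cnj (v n) * ?z) \<le> w n * (((cmod (v n))\<^sup>2 + (cmod ?z)\<^sup>2) / 2)"
          using w0 by (intro mult_left_mono)
        then show "w n * Re (cnj (v n) * ?z) \<le> w n * (cmod (v n))\<^sup>2 / 2 + w n * (cmod ?z)\<^sup>2 / 2"
          by (simp add: distrib_left add_divide_distrib)
      qed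
      also have "\<dots> = (\<Sum>n\<in>A. w n * (cmod (v n))\<^sup>2) / 2 + (\<Sum>n\<in>A. w n * (cmod (fc (F' \<xi>) n - fc (F' t) n))\<^sup>2) / 2"
        by (simp add: sum.distrib sum_divide_distrib)
      finally have "(\<Sum>n\<in>A. w n * (cmod (v n))\<^sup>2) \<le> (\<Sum>n\<in>A. w n * (cmod (fc (F' \<xi>) n - fc (F' t) n))\<^sup>2)" by simp
      also have "\<dots> = (\<Sum>n\<in>A. sobolev_term r (\<lambda>x. F' \<xi> x - F' t x) n)"
        by (simp add: sobolev_term_def w_def fc_diff i)
      also have "\<dots> \<le> sob_sq r (\<lambda>x. F' \<xi> x - F' t x)" unfolding sob_sq_def
        by (intro finite_sum_le_infsum A hsp_summable hsp_diff(1) sob_contD[OF F']) (auto simp: sobolev_term_nonneg)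
      also have "\<dots> \<le> e / 2" using d(2)[OF \<xi>(1,2)] by simp
      finally show ?thesis .
    qed
    have st: "sobolev_term r (\<lambda>x. (F \<tau> x - F t x) / (\<tau> - t) - F' t x) = (\<lambda>n. w n * (cmod (v n))\<^sup>2)"
      by (auto simp: sobolev_term_def fv w_def)
    have sm: "(\<lambda>n. w n * (cmod (v n))\<^sup>2) summable_on UNIV"
    proof (rule nonneg_bdd_above_summable_on)
      show "bdd_above (sum (\<lambda>n. w n * (cmod (v n))\<^sup>2) ` {F. F \<subseteq> UNIV \<and> finite F})"
        using bound by (intro bdd_aboveI[of _ "e/2"]) blast
    qed (simp add: w0)
    have "sob_sq r (\<lambda>x. (F \<tau> x - F t x) / (\<tau> - t) - F' t x) \<le> e / 2"
      unfolding sob_sq_def st by (rule infsum_le_finite_sums[OF sm]) (rule bound)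
    then show ?thesis using e sob_sq_nonneg[of r "\<lambda>x. (F \<tau> x - F t x) / (\<tau> - t) - F' t x"] by simp
  qed
  then show "\<forall>\<^sub>F \<tau> in at t. dist (sob_sq r (\<lambda>x. (F \<tau> x - F t x) / (\<tau> - t) - F' t x)) 0 < e"
    using d(1) by (auto simp: eventually_at)
qed

lemma sob_family_C1_in_sobolev:
  assumes \<sigma>: "0 \<le> \<sigma>" "\<sigma> \<le> 1" and F: "sob_family \<sigma> m F" and F': "sob_family \<sigma> m F'" and m: "m > 0 \<or> \<sigma> = 0"
    and der: "\<And>n t. ((\<lambda>\<tau>. fc (F \<tau>) n) has_vector_derivative fc (F' t) n) (at t)"
  shows "C1_in_sobolev T (real m + \<sigma>) F F'"
  unfolding C1_in_sobolev_def
proof (intro conjI ballI sob_family_continuous_in_sobolev[OF \<sigma> _ m] F F')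
  fix t
  have "((\<lambda>\<tau>. sqrt (sob_sq (real m + \<sigma>) (\<lambda>x. (F \<tau> x - F t x) / (\<tau> - t) - F' t x))) \<longlongrightarrow> sqrt 0) (at t)"
    by (intro tendsto_real_sqrt sob_sq_difference_quotient sob_family_sob_cont[OF \<sigma> F'] der sob_contD(2)[OF sob_family_sob_cont[OF \<sigma> F]])
  then show "((\<lambda>\<tau>. sobolev_norm (real m + \<sigma>) (\<lambda>x. (F \<tau> x - F t x) / (\<tau> - t) - F' t x)) \<longlongrightarrow> 0) (at t within time_interval T)"
    unfolding sobolev_norm_sob_sq real_sqrt_zero by (rule tendsto_within_subset) simp
qed

section \<open>A global existence theorem for second-order equations\<close>

lemma continuous_antiderivative:
  assumes "continuous_on UNIV f"
  shows "\<exists>F. F 0 = (0::real) \<and> (\<forall>x. (F has_real_derivative f x) (at x))"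
proof -
  have "f absolutely_integrable_on {a..b}" for a b
    by (intro abs_integrable_continuous continuous_on_subset[OF assms]) simp
  from ac_deriv_exists[OF this] obtain F where "F 0 = 0" "ac_deriv F f" by blast
  then show ?thesis using ac_deriv_imp_C1[OF _ assms] by blast
qed

text \<open>Comparison with the primitive of the bound.  Integrating twice gains the factor \<open>1 / \<mu>\<^sup>2\<close>, which
makes the Picard map below a contraction.\<close>

lemma exponential_growth_integral_pos:
  fixes F f :: "real \<Rightarrow> real"
  assumes F: "F 0 = 0" "\<And>x. (F has_real_derivative f x) (at x)"
    and f: "\<And>x. \<bar>f x\<bar> \<le> M * exp (\<mu> * \<bar>x\<bar>)" and \<mu>: "0 < \<mu>" and t: "0 \<le> t"
  shows "\<bar>F t\<bar> \<le> M / \<mu> * exp (\<mu> * t)"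
proof -
  have M: "0 \<le> M" using f[of 0] by simp
  let ?H = "\<lambda>x. M / \<mu> * exp (\<mu> * x)"
  have H: "(?H has_real_derivative M * exp (\<mu> * x)) (at x)" for x
    using \<mu> by (auto intro!: derivative_eq_intros)
  have "?H 0 - F 0 \<le> ?H t - F t"
  proof (rule DERIV_nonneg_imp_nondecreasing[OF t, where f = "\<lambda>x. ?H x - F x"])
    fix x assume "0 \<le> x" "x \<le> t"
    then show "\<exists>y. ((\<lambda>x. ?H x - F x) has_real_derivative y) (at x) \<and> 0 \<le> y"
      using f[of x] by (intro exI[of _ "M * exp (\<mu> * x) - f x"] conjI DERIV_diff H F(2)) (simp add: abs_le_iff)
  qed
  moreover have "?H 0 + F 0 \<le> ?H t + F t"
  proof (rule DERIV_nonneg_imp_nondecreasing[OF t, where f = "\<lambda>x. ?H x + F x"])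
    fix x assume "0 \<le> x" "x \<le> t"
    then show "\<exists>y. ((\<lambda>x. ?H x + F x) has_real_derivative y) (at x) \<and> 0 \<le> y"
      using f[of x] by (intro exI[of _ "M * exp (\<mu> * x) + f x"] conjI DERIV_add H F(2)) (simp add: abs_le_iff)
  qed
  moreover have "0 \<le> ?H 0" using M \<mu> by simp
  ultimately show ?thesis using F(1) unfolding abs_le_iff by linarith
qed

lemma exponential_growth_integral:
  fixes F f :: "real \<Rightarrow> real"
  assumes F: "F 0 = 0" "\<And>x. (F has_real_derivative f x) (at x)"
    and f: "\<And>x. \<bar>f x\<bar> \<le> M * exp (\<mu> * \<bar>x\<bar>)" and \<mu>: "0 < \<mu>"
  shows "\<bar>F t\<bar> \<le> M / \<mu> * exp (\<mu> * \<bar>t\<bar>)"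
proof (cases "0 \<le> t")
  case True
  then show ?thesis using exponential_growth_integral_pos[OF F f \<mu>] by simp
next
  case False
  have "((\<lambda>x. F (- x)) has_real_derivative - f (- x)) (at x)" for x
    using DERIV_chain2[OF F(2)[of "-x"] DERIV_minus[OF DERIV_ident]] by simp
  moreover have "\<bar>- f (- x)\<bar> \<le> M * exp (\<mu> * \<bar>x\<bar>)" for x using f[of "-x"] by simp
  ultimately have "\<bar>F (- (- t))\<bar> \<le> M / \<mu> * exp (\<mu> * (- t))"
    using F(1) False \<mu> by (intro exponential_growth_integral_pos[where F = "\<lambda>x. F (- x)" and f = "\<lambda>x. - f (- x)"]) auto
  then show ?thesis using False by simp
qed

text \<open>The unknown is \<open>exp (- \<mu> \<bar>t\<bar>) p'' t\<close>, a bounded continuous function on the whole line because \<open>G\<close> is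
bounded.  In these weighted variables the fixed point map contracts by \<open>1/2\<close> when \<open>\<mu>\<^sup>2 = 2 (\<bar>L\<bar> + 1)\<close>,
so the solution is global at once.\<close>

theorem picard_second_order:
  fixes G :: "real \<Rightarrow> real \<Rightarrow> real"
  assumes G: "jcont G" and bd: "\<And>t q. \<bar>G t q\<bar> \<le> B" and lip: "\<And>t a b. \<bar>G t a - G t b\<bar> \<le> L * \<bar>a - b\<bar>"
  shows "\<exists>p p'. p 0 = 0 \<and> p' 0 = a1 \<and> (\<forall>t. (p has_real_derivative p' t) (at t)) \<and>
     (\<forall>t. (p' has_real_derivative G t (p t)) (at t))"
proof -
  define \<mu> where "\<mu> = sqrt (2 * (\<bar>L\<bar> + 1))"
  have \<mu>: "0 < \<mu>" "\<mu> * \<mu> = 2 * (\<bar>L\<bar> + 1)" unfolding \<mu>_def by (auto simp: add_nonneg_pos)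
  define AD where "AD f = (SOME F. F 0 = (0::real) \<and> (\<forall>x. (F has_real_derivative f x) (at x)))" for f :: "real \<Rightarrow> real"
  have AD: "AD f 0 = 0 \<and> (\<forall>x. (AD f has_real_derivative f x) (at x))" if "continuous_on UNIV f" for f
    using someI_ex[OF continuous_antiderivative[OF that]] unfolding AD_def .
  have ADc: "continuous_on UNIV (AD f)" if "continuous_on UNIV f" for f
    using AD[OF that] by (meson DERIV_isCont continuous_at_imp_continuous_on)
  define w where "w z t = exp (\<mu> * \<bar>t\<bar>) * apply_bcontfun z t" for z :: "real \<Rightarrow>\<^sub>C real" and t
  have wc: "continuous_on UNIV (w z)" for z
    unfolding w_def[abs_def] by (intro continuous_intros continuous_on_apply_bcontfun)
  define P where "P z t = a1 * t + AD (AD (w z)) t" for z t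
  have Pc: "continuous_on UNIV (P z)" for z
    unfolding P_def[abs_def] by (intro continuous_intros ADc wc)
  define T where "T z = Bcontfun (\<lambda>t. exp (- \<mu> * \<bar>t\<bar>) * G t (P z t))" for z
  have T: "apply_bcontfun (T z) = (\<lambda>t. exp (- \<mu> * \<bar>t\<bar>) * G t (P z t))" for z
    unfolding T_def
  proof (rule Bcontfun_inverse, unfold bcontfun_def, intro CollectI conjI boundedI)
    show "continuous_on UNIV (\<lambda>t. exp (- \<mu> * \<bar>t\<bar>) * G t (P z t))"
      by (intro continuous_intros jcont_compose[OF G] Pc)
    fix y assume "y \<in> range (\<lambda>t. exp (- \<mu> * \<bar>t\<bar>) * G t (P z t))"
    then obtain t where y: "y = exp (- \<mu> * \<bar>t\<bar>) * G t (P z t)" by blast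
    have "\<bar>exp (- \<mu> * \<bar>t\<bar>)\<bar> * \<bar>G t (P z t)\<bar> \<le> 1 * B"
      using \<mu> bd[of t "P z t"] by (intro mult_mono) auto
    then show "norm y \<le> B" by (simp add: y abs_mult)
  qed
  have contr: "dist (T z1) (T z2) \<le> 1/2 * dist z1 z2" for z1 z2
  proof (rule dist_bound)
    fix t
    let ?D = "dist z1 z2"
    have f: "\<bar>w z1 x - w z2 x\<bar> \<le> ?D * exp (\<mu> * \<bar>x\<bar>)" for x
    proof -
      have "w z1 x - w z2 x = exp (\<mu> * \<bar>x\<bar>) * (apply_bcontfun z1 x - apply_bcontfun z2 x)"
        by (simp add: w_def right_diff_distrib)
      then show ?thesis using dist_bounded[of z1 x z2] by (simp add: abs_mult dist_real_def mult.commute)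
    qed
    have f1: "\<bar>AD (w z1) x - AD (w z2) x\<bar> \<le> ?D / \<mu> * exp (\<mu> * \<bar>x\<bar>)" for x
      by (rule exponential_growth_integral[OF _ _ f \<mu>(1), where F = "\<lambda>x. AD (w z1) x - AD (w z2) x"])
        (use AD[OF wc] in \<open>auto intro: DERIV_diff\<close>)
    have "\<bar>AD (AD (w z1)) t - AD (AD (w z2)) t\<bar> \<le> ?D / \<mu> / \<mu> * exp (\<mu> * \<bar>t\<bar>)"
      by (rule exponential_growth_integral[OF _ _ f1 \<mu>(1), where F = "\<lambda>x. AD (AD (w z1)) x - AD (AD (w z2)) x"])
        (use AD[OF ADc[OF wc]] in \<open>auto intro: DERIV_diff\<close>)
    then have PP: "\<bar>P z1 t - P z2 t\<bar> \<le> ?D / (\<mu> * \<mu>) * exp (\<mu> * \<bar>t\<bar>)" by (simp add: P_def)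
    have "\<bar>G t (P z1 t) - G t (P z2 t)\<bar> \<le> L * \<bar>P z1 t - P z2 t\<bar>" by (rule lip)
    also have "\<dots> \<le> (\<bar>L\<bar> + 1) * \<bar>P z1 t - P z2 t\<bar>" by (intro mult_right_mono) auto
    also have "\<dots> \<le> (\<bar>L\<bar> + 1) * (?D / (\<mu> * \<mu>) * exp (\<mu> * \<bar>t\<bar>))" by (intro mult_left_mono PP) auto
    also have "\<dots> = 1/2 * ?D * exp (\<mu> * \<bar>t\<bar>)" unfolding \<mu>(2) by (simp add: field_simps)
    finally have "exp (- \<mu> * \<bar>t\<bar>) * \<bar>G t (P z1 t) - G t (P z2 t)\<bar> \<le> exp (- \<mu> * \<bar>t\<bar>) * (1/2 * ?D * exp (\<mu> * \<bar>t\<bar>))"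
      by (intro mult_left_mono) auto
    also have "\<dots> = 1/2 * ?D" by (simp add: exp_minus field_simps)
    finally show "dist (apply_bcontfun (T z1) t) (apply_bcontfun (T z2) t) \<le> 1/2 * ?D"
      unfolding T dist_real_def right_diff_distrib[symmetric] by (simp add: abs_mult)
  qed
  have "\<exists>!z. T z = z"
    by (rule banach_fix_type[of "1/2"]) (use contr in auto)
  then obtain z where z: "T z = z" by blast
  have wz: "w z t = G t (P z t)" for t
  proof -
    have "apply_bcontfun z t = exp (- \<mu> * \<bar>t\<bar>) * G t (P z t)" using T[of z] z by simp
    then show ?thesis by (simp add: w_def exp_minus)
  qed
  have "(P z has_real_derivative a1 + AD (w z) t) (at t)" for t
    unfolding P_def[abs_def] using AD[OF ADc[OF wc], of z] by (auto intro!: derivative_eq_intros)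
  moreover have "((\<lambda>t. a1 + AD (w z) t) has_real_derivative G t (P z t)) (at t)" for t
    using AD[OF wc, of z] unfolding wz[symmetric] by (auto intro!: derivative_eq_intros)
  moreover have "P z 0 = 0" "a1 + AD (w z) 0 = a1" using AD[OF wc, of z] AD[OF ADc[OF wc], of z] by (auto simp: P_def)
  ultimately show ?thesis by (intro exI[of _ "P z"] exI[of _ "\<lambda>t. a1 + AD (w z) t"]) blast
qed

lemma fc_integral_continuous:
  assumes "continuous_on UNIV f"
  shows "fc f n = integral {0..1} (\<lambda>x. complex_of_real (f x) * cis (- (2 * pi * real_of_int n * x)))"
  unfolding fourier_coeff_def
  by (rule set_lebesgue_integral_eq_integral(2))
    (intro abs_integrable_continuous continuous_intros continuous_on_subset[OF assms] subset_UNIV)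

section \<open>The data and the linear oscillator\<close>

text \<open>The initial data, with \<open>v0\<close> the derivative of \<open>u0\<close>.  The forcing \<open>h\<close> is taken on the whole line so
that the solution can be constructed for all real times, without end points.\<close>

locale hs_data =
  fixes \<sigma> :: real and k :: nat and h u0 v0 \<rho>0 :: "real \<Rightarrow> real"
  assumes \<sigma>: "0 \<le> \<sigma>" "\<sigma> < 1"
    and h: "continuous_on UNIV h"
    and v0_family: "sob_family \<sigma> (Suc k) (\<lambda>t. v0)"
    and u0: "ac_deriv u0 v0" "periodic1 u0"
    and \<rho>0_family: "sob_family \<sigma> (Suc k) (\<lambda>t. \<rho>0)"
    and \<rho>0_nz: "\<And>x. \<rho>0 x \<noteq> 0"
begin

lemma \<sigma>1: "\<sigma> \<le> 1" using \<sigma> by simp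

lemma v0_cont: "continuous_on S v0" and \<rho>0_cont: "continuous_on S \<rho>0"
  using jcont_x[OF sob_family_jcont[OF v0_family \<sigma>(1) \<sigma>1]] jcont_x[OF sob_family_jcont[OF \<rho>0_family \<sigma>(1) \<sigma>1]] by auto

lemma v0_per: "v0 (x + 1) = v0 x" and \<rho>0_per: "\<rho>0 (x + 1) = \<rho>0 x"
  using sob_family_periodic[OF v0_family] sob_family_periodic[OF \<rho>0_family] by (auto simp: periodic1_def)

lemma u0_per: "u0 (x + 1) = u0 x" using u0(2) by (simp add: periodic1_def)

lemma u0_deriv: "(u0 has_real_derivative v0 x) (at x)"
  by (rule ac_deriv_imp_C1[OF u0(1) v0_cont])

lemma u0_cont: "continuous_on S u0" by (rule ac_deriv_continuous[OF u0(1)])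

definition e0 :: "real \<Rightarrow> real" where "e0 x = (v0 x)\<^sup>2 + (\<rho>0 x)\<^sup>2"

lemma e0_cont: "continuous_on S e0"
  unfolding e0_def[abs_def] by (intro continuous_intros v0_cont \<rho>0_cont)

lemma e0_per: "e0 (x + 1) = e0 x" by (simp add: e0_def v0_per \<rho>0_per)

text \<open>The frequency of the oscillator \<open>w\<close>.\<close>

definition c :: real where "c = sqrt (integral {0..1} e0) / 2"

lemma c_pos: "0 < c" and four_c2: "4 * c\<^sup>2 = integral {0..1} e0"
proof -
  have pos: "0 < e0 x" for x using \<rho>0_nz[of x] by (simp add: e0_def add_nonneg_pos)
  have "0 \<le> integral {0..1} e0"
    by (intro Henstock_Kurzweil_Integration.integral_nonneg integrable_continuous_interval e0_cont less_imp_le pos)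
  moreover have "integral {0..1} e0 \<noteq> 0"
    using integral_eq_0_iff[of 0 1 e0] e0_cont pos less_imp_le[OF pos] by (metis atLeastAtMost_iff less_irrefl order_refl zero_less_one zero_le_one)
  ultimately have "0 < integral {0..1} e0" by simp
  then show "0 < c" "4 * c\<^sup>2 = integral {0..1} e0" by (simp_all add: c_def power_divide)
qed

definition E0 :: "real \<Rightarrow> real" where "E0 = (SOME F. F 0 = 0 \<and> (\<forall>x. (F has_real_derivative e0 x) (at x)))"

lemma E0_0: "E0 0 = 0" and E0_deriv: "(E0 has_real_derivative e0 x) (at x)"
  using someI_ex[OF continuous_antiderivative[OF e0_cont]] unfolding E0_def by auto

lemma E0_per: "E0 (x + 1) = E0 x + 4 * c\<^sup>2"
proof -
  have E: "ac_deriv E0 e0" by (rule ac_deriv_C1[OF E0_deriv e0_cont])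
  have "E0 (x + 1) - E0 x = integral {x..x+1} e0" by (rule ac_derivD(3)[OF E]) simp
  also have "\<dots> = integral {0..1} e0"
    by (rule periodic_integral[OF e0_per ac_derivD(1)[OF E]])
  finally show ?thesis by (simp add: four_c2)
qed

section \<open>The Jacobian of the flow\<close>

text \<open>Since \<open>w\<close> is affine in the data, its squared modulus and the time derivatives of it lie in the span
of \<open>1\<close>, \<open>v0\<close> and \<open>e0\<close>, with coefficients depending on time only; \<open>Lin\<close> is the primitive in space.\<close>

definition lin :: "real \<Rightarrow> real \<Rightarrow> real \<Rightarrow> real \<Rightarrow> real" where
  "lin p q r x = p + q * v0 x + r * e0 x"

definition Lin :: "real \<Rightarrow> real \<Rightarrow> real \<Rightarrow> real \<Rightarrow> real" where
  "Lin p q r x = p * x + q * (u0 x - u0 0) + r * E0 x"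

lemma Lin_deriv: "(Lin p q r has_real_derivative lin p q r x) (at x)"
  unfolding Lin_def[abs_def] lin_def
  by (auto intro!: derivative_eq_intros u0_deriv E0_deriv)

lemma Lin_0: "Lin p q r 0 = 0" by (simp add: Lin_def E0_0)

lemma Lin_per: "Lin p q r (x + 1) = Lin p q r x + (p + 4 * c\<^sup>2 * r)"
  unfolding Lin_def u0_per E0_per by (simp add: algebra_simps)

lemma lin_per: "lin p q r (x + 1) = lin p q r x" by (simp add: lin_def v0_per e0_per)

lemma lin_jcont:
  assumes "continuous_on UNIV p" "continuous_on UNIV q" "continuous_on UNIV r"
  shows "jcont (\<lambda>t. lin (p t) (q t) (r t))"
  unfolding lin_def by (intro jcont_add jcont_mult jcont_const_x assms jcont_const_t v0_cont e0_cont)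

lemma Lin_jcont:
  assumes "continuous_on UNIV p" "continuous_on UNIV q" "continuous_on UNIV r"
  shows "jcont (\<lambda>t. Lin (p t) (q t) (r t))"
proof -
  have "continuous_on UNIV E0" using E0_deriv by (meson DERIV_isCont continuous_at_imp_continuous_on)
  then show ?thesis unfolding Lin_def
    by (intro jcont_add jcont_mult jcont_const_x assms jcont_const_t continuous_intros u0_cont)
qed

lemma lin_family:
  assumes "continuous_on UNIV p" "continuous_on UNIV q" "continuous_on UNIV r"
  shows "sob_family \<sigma> (Suc k) (\<lambda>t. lin (p t) (q t) (r t))"
proof -
  have "sob_family \<sigma> (Suc k) (\<lambda>t x. v0 x * v0 x + \<rho>0 x * \<rho>0 x)"
    by (intro sob_family_add sob_family_mult \<sigma> v0_family \<rho>0_family)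
  then have e: "sob_family \<sigma> (Suc k) (\<lambda>t. e0)" by (simp add: e0_def[abs_def] power2_eq_square del: sob_family.simps)
  show ?thesis unfolding lin_def
    by (intro sob_family_add sob_family_time_mult sob_family_time \<sigma> \<sigma>1 assms v0_family e)
qed

text \<open>The coefficients of \<open>J\<close>, that is of the squared modulus of \<open>w\<close>, and their first and second
derivatives.\<close>

definition al :: "real \<Rightarrow> real" where "al t = (cos (c * t))\<^sup>2"
definition be :: "real \<Rightarrow> real" where "be t = sin (c * t) * cos (c * t) / c"
definition ka :: "real \<Rightarrow> real" where "ka t = (sin (c * t))\<^sup>2 / (4 * c\<^sup>2)"
definition al1 :: "real \<Rightarrow> real" where "al1 t = - 2 * c * sin (c * t) * cos (c * t)"
definition be1 :: "real \<Rightarrow> real" where "be1 t = (cos (c * t))\<^sup>2 - (sin (c * t))\<^sup>2"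
definition ka1 :: "real \<Rightarrow> real" where "ka1 t = sin (c * t) * cos (c * t) / (2 * c)"
definition al2 :: "real \<Rightarrow> real" where "al2 t = - 2 * c\<^sup>2 * ((cos (c * t))\<^sup>2 - (sin (c * t))\<^sup>2)"
definition be2 :: "real \<Rightarrow> real" where "be2 t = - 4 * c * (sin (c * t) * cos (c * t))"
definition ka2 :: "real \<Rightarrow> real" where "ka2 t = ((cos (c * t))\<^sup>2 - (sin (c * t))\<^sup>2) / 2"

lemmas coeff_defs = al_def be_def ka_def al1_def be1_def ka1_def al2_def be2_def ka2_def

lemma coeff_cont: "continuous_on UNIV al" "continuous_on UNIV be" "continuous_on UNIV ka"
   "continuous_on UNIV al1" "continuous_on UNIV be1" "continuous_on UNIV ka1"
   "continuous_on UNIV al2" "continuous_on UNIV be2" "continuous_on UNIV ka2"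
  unfolding coeff_defs[abs_def] using c_pos by (auto intro!: continuous_intros)

lemma coeff_deriv:
  "(al has_real_derivative al1 t) (at t)" "(be has_real_derivative be1 t) (at t)" "(ka has_real_derivative ka1 t) (at t)"
  "(al1 has_real_derivative al2 t) (at t)" "(be1 has_real_derivative be2 t) (at t)" "(ka1 has_real_derivative ka2 t) (at t)"
  unfolding coeff_defs[abs_def] using c_pos
  by (auto intro!: derivative_eq_intros simp: field_simps power2_eq_square)

text \<open>The mean of \<open>J\<close> over the circle is 1, so the flow commutes with translations by 1, and the time
derivatives of \<open>M\<close> are periodic.  This is where the value of \<open>c\<close> enters.\<close>

lemma coeff_mean: "al t + 4 * c\<^sup>2 * ka t = 1" "al1 t + 4 * c\<^sup>2 * ka1 t = 0" "al2 t + 4 * c\<^sup>2 * ka2 t = 0"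
  using c_pos by (simp_all add: coeff_defs power2_eq_square field_simps)

definition J :: "real \<Rightarrow> real \<Rightarrow> real" where "J t = lin (al t) (be t) (ka t)"
definition J1 :: "real \<Rightarrow> real \<Rightarrow> real" where "J1 t = lin (al1 t) (be1 t) (ka1 t)"
definition J2 :: "real \<Rightarrow> real \<Rightarrow> real" where "J2 t = lin (al2 t) (be2 t) (ka2 t)"
text \<open>The flow, normalised to fix the label 0, and its velocity and acceleration.\<close>

definition M :: "real \<Rightarrow> real \<Rightarrow> real" where "M t = Lin (al t) (be t) (ka t)"
definition M1 :: "real \<Rightarrow> real \<Rightarrow> real" where "M1 t = Lin (al1 t) (be1 t) (ka1 t)"
definition M2 :: "real \<Rightarrow> real \<Rightarrow> real" where "M2 t = Lin (al2 t) (be2 t) (ka2 t)"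

lemma J_family: "sob_family \<sigma> (Suc k) J" "sob_family \<sigma> (Suc k) J1" "sob_family \<sigma> (Suc k) J2"
  unfolding J_def[abs_def] J1_def[abs_def] J2_def[abs_def] by (intro lin_family coeff_cont)+

lemma J_jcont: "jcont J" "jcont J1" "jcont J2"
  unfolding J_def[abs_def] J1_def[abs_def] J2_def[abs_def] by (intro lin_jcont coeff_cont)+

lemma M_jcont: "jcont M" "jcont M1" "jcont M2"
  unfolding M_def[abs_def] M1_def[abs_def] M2_def[abs_def] by (intro Lin_jcont coeff_cont)+

lemma J_per: "J t (x + 1) = J t x" "J1 t (x + 1) = J1 t x" "J2 t (x + 1) = J2 t x"
  by (simp_all add: J_def J1_def J2_def lin_per)

lemma M_per: "M t (x + 1) = M t x + 1" "M1 t (x + 1) = M1 t x" "M2 t (x + 1) = M2 t x"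
  by (simp_all only: M_def M1_def M2_def Lin_per coeff_mean)

lemma M_0: "M t 0 = 0" "M1 t 0 = 0" "M2 t 0 = 0" by (simp_all add: M_def M1_def M2_def Lin_0)

lemma M_deriv_x: "(M t has_real_derivative J t x) (at x)" "(M1 t has_real_derivative J1 t x) (at x)"
   "(M2 t has_real_derivative J2 t x) (at x)"
  unfolding M_def M1_def M2_def J_def J1_def J2_def by (rule Lin_deriv)+

lemma M_deriv_t: "((\<lambda>t. M t x) has_real_derivative M1 t x) (at t)" "((\<lambda>t. M1 t x) has_real_derivative M2 t x) (at t)"
   "((\<lambda>t. J t x) has_real_derivative J1 t x) (at t)"
  unfolding M_def M1_def M2_def J_def J1_def Lin_def lin_def
  by (auto intro!: derivative_eq_intros coeff_deriv)

lemma J_square: "J t x = (cos (c * t) + v0 x * sin (c * t) / (2 * c))\<^sup>2 + (\<rho>0 x * sin (c * t) / (2 * c))\<^sup>2"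
  using c_pos by (simp add: J_def lin_def coeff_defs e0_def power2_eq_square field_simps)

text \<open>With \<open>w = A + \<i> B\<close> one has \<open>J = A\<^sup>2 + B\<^sup>2\<close>, \<open>J1 = 2 (A A' + B B')\<close> and the constant Wronskian
\<open>A B' - A' B = \<rho>0 / 2\<close>; the identity is Lagrange's for these two pairs, together with \<open>w'' = - c\<^sup>2 w\<close>.
It is the first equation of the system in Lagrangian form.\<close>

lemma J_identity: "2 * J t x * J2 t x = (J1 t x)\<^sup>2 + (\<rho>0 x)\<^sup>2 - 4 * c\<^sup>2 * (J t x)\<^sup>2"
proof -
  define s where "s = sin (c * t)"
  define C where "C = cos (c * t)"
  define S where "S = s / (2 * c)"
  define v where "v = v0 x"
  define r where "r = \<rho>0 x"
  have sc: "s * s + C * C = 1" using sin_cos_squared_add[of "c * t"] by (simp add: s_def C_def power2_eq_square)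
  have s: "s = 2 * c * S" using c_pos by (simp add: S_def)
  define A where "A = C + v * S"
  define B where "B = r * S"
  define A' where "A' = - c * s + v * C / 2"
  define B' where "B' = r * C / 2"
  have ka': "ka t = S * S" "be t = 2 * S * C" "ka1 t = S * C"
    using c_pos unfolding coeff_defs s_def[symmetric] C_def[symmetric] by (simp_all add: s power2_eq_square field_simps)
  have JJ: "J t x = A * A + B * B"
    unfolding J_def lin_def e0_def ka' al_def C_def[symmetric] v_def[symmetric] r_def[symmetric] A_def B_def
    by (simp add: power2_eq_square algebra_simps)
  have JJ1: "J1 t x = 2 * (A * A' + B * B')"
    unfolding J1_def lin_def e0_def ka' al1_def be1_def C_def[symmetric] s_def[symmetric] v_def[symmetric] r_def[symmetric] A_def B_def A'_def B'_def
    by (simp add: s power2_eq_square algebra_simps)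
  have JJ2: "J2 t x = 2 * (A' * A' + B' * B') - 2 * c\<^sup>2 * (A * A + B * B)"
    unfolding J2_def lin_def e0_def al2_def be2_def ka2_def C_def[symmetric] s_def[symmetric] v_def[symmetric] r_def[symmetric] A_def B_def A'_def B'_def
    by (simp add: s power2_eq_square field_simps)
  have "A * B' - A' * B = r / 2 * (s * s + C * C)"
    using c_pos by (simp add: A_def B_def A'_def B'_def s algebra_simps)
  then have W: "r = 2 * (A * B' - A' * B)" using sc by simp
  show ?thesis unfolding JJ JJ1 JJ2 r_def[symmetric] unfolding W by (simp add: power2_eq_square algebra_simps)
qed

text \<open>Time enters \<open>J\<close> only through the point \<open>(cos (c t), sin (c t))\<close> of the unit circle, so \<open>J\<close> takes its
values from a positive continuous function on a compact set.  The hypothesis that \<open>\<rho>0\<close> has no zero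
is used here.\<close>

lemma J_lower: "\<exists>\<delta>>0. \<forall>t x. \<delta> \<le> J t x"
proof -
  (* The first component of z stands for (cos (c t), sin (c t)). *)
  let ?j = "\<lambda>z. (Re (fst z) + v0 (snd z) * Im (fst z) / (2 * c))\<^sup>2 + (\<rho>0 (snd z) * Im (fst z) / (2 * c))\<^sup>2"
  let ?S = "sphere (0::complex) 1 \<times> {0..1::real}"
  have cont: "continuous_on ?S ?j"
    using c_pos by (intro continuous_intros continuous_on_compose2[OF v0_cont[of UNIV]] continuous_on_compose2[OF \<rho>0_cont[of UNIV]]) auto
  have "compact ?S" "?S \<noteq> {}" by (auto intro!: compact_Times simp: sphere_eq_empty)
  from continuous_attains_inf[OF this cont] obtain z where z: "z \<in> ?S" "\<And>y. y \<in> ?S \<Longrightarrow> ?j z \<le> ?j y" by blast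
  have "0 < ?j z"
  proof (cases "Im (fst z) = 0")
    case True
    then have "Re (fst z) \<noteq> 0" using z(1) by (auto simp: mem_Times_iff cmod_def)
    then show ?thesis using True by simp
  next
    case False
    then show ?thesis using \<rho>0_nz c_pos by (intro add_nonneg_pos) auto
  qed
  moreover have "?j z \<le> J t x" for t x
  proof -
    have "?j z \<le> ?j (cis (c * t), frac x)" using frac_unit[of x] by (intro z(2)) auto
    also have "\<dots> = J t (frac x)" by (simp add: J_square)
    also have "\<dots> = J t x" using periodic_frac[of "J t" x] by (simp add: periodic1_def J_per)
    finally show ?thesis .
  qed
  ultimately show ?thesis by blast
qed

definition \<delta> :: real where "\<delta> = (SOME \<delta>. \<delta> > 0 \<and> (\<forall>t x. \<delta> \<le> J t x))"

lemma \<delta>: "0 < \<delta>" "\<delta> \<le> J t x"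
  using someI_ex[OF J_lower] unfolding \<delta>_def by auto

lemma J_pos: "0 < J t x" using \<delta>(1) \<delta>(2)[of t x] by linarith

lemma J2_bound: "\<exists>K. \<forall>t x. \<bar>J2 t x\<bar> \<le> K"
proof -
  obtain V where V: "V > 0" "\<And>x. \<bar>v0 x\<bar> \<le> V"
    using jcont_bound[of "\<lambda>t. v0" 0] jcont_const_t[OF v0_cont] v0_per by (auto simp: periodic1_def) (metis abs_zero zero_le_one)
  obtain W where W: "W > 0" "\<And>x. \<bar>e0 x\<bar> \<le> W"
    using jcont_bound[of "\<lambda>t. e0" 0] jcont_const_t[OF e0_cont] e0_per by (auto simp: periodic1_def) (metis abs_zero zero_le_one)
  have sq: "(sin y)\<^sup>2 \<le> 1" "(cos y)\<^sup>2 \<le> 1" "0 \<le> (sin y)\<^sup>2" "0 \<le> (cos y)\<^sup>2" for y :: real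
    by (simp_all add: abs_square_le_1)
  have 1: "\<bar>(cos y)\<^sup>2 - (sin y)\<^sup>2\<bar> \<le> 1" for y :: real using sq[of y] by linarith
  have 2: "\<bar>sin y * cos y\<bar> \<le> 1" for y :: real
    unfolding abs_mult using mult_mono[of "\<bar>sin y\<bar>" 1 "\<bar>cos y\<bar>" 1] by simp
  have "\<bar>J2 t x\<bar> \<le> 2 * c\<^sup>2 * 1 + 4 * c * 1 * V + 1 / 2 * W" for t x
  proof -
    have "\<bar>J2 t x\<bar> \<le> \<bar>al2 t\<bar> + \<bar>be2 t\<bar> * \<bar>v0 x\<bar> + \<bar>ka2 t\<bar> * \<bar>e0 x\<bar>"
      unfolding J2_def lin_def abs_mult[symmetric] by linarith
    also have "\<dots> \<le> 2 * c\<^sup>2 * 1 + 4 * c * 1 * V + 1 / 2 * W"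
    proof (intro add_mono mult_mono V W)
      show "\<bar>al2 t\<bar> \<le> 2 * c\<^sup>2 * 1" unfolding al2_def abs_mult using 1 by (intro mult_mono) auto
      show "\<bar>be2 t\<bar> \<le> 4 * c * 1" unfolding be2_def abs_mult[of "- 4 * c"] using 2 c_pos by (intro mult_mono) auto
      show "\<bar>ka2 t\<bar> \<le> 1 / 2" unfolding ka2_def using 1[of "c * t"] by (simp add: abs_divide)
    qed (use c_pos in auto)
    finally show ?thesis .
  qed
  then show ?thesis by blast
qed

definition K2 :: real where "K2 = (SOME K. \<forall>t x. \<bar>J2 t x\<bar> \<le> K)"

lemma K2: "\<bar>J2 t x\<bar> \<le> K2" using someI_ex[OF J2_bound] unfolding K2_def by auto

lemma M_mvt: "\<exists>z. M t x - M t y = (x - y) * J t z" "\<exists>z. M2 t x - M2 t y = (x - y) * J2 t z"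
proof -
  have gen: "\<exists>z. F x - F y = (x - y) * f z" if "\<And>z. (F has_real_derivative f z) (at z)" for F f :: "real \<Rightarrow> real"
  proof (cases x y rule: linorder_cases)
    case less
    from MVT2[OF less, of F f] that obtain z where "F y - F x = (y - x) * f z" by blast
    then show ?thesis by (intro exI[of _ z]) (simp add: algebra_simps)
  next
    case greater
    from MVT2[OF greater, of F f] that show ?thesis by blast
  qed simp
  show "\<exists>z. M t x - M t y = (x - y) * J t z" "\<exists>z. M2 t x - M2 t y = (x - y) * J2 t z"
    by (rule gen, rule M_deriv_x)+
qed

lemma M_expand: "\<delta> * \<bar>x - y\<bar> \<le> \<bar>M t x - M t y\<bar>"
proof -
  obtain z where "M t x - M t y = (x - y) * J t z" using M_mvt(1) by blast
  then show ?thesis using \<delta>(2)[of t z] J_pos[of t z] by (simp add: abs_mult mult.commute[of \<delta>] mult_left_mono)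
qed

lemma M2_lipschitz: "\<bar>M2 t x - M2 t y\<bar> \<le> K2 * \<bar>x - y\<bar>"
proof -
  obtain z where "M2 t x - M2 t y = (x - y) * J2 t z" using M_mvt(2) by blast
  then show ?thesis using K2[of t z] by (simp add: abs_mult mult.commute[of K2] mult_left_mono)
qed

lemma M2_bound: "\<bar>M2 t x\<bar> \<le> K2"
proof -
  have "M2 t x = M2 t (frac x)" using periodic_frac[of "M2 t" x] by (simp add: periodic1_def M_per)
  then have "\<bar>M2 t x\<bar> \<le> K2 * \<bar>frac x - 0\<bar>" using M2_lipschitz[of t "frac x" 0] by (simp add: M_0)
  also have "\<dots> \<le> K2 * 1" using K2[of 0 0] frac_unit[of x] by (intro mult_left_mono) auto
  finally show ?thesis by simp
qed

section \<open>The inverse of the normalised flow\<close>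

lemma M_surj: "\<exists>x. M t x = z"
proof -
  have per: "M t (x + of_int n) - (x + of_int n) = M t x - x" for x and n :: int
    by (rule periodic_of_int[where f = "\<lambda>x. M t x - x"]) (simp add: M_per)
  (* M t fixes the integers, so z is enclosed by its neighbours. *)
  have Mn: "M t (of_int n) = of_int n" for n :: int using per[of 0 n] by (simp add: M_0)
  have "\<exists>x\<ge>of_int \<lfloor>z\<rfloor>. x \<le> of_int \<lfloor>z\<rfloor> + 1 \<and> M t x = z"
  proof (rule IVT')
    show "M t (of_int \<lfloor>z\<rfloor>) \<le> z" by (simp add: Mn)
    show "z \<le> M t (of_int \<lfloor>z\<rfloor> + 1)" by (simp add: M_per Mn)
    show "continuous_on {of_int \<lfloor>z\<rfloor>..of_int \<lfloor>z\<rfloor> + 1} (M t)" by (rule jcont_x[OF M_jcont(1)])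
  qed simp
  then show ?thesis by blast
qed

definition Y :: "real \<Rightarrow> real \<Rightarrow> real" where "Y t z = (SOME x. M t x = z)"

lemma M_Y: "M t (Y t z) = z" unfolding Y_def by (rule someI_ex[OF M_surj])

lemma M_inj: "M t x = M t y \<Longrightarrow> x = y"
  using M_expand[of x y t] \<delta>(1) by (simp add: mult_le_0_iff)

lemma Y_M: "Y t (M t x) = x" by (rule M_inj[of t]) (rule M_Y)

lemma Y_per: "Y t (z + 1) = Y t z + 1"
  by (rule M_inj[of t]) (simp add: M_Y M_per)

text \<open>The inverse is compared with an arbitrary point \<open>x\<close>.  With \<open>x\<close> frozen at \<open>Y t z\<close> for another time this
gives joint continuity, and with \<open>x\<close> another value of \<open>Y t\<close> the Lipschitz bound.\<close>

lemma Y_contract: "\<bar>Y t z - x\<bar> \<le> \<bar>z - M t x\<bar> / \<delta>"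
  using M_expand[of "Y t z" x t] \<delta>(1) by (simp add: M_Y field_simps)

lemma Y_jcont: "jcont Y"
  unfolding jcont_def continuous_on_def
proof
  fix w :: "real \<times> real"
  obtain t z where w: "w = (t, z)" by (cases w)
  have c1: "continuous_on UNIV (\<lambda>v. \<bar>snd v - M (fst v) (Y t z)\<bar> / \<delta>)"
    using \<delta>(1) by (intro continuous_intros jcont_compose[OF M_jcont(1)]) auto
  have "((\<lambda>v. \<bar>snd v - M (fst v) (Y t z)\<bar> / \<delta>) \<longlongrightarrow> \<bar>snd w - M (fst w) (Y t z)\<bar> / \<delta>) (at w)"
    using c1[unfolded continuous_on_def, rule_format, of w] by simp
  then have "((\<lambda>v. \<bar>snd v - M (fst v) (Y t z)\<bar> / \<delta>) \<longlongrightarrow> 0) (at w)" by (simp add: w M_Y)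
  then have "((\<lambda>v. Y (fst v) (snd v) - Y t z) \<longlongrightarrow> 0) (at w)"
    by (rule Lim_null_comparison[rotated]) (auto intro!: always_eventually Y_contract)
  then show "((\<lambda>v. Y (fst v) (snd v)) \<longlongrightarrow> Y (fst w) (snd w)) (at w)"
    unfolding w fst_conv snd_conv by (rule Lim_null[THEN iffD2])
qed

lemma Y_deriv: "(Y t has_real_derivative inverse (J t (Y t z))) (at z)"
proof (rule DERIV_inverse_function[where f = "M t" and a = "z - 1" and b = "z + 1"])
  show "isCont (Y t) z" using jcont_x[OF Y_jcont, of UNIV t] by (simp add: continuous_on_eq_continuous_at)
qed (use M_deriv_x(1) J_pos[of t "Y t z"] M_Y in auto)

text \<open>Adding a second primitive \<open>H\<close> of \<open>h\<close> removes the possibly unbounded forcing, so that the bounded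
theory applies to the remainder \<open>p = q - H\<close>.\<close>

lemma q_exists: "\<exists>q q1 q2. q 0 = 0 \<and> q1 0 = u0 0 \<and> (\<forall>t. (q has_real_derivative q1 t) (at t)) \<and>
  (\<forall>t. (q1 has_real_derivative q2 t) (at t)) \<and> (\<forall>t. q2 t = h t - M2 t (Y t (- q t)))"
proof -
  obtain H1 where H1: "H1 0 = 0" "\<And>t. (H1 has_real_derivative h t) (at t)"
    using continuous_antiderivative[OF h] by blast
  have H1c: "continuous_on UNIV H1" using H1(2) by (meson DERIV_isCont continuous_at_imp_continuous_on)
  obtain H where H: "H 0 = 0" "\<And>t. (H has_real_derivative H1 t) (at t)"
    using continuous_antiderivative[OF H1c] by blast
  have Hc: "continuous_on UNIV H" using H(2) by (meson DERIV_isCont continuous_at_imp_continuous_on)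
  (* The point Y t (- q) is the label that sits at the Eulerian point 0. *)
  let ?G = "\<lambda>t p. - M2 t (Y t (- (H t + p)))"
  have jG: "jcont ?G" unfolding jcont_def
    by (intro continuous_intros jcont_compose[OF M_jcont(3)] jcont_compose[OF Y_jcont] continuous_on_compose2[OF Hc]) auto
  have bG: "\<bar>?G t p\<bar> \<le> K2" for t p using M2_bound by simp
  have lG: "\<bar>?G t a - ?G t b\<bar> \<le> K2 / \<delta> * \<bar>a - b\<bar>" for t a b
  proof -
    have "\<bar>?G t a - ?G t b\<bar> \<le> K2 * \<bar>Y t (- (H t + a)) - Y t (- (H t + b))\<bar>"
      using M2_lipschitz[of t "Y t (- (H t + a))" "Y t (- (H t + b))"] by simp
    also have "\<dots> \<le> K2 * (\<bar>a - b\<bar> / \<delta>)"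
      using Y_contract[of t "- (H t + a)" "Y t (- (H t + b))"] K2[of 0 0] by (intro mult_left_mono) (auto simp: M_Y abs_minus_commute)
    finally show ?thesis by simp
  qed
  from picard_second_order[OF jG bG lG, of "u0 0"] obtain p p' where
    p: "p 0 = 0" "p' 0 = u0 0" "\<And>t. (p has_real_derivative p' t) (at t)" "\<And>t. (p' has_real_derivative ?G t (p t)) (at t)"
    by blast
  show ?thesis
  proof (rule exI[of _ "\<lambda>t. H t + p t"], rule exI[of _ "\<lambda>t. H1 t + p' t"], rule exI[of _ "\<lambda>t. h t + ?G t (p t)"], intro conjI allI)
    show "((\<lambda>t. H t + p t) has_real_derivative H1 t + p' t) (at t)" for t by (intro DERIV_add H p)
    show "((\<lambda>t. H1 t + p' t) has_real_derivative h t + ?G t (p t)) (at t)" for t by (intro DERIV_add H1 p)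
  qed (simp_all add: H H1 p)
qed

section \<open>The explicit flow and velocity\<close>

definition q_triple :: "(real \<Rightarrow> real) \<times> (real \<Rightarrow> real) \<times> (real \<Rightarrow> real)" where
  "q_triple = (SOME (a, b, d). a 0 = 0 \<and> b 0 = u0 0 \<and> (\<forall>t. (a has_real_derivative b t) (at t)) \<and>
     (\<forall>t. (b has_real_derivative d t) (at t)) \<and> (\<forall>t. d t = h t - M2 t (Y t (- a t))))"

definition "q = fst q_triple"
definition "q1 = fst (snd q_triple)"
definition "q2 = snd (snd q_triple)"

lemma q_0: "q 0 = 0" and q1_0: "q1 0 = u0 0" and q_deriv: "(q has_real_derivative q1 t) (at t)"
  and q1_deriv: "(q1 has_real_derivative q2 t) (at t)" and q2_eq: "q2 t = h t - M2 t (Y t (- q t))"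
proof -
  have "\<exists>p. case p of (a, b, d) \<Rightarrow> a 0 = 0 \<and> b 0 = u0 0 \<and> (\<forall>t. (a has_real_derivative b t) (at t)) \<and>
     (\<forall>t. (b has_real_derivative d t) (at t)) \<and> (\<forall>t. d t = h t - M2 t (Y t (- a t)))"
    using q_exists by auto
  from someI_ex[OF this, folded q_triple_def]
  have T: "q 0 = 0 \<and> q1 0 = u0 0 \<and> (\<forall>t. (q has_real_derivative q1 t) (at t)) \<and>
     (\<forall>t. (q1 has_real_derivative q2 t) (at t)) \<and> (\<forall>t. q2 t = h t - M2 t (Y t (- q t)))"
    unfolding q_def q1_def q2_def case_prod_beta .
  then show "q 0 = 0" "q1 0 = u0 0" "(q has_real_derivative q1 t) (at t)" "(q1 has_real_derivative q2 t) (at t)"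
    by blast+
  show "q2 t = h t - M2 t (Y t (- q t))" using T by blast
qed

lemma q_cont: "continuous_on S q" and q1_cont: "continuous_on S q1"
  using q_deriv q1_deriv by (meson DERIV_isCont continuous_at_imp_continuous_on)+

text \<open>The flow \<open>\<phi>\<close>, its inverse \<open>g\<close> and the derivative \<open>\<gamma>\<close> of the inverse.\<close>

definition \<phi> :: "real \<Rightarrow> real \<Rightarrow> real" where "\<phi> t x = q t + M t x"
definition g :: "real \<Rightarrow> real \<Rightarrow> real" where "g t y = Y t (y - q t)"
definition \<gamma> :: "real \<Rightarrow> real \<Rightarrow> real" where "\<gamma> t y = inverse (J t (g t y))"

lemma g_\<phi>: "g t (\<phi> t x) = x" by (simp add: g_def \<phi>_def Y_M)

lemma q_jcont: "jcont (\<lambda>t x. q t)" "jcont (\<lambda>t x. q1 t)"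
  by (intro jcont_const_x q_cont q1_cont)+

lemma \<phi>_jcont: "jcont \<phi>"
  unfolding \<phi>_def[abs_def] by (intro jcont_add q_jcont M_jcont)

lemma g_jcont: "jcont g"
  unfolding g_def[abs_def] by (intro jcont_comp[OF Y_jcont] jcont_diff q_jcont jcont_const_t continuous_on_id)

lemma J_nz: "J t x \<noteq> 0" using J_pos[of t x] by simp

lemma \<phi>_deriv: "(\<phi> t has_real_derivative J t x) (at x)"
  unfolding \<phi>_def[abs_def] using DERIV_add[OF DERIV_const M_deriv_x(1)] by simp

lemma g_deriv: "(g t has_real_derivative \<gamma> t y) (at y)"
  unfolding g_def[abs_def] \<gamma>_def
  using DERIV_chain2[OF Y_deriv DERIV_diff[OF DERIV_ident DERIV_const[of "q t"]]] by (simp add: g_def)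

lemma g_per: "g t (y + 1) = g t y + 1"
  using Y_per[of t "y - q t"] by (simp add: g_def algebra_simps)

lemma flow_g: "flow g \<gamma>"
  unfolding flow_def
proof (intro conjI allI)
  show "jcont g" by (rule g_jcont)
  show "jcont \<gamma>" unfolding \<gamma>_def[abs_def]
    by (rule jcont_inverse[OF jcont_comp[OF J_jcont(1) g_jcont] J_nz])
next
  fix t x
  show "(g t has_real_derivative \<gamma> t x) (at x)" by (rule g_deriv)
  show "0 < \<gamma> t x" by (simp add: \<gamma>_def J_pos)
  show "g t (x + 1) = g t x + 1" by (rule g_per)
  show "\<gamma> t (x + 1) = \<gamma> t x" by (simp add: \<gamma>_def g_per J_per)
qed

lemma inverse_J_family: "sob_family \<sigma> (Suc k) (\<lambda>t x. inverse (J t x))"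
  by (intro sob_family_inverse \<sigma> J_nz J_family)

lemma \<gamma>_family: "sob_family \<sigma> (Suc k) \<gamma>"
  by (rule sob_family_flow_derivative[OF \<sigma> flow_g inverse_J_family]) (rule \<gamma>_def)

lemma compose_family: "sob_family \<sigma> (Suc k) F \<Longrightarrow> sob_family \<sigma> (Suc k) (\<lambda>t x. F t (g t x))"
  by (rule sob_family_compose[OF \<sigma> flow_g _ \<gamma>_family])

definition u :: "real \<Rightarrow> real \<Rightarrow> real" where "u t y = q1 t + M1 t (g t y)"
definition ux :: "real \<Rightarrow> real \<Rightarrow> real" where "ux t y = J1 t (g t y) * inverse (J t (g t y))"
definition \<rho> :: "real \<Rightarrow> real \<Rightarrow> real" where "\<rho> t y = \<rho>0 (g t y) * inverse (J t (g t y))"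
text \<open>The material acceleration, that is \<open>\<phi>\<^sub>t\<^sub>t\<close> in Eulerian coordinates.\<close>

definition accel :: "real \<Rightarrow> real \<Rightarrow> real" where "accel t y = q2 t + M2 t (g t y)"
text \<open>The Eulerian time derivative is defined by the relation \<open>u\<^sub>t + u u\<^sub>x = accel\<close>; that it is the derivative
of the curve \<open>u\<close> is shown with \<open>momentum_transport\<close>.\<close>

definition ut :: "real \<Rightarrow> real \<Rightarrow> real" where "ut t y = accel t y + (- 1) * (u t y * ux t y)"

lemma ux_family: "sob_family \<sigma> (Suc k) ux"
  unfolding ux_def[abs_def]
  by (rule compose_family[OF sob_family_mult[OF \<sigma> J_family(2) inverse_J_family]])

lemma \<rho>_family: "sob_family \<sigma> (Suc k) \<rho>"
  unfolding \<rho>_def[abs_def]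
  by (rule compose_family[OF sob_family_mult[OF \<sigma> \<rho>0_family inverse_J_family]])

lemma u_deriv: "(u t has_real_derivative ux t y) (at y)"
  unfolding u_def[abs_def] ux_def
  using DERIV_add[OF DERIV_const DERIV_chain2[OF M_deriv_x(2) g_deriv]] by (simp add: \<gamma>_def)

lemma u_per: "periodic1 (u t)" by (simp add: periodic1_def u_def g_per M_per)

lemma u_jcont: "jcont u"
  unfolding u_def[abs_def] by (rule jcont_add[OF q_jcont(2) jcont_comp[OF M_jcont(2) g_jcont]])

lemma ux_jcont: "jcont ux" by (rule sob_family_jcont[OF ux_family \<sigma>(1) \<sigma>1])

lemma u_ac: "ac_deriv (u t) (ux t)"
  by (rule ac_deriv_C1[OF u_deriv jcont_x[OF ux_jcont]])

lemma u_family: "sob_family \<sigma> (Suc (Suc k)) u"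
  by (rule sob_familyI[OF ux_family u_ac u_per jcont_t[OF u_jcont]])

text \<open>The equation for \<open>q\<close> was chosen to make the acceleration at the point 0 equal to \<open>h\<close>.\<close>

lemma accel_eq: "accel t y = h t + (M2 t (g t y) - M2 t (g t 0))"
  by (simp add: accel_def q2_eq g_def)

lemma accel_deriv: "(accel t has_real_derivative J2 t (g t y) * inverse (J t (g t y))) (at y)"
  unfolding accel_def[abs_def]
  using DERIV_add[OF DERIV_const DERIV_chain2[OF M_deriv_x(3) g_deriv]] by (simp add: \<gamma>_def)

lemma accel_family: "sob_family \<sigma> (Suc (Suc k)) accel"
proof -
  let ?a = "\<lambda>t y. J2 t (g t y) * inverse (J t (g t y))"
  have f: "sob_family \<sigma> (Suc k) ?a"
    by (rule compose_family[OF sob_family_mult[OF \<sigma> J_family(3) inverse_J_family]])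
  show ?thesis
  proof (rule sob_familyI[OF f])
    show "ac_deriv (accel t) (?a t)" for t
      by (rule ac_deriv_C1[OF accel_deriv jcont_x[OF sob_family_jcont[OF f \<sigma>(1) \<sigma>1]]])
    show "periodic1 (accel t)" for t by (simp add: periodic1_def accel_def g_per M_per)
    show "continuous_on UNIV (\<lambda>t. accel t 0)" using h by (simp add: accel_eq)
  qed
qed

lemma ut_family: "sob_family \<sigma> (Suc k) ut"
  unfolding ut_def[abs_def]
  by (intro sob_family_add sob_family_time_mult sob_family_mult \<sigma> ux_family continuous_on_const
      sob_family_Suc[OF accel_family \<sigma>(1) \<sigma>1] sob_family_Suc[OF u_family \<sigma>(1) \<sigma>1])

lemma u_initial: "u 0 = u0" and \<rho>_initial: "\<rho> 0 = \<rho>0"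
proof -
  have c0: "al 0 = 1" "be 0 = 0" "ka 0 = 0" "al1 0 = 0" "be1 0 = 1" "ka1 0 = 0" by (simp_all add: coeff_defs)
  have "M 0 x = x" for x by (simp add: M_def Lin_def c0)
  then have "g 0 y = y" for y using Y_M[of 0 y] by (simp add: g_def q_0)
  then show "u 0 = u0" "\<rho> 0 = \<rho>0"
    by (auto simp: u_def \<rho>_def q1_0 M1_def Lin_def J_def lin_def c0)
qed

section \<open>Evolution of the Fourier coefficients\<close>

text \<open>In the labels \<open>x\<close> the time dependence is differentiable although \<open>F t \<circ> g t\<close> need not be
differentiable in time at a fixed point.\<close>

lemma fc_lagrangian:
  assumes F: "jcont F" "\<And>t. periodic1 (F t)"
  shows "fc (\<lambda>y. F t (g t y)) n =
    integral {0..1} (\<lambda>x. complex_of_real (F t x * J t x) * cis (- (2 * pi * real_of_int n * \<phi> t x)))"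
proof -
  let ?f = "\<lambda>y. complex_of_real (F t (g t y)) * cis (- (2 * pi * real_of_int n * y))"
  have Fc: "continuous_on UNIV (\<lambda>y. F t (g t y))" by (rule jcont_x[OF jcont_comp[OF F(1) g_jcont]])
  have fc: "continuous_on S ?f" for S
    by (intro continuous_intros continuous_on_subset[OF Fc]) auto
  have per: "?f (y + 1) = ?f y" for y
  proof -
    have "- (2 * pi * real_of_int n * (y + 1)) = - (2 * pi * real_of_int n * y) + 2 * pi * real_of_int (- n)"
      by (simp add: distrib_left)
    then have "cis (- (2 * pi * real_of_int n * (y + 1))) = cis (- (2 * pi * real_of_int n * y)) * cis (2 * pi * real_of_int (- n))"
      by (simp only: cis_mult)
    also have "cis (2 * pi * real_of_int (- n)) = 1" by (rule cis_multiple_2pi) simp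
    finally show ?thesis using F(2)[of t] by (simp add: g_per periodic1_def)
  qed
  have \<phi>1: "\<phi> t 1 = \<phi> t 0 + 1" using M_per(1)[of t 0] by (simp add: \<phi>_def)
  have "fc (\<lambda>y. F t (g t y)) n = integral {0..1} ?f" by (rule fc_integral_continuous[OF Fc])
  also have "\<dots> = integral {\<phi> t 0..\<phi> t 1} ?f" unfolding \<phi>1
    by (rule periodic_integral[where f = ?f, OF per abs_integrable_continuous[OF fc], symmetric])
  also have "\<dots> = integral {0..1} (\<lambda>x. J t x *\<^sub>R ?f (\<phi> t x))"
    by (rule integral_substitution_increasing(2)[OF \<phi>_deriv J_pos, symmetric]) (auto intro: abs_integrable_continuous fc)
  also have "\<dots> = integral {0..1} (\<lambda>x. complex_of_real (F t x * J t x) * cis (- (2 * pi * real_of_int n * \<phi> t x)))"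
    by (simp add: g_\<phi> scaleR_conv_of_real mult_ac)
  finally show ?thesis .
qed

text \<open>The velocity in Lagrangian coordinates.\<close>

definition \<phi>1 :: "real \<Rightarrow> real \<Rightarrow> real" where "\<phi>1 t x = q1 t + M1 t x"

lemma \<phi>_deriv_t: "((\<lambda>t. \<phi> t x) has_real_derivative \<phi>1 t x) (at t)"
  unfolding \<phi>_def \<phi>1_def by (intro DERIV_add q_deriv M_deriv_t)

lemma \<phi>1_jcont: "jcont \<phi>1" unfolding \<phi>1_def[abs_def] by (intro jcont_add q_jcont M_jcont)

lemma \<phi>1_per: "periodic1 (\<phi>1 t)" by (simp add: periodic1_def \<phi>1_def M_per)

text \<open>The weak form of \<open>\<partial>\<^sub>t f + \<partial>\<^sub>x (u f) = A \<circ> g\<close> for \<open>f = F \<circ> g\<close>, tested against exponentials: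
differentiation under the integral, once in the density \<open>F J\<close> and once in the exponent.\<close>

lemma fc_transport:
  assumes F: "jcont F" "\<And>t. periodic1 (F t)" and A: "jcont A" "\<And>t. periodic1 (A t)"
    and der: "\<And>t x. ((\<lambda>t. F t x * J t x) has_real_derivative A t x * J t x) (at t)"
  shows "((\<lambda>\<tau>. fc (\<lambda>y. F \<tau> (g \<tau> y)) n) has_vector_derivative
     fc (\<lambda>y. A t (g t y)) n - \<i> * of_real (2 * pi * real_of_int n) * fc (\<lambda>y. \<phi>1 t (g t y) * F t (g t y)) n) (at t)"
proof -
  define w where "w = 2 * pi * real_of_int n"
  let ?e = "\<lambda>t x. cis (- (w * \<phi> t x))"
  let ?D = "\<lambda>t x. complex_of_real (A t x * J t x) * ?e t x - \<i> * of_real w * (complex_of_real (\<phi>1 t x * F t x * J t x) * ?e t x)"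
  have P: "jcont (\<lambda>t x. \<phi>1 t x * F t x)" "periodic1 (\<lambda>x. \<phi>1 t x * F t x)" for t
    using jcont_mult[OF \<phi>1_jcont F(1)] F(2)[of t] \<phi>1_per[of t] by (auto simp: periodic1_def)
  have cont: "continuous_on S (\<lambda>z. complex_of_real (H (fst z) (snd z) * J (fst z) (snd z)) * ?e (fst z) (snd z))" if "jcont H" for H and S :: "(real \<times> real) set"
    by (intro continuous_intros jcont_compose[OF that] jcont_compose[OF J_jcont(1)] jcont_compose[OF \<phi>_jcont])
  have cont1: "continuous_on S (\<lambda>x. complex_of_real (H t x * J t x) * ?e t x)" if "jcont H" for H t S
    by (intro continuous_intros jcont_x[OF that] jcont_x[OF J_jcont(1)] jcont_x[OF \<phi>_jcont])
  have "((\<lambda>\<tau>. integral (cbox 0 1) (\<lambda>x. complex_of_real (F \<tau> x * J \<tau> x) * ?e \<tau> x)) has_vector_derivative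
      integral (cbox 0 1) (?D t)) (at t within UNIV)"
  proof (rule leibniz_rule_vector_derivative)
    fix t x :: real
    have "((\<lambda>t. complex_of_real (F t x * J t x)) has_vector_derivative complex_of_real (A t x * J t x)) (at t)"
      by (rule has_vector_derivative_of_real[OF der])
    moreover have "((\<lambda>t. ?e t x) has_vector_derivative (- (w * \<phi>1 t x)) *\<^sub>R (\<i> * ?e t x)) (at t)"
    proof -
      have "((\<lambda>t. - (w * \<phi> t x)) has_vector_derivative - (w * \<phi>1 t x)) (at t)"
        using DERIV_minus[OF DERIV_cmult[OF \<phi>_deriv_t[of x t], of w]]
        by (simp only: has_real_derivative_iff_has_vector_derivative)
      then have "((\<lambda>t. - (w * \<phi> t x)) has_derivative (\<lambda>y. y *\<^sub>R (- (w * \<phi>1 t x)))) (at t)"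
        unfolding has_vector_derivative_def .
      from has_derivative_cis[OF this] show ?thesis
        unfolding has_vector_derivative_def by (simp add: scaleR_conv_of_real mult_ac)
    qed
    ultimately have "((\<lambda>t. complex_of_real (F t x * J t x) * ?e t x) has_vector_derivative
       (complex_of_real (F t x * J t x) * ((- (w * \<phi>1 t x)) *\<^sub>R (\<i> * ?e t x)) + complex_of_real (A t x * J t x) * ?e t x)) (at t)"
      by (rule has_vector_derivative_mult)
    moreover have "complex_of_real (F t x * J t x) * ((- (w * \<phi>1 t x)) *\<^sub>R (\<i> * ?e t x)) + complex_of_real (A t x * J t x) * ?e t x = ?D t x"
      by (simp add: scaleR_conv_of_real algebra_simps)
    ultimately show "((\<lambda>t. complex_of_real (F t x * J t x) * ?e t x) has_vector_derivative ?D t x) (at t within UNIV)"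
      by simp
  next
    fix t :: real
    show "(\<lambda>x. complex_of_real (F t x * J t x) * ?e t x) integrable_on cbox 0 1"
      by (rule integrable_continuous) (rule cont1[OF F(1)])
  next
    show "continuous_on (UNIV \<times> cbox 0 1) (\<lambda>(t, x). ?D t x)"
      unfolding case_prod_beta
      by (intro continuous_on_diff continuous_on_mult continuous_on_const cont[OF A(1)] cont[OF P(1)])
  qed auto
  then have L: "((\<lambda>\<tau>. fc (\<lambda>y. F \<tau> (g \<tau> y)) n) has_vector_derivative integral {0..1} (?D t)) (at t)"
    unfolding fc_lagrangian[OF F] w_def by simp
  have i: "(\<lambda>x. complex_of_real (H t x * J t x) * ?e t x) integrable_on {0..1}" if "jcont H" for H
    by (intro integrable_continuous_interval cont1[OF that])
  have i2: "(\<lambda>x. \<i> * of_real w * (complex_of_real (\<phi>1 t x * F t x * J t x) * ?e t x)) integrable_on {0..1}"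
    by (rule integrable_on_mult_right[OF i[OF P(1)]])
  have "integral {0..1} (?D t) = integral {0..1} (\<lambda>x. complex_of_real (A t x * J t x) * ?e t x)
      - \<i> * of_real w * integral {0..1} (\<lambda>x. complex_of_real (\<phi>1 t x * F t x * J t x) * ?e t x)"
    by (simp only: Henstock_Kurzweil_Integration.integral_diff[OF i[OF A(1)] i2] integral_mult_right)
  also have "\<dots> = fc (\<lambda>y. A t (g t y)) n - \<i> * of_real w * fc (\<lambda>y. \<phi>1 t (g t y) * F t (g t y)) n"
    unfolding fc_lagrangian[OF A] fc_lagrangian[OF P] w_def ..
  finally show ?thesis using L by (simp only: w_def)
qed

lemma jcont_per_of_family: "sob_family \<sigma> (Suc m) F \<Longrightarrow> jcont F \<and> (\<forall>t. periodic1 (F t))"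
  using sob_family_jcont[OF _ \<sigma>(1) \<sigma>1] sob_family_periodic by blast

lemma u_\<phi>1: "\<phi>1 t (g t y) = u t y" by (simp add: \<phi>1_def u_def)

text \<open>The transport identity applied to the velocity itself; \<open>\<partial>\<^sub>x (u\<^sup>2) = 2 u u\<^sub>x\<close> turns its flux into the
nonconservative form of \<open>ut\<close>.\<close>

lemma momentum_transport:
  "((\<lambda>\<tau>. fc (u \<tau>) n) has_vector_derivative fc (ut t) n) (at t)"
proof -
  let ?A = "\<lambda>t x. (q2 t + M2 t x) + \<phi>1 t x * (J1 t x * inverse (J t x))"
  have q2c: "continuous_on UNIV q2"
  proof -
    have "continuous_on UNIV (\<lambda>t. h t - M2 t (Y t (- q t)))"
      by (intro continuous_on_diff h jcont_compose[OF M_jcont(3)] jcont_compose[OF Y_jcont] continuous_intros q_cont)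
    then show ?thesis using q2_eq by (simp add: fun_eq_iff[symmetric])
  qed
  have A: "jcont ?A" "periodic1 (?A t)" for t
    by (intro jcont_add jcont_mult jcont_const_x q2c M_jcont \<phi>1_jcont J_jcont jcont_inverse J_nz)
      (use \<phi>1_per[of t] in \<open>simp add: periodic1_def M_per J_per\<close>)
  have der: "((\<lambda>t. \<phi>1 t x * J t x) has_real_derivative ?A t x * J t x) (at t)" for t x
  proof -
    have "((\<lambda>t. \<phi>1 t x) has_real_derivative q2 t + M2 t x) (at t)"
      unfolding \<phi>1_def by (intro DERIV_add q1_deriv M_deriv_t)
    from DERIV_mult[OF this M_deriv_t(3)[of x t]]
    have "((\<lambda>t. \<phi>1 t x * J t x) has_real_derivative (q2 t + M2 t x) * J t x + J1 t x * \<phi>1 t x) (at t)" .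
    moreover have "(q2 t + M2 t x) * J t x + J1 t x * \<phi>1 t x = ?A t x * J t x"
      using J_nz[of t x] by (simp add: distrib_right)
    ultimately show ?thesis by simp
  qed
  from fc_transport[OF \<phi>1_jcont \<phi>1_per A der, of n t]
  have T: "((\<lambda>\<tau>. fc (u \<tau>) n) has_vector_derivative
      fc (\<lambda>y. accel t y + u t y * ux t y) n - \<i> * of_real (2 * pi * real_of_int n) * fc (\<lambda>y. u t y * u t y) n) (at t)"
    unfolding u_\<phi>1 accel_def[symmetric] ux_def[symmetric] by simp
  have uux: "continuous_on UNIV (\<lambda>y. u t y * ux t y)" by (intro continuous_on_mult jcont_x u_jcont ux_jcont)
  have uuxi: "circle_integrable (\<lambda>y. u t y * ux t y)" by (rule circle_integrable_continuous[OF uux])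
  have acci: "circle_integrable (accel t)" using jcont_per_of_family[OF accel_family] by (intro circle_integrable_continuous jcont_x) blast
  have "ac_deriv (\<lambda>y. u t y * u t y) (\<lambda>y. 2 * (u t y * ux t y))"
    using ac_deriv_mult[OF u_ac[of t] u_ac[of t]] by (simp add: mult.commute)
  from fc_deriv[OF this _ circle_integrable_cmult[OF uuxi], of n]
  have "\<i> * of_real (2 * pi * real_of_int n) * fc (\<lambda>y. u t y * u t y) n = fc (\<lambda>y. 2 * (u t y * ux t y)) n"
    using u_per[of t] by (simp add: periodic1_def)
  also have "\<dots> = 2 * fc (\<lambda>y. u t y * ux t y) n" by (simp add: fc_cmult[OF uuxi])
  finally have X: "\<i> * of_real (2 * pi * real_of_int n) * fc (\<lambda>y. u t y * u t y) n = 2 * fc (\<lambda>y. u t y * ux t y) n" .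
  have Y: "fc (\<lambda>y. accel t y + u t y * ux t y) n = fc (accel t) n + fc (\<lambda>y. u t y * ux t y) n"
    by (rule fc_add[OF acci uuxi])
  have Z: "fc (ut t) n = fc (accel t) n + of_real (- 1) * fc (\<lambda>y. u t y * ux t y) n"
    unfolding ut_def[abs_def] fc_add[OF acci circle_integrable_cmult[OF uuxi]] fc_cmult[OF uuxi] ..
  have "fc (\<lambda>y. accel t y + u t y * ux t y) n - \<i> * of_real (2 * pi * real_of_int n) * fc (\<lambda>y. u t y * u t y) n = fc (ut t) n"
    unfolding X Y Z by simp
  then show ?thesis using T by simp
qed

text \<open>The density \<open>(\<rho>0 / J) J = \<rho>0\<close> is independent of time, so only the flux term remains.\<close>

lemma mass_transport:
  assumes w: "ac_deriv (\<lambda>y. \<rho> t y * u t y) w" "circle_integrable w"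
  shows "((\<lambda>\<tau>. fc (\<rho> \<tau>) n) has_vector_derivative fc (\<lambda>y. (- 1) * w y) n) (at t)"
proof -
  let ?F = "\<lambda>t x. \<rho>0 x * inverse (J t x)"
  have F: "jcont ?F" "periodic1 (?F t)" for t
    by (intro jcont_mult jcont_const_t \<rho>0_cont jcont_inverse J_jcont J_nz) (simp add: periodic1_def \<rho>0_per J_per)
  have Z: "jcont (\<lambda>t x. 0)" "periodic1 (\<lambda>x. 0)" by (auto intro: jcont_const_t simp: periodic1_def)
  have der: "((\<lambda>t. ?F t x * J t x) has_real_derivative 0 * J t x) (at t)" for t x
  proof -
    have e: "(\<lambda>t. ?F t x * J t x) = (\<lambda>t. \<rho>0 x)" using J_nz by (intro ext) simp
    show ?thesis unfolding e by simp
  qed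
  have per: "periodic1 (\<lambda>y. \<rho> t y * u t y)"
    using sob_family_periodic[OF \<rho>_family, of t] u_per[of t] by (simp add: periodic1_def)
  from fc_transport[OF F Z der, of n t]
  have "((\<lambda>\<tau>. fc (\<rho> \<tau>) n) has_vector_derivative fc (\<lambda>y. 0) n - \<i> * of_real (2 * pi * real_of_int n) * fc (\<lambda>y. u t y * \<rho> t y) n) (at t)"
    unfolding u_\<phi>1 \<rho>_def[symmetric] by simp
  moreover have "fc (\<lambda>y. 0) n = 0" using fc_cmult[OF circle_integrable_tw[of 0 0], of 0 n] by simp
  moreover have N: "fc (\<lambda>y. (- 1) * w y) n = of_real (- 1) * fc w n" by (rule fc_cmult[OF w(2)])
  ultimately show ?thesis unfolding N fc_deriv[OF w(1) per w(2)] by (simp add: mult.commute)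
qed

section \<open>The equations and the global solution\<close>

lemma deriv_u: "deriv (u t) x = ux t x" by (rule DERIV_imp_deriv[OF u_deriv])

lemma deriv_u0: "deriv u0 x = v0 x" by (rule DERIV_imp_deriv[OF u0_deriv])

lemma HS_const_eq: "HS_const 1 u0 \<rho>0 = - 2 * c\<^sup>2"
proof -
  have "(LINT x:{0..1}|lebesgue. 1 * (\<rho>0 x)\<^sup>2 + (deriv u0 x)\<^sup>2) = (LINT x:{0..1}|lebesgue. e0 x)"
    by (simp add: deriv_u0 e0_def add.commute)
  also have "\<dots> = integral {0..1} e0"
    by (rule set_lebesgue_integral_eq_integral(2)[OF abs_integrable_continuous[OF e0_cont]])
  finally show ?thesis by (simp add: HS_const_def four_c2[symmetric])
qed

text \<open>After division by \<open>J\<^sup>2\<close>, \<open>J_identity\<close> says that the integrand is \<open>(J2 / J) \<circ> g\<close>, the spatial derivative of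
the acceleration.\<close>

lemma momentum_equation:
  "ut t x + u t x * deriv (u t) x =
     antideriv (\<lambda>y. 1 / 2 * (\<rho> t y)\<^sup>2 + 1 / 2 * (deriv (u t) y)\<^sup>2 + HS_const 1 u0 \<rho>0) x + h t"
proof -
  let ?a = "\<lambda>y. J2 t (g t y) * inverse (J t (g t y))"
  have e: "1 / 2 * (\<rho> t y)\<^sup>2 + 1 / 2 * (deriv (u t) y)\<^sup>2 + HS_const 1 u0 \<rho>0 = ?a y" for y
  proof -
    let ?x = "g t y"
    have "1 / 2 * (\<rho> t y)\<^sup>2 + 1 / 2 * (deriv (u t) y)\<^sup>2 + HS_const 1 u0 \<rho>0
       = ((J1 t ?x)\<^sup>2 + (\<rho>0 ?x)\<^sup>2 - 4 * c\<^sup>2 * (J t ?x)\<^sup>2) / (2 * (J t ?x)\<^sup>2)"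
      using J_nz[of t ?x] by (simp add: HS_const_eq deriv_u \<rho>_def ux_def field_simps)
    also have "\<dots> = ?a y" unfolding J_identity[symmetric] using J_nz[of t ?x] by (simp add: field_simps power2_eq_square)
    finally show ?thesis .
  qed
  have ac: "continuous_on S ?a" for S
    using J_nz by (intro continuous_intros jcont_x[OF jcont_comp[OF J_jcont(3) g_jcont]] jcont_x[OF jcont_comp[OF J_jcont(1) g_jcont]]) auto
  have "(LBINT y=ereal 0..ereal x. ?a y) = accel t x - accel t 0"
    by (rule interval_integral_FTC_finite[OF ac])
      (use accel_deriv[of t] in \<open>auto simp: has_real_derivative_iff_has_vector_derivative intro: has_vector_derivative_at_within\<close>)
  then show ?thesis unfolding antideriv_def e by (simp add: ut_def deriv_u accel_eq)
qed

lemma mass_equation: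
  "\<exists>w. sob_family \<sigma> k w \<and> (\<forall>t. ac_deriv (\<lambda>y. \<rho> t y * u t y) (w t))"
proof -
  have "sob_family \<sigma> (Suc k) (\<lambda>t y. \<rho> t y * u t y)"
    by (rule sob_family_mult[OF \<sigma> \<rho>_family sob_family_Suc[OF u_family \<sigma>(1) \<sigma>1]])
  then show ?thesis by (rule sob_familyE) blast
qed

end

text \<open>This turns the chain of derivatives of a constant curve into one that is constant in time, so that
the derivative of \<open>u0\<close> is available as a fixed function.\<close>

lemma sob_family_freeze: "sob_family \<sigma> m F \<Longrightarrow> sob_family \<sigma> m (\<lambda>\<tau>. F t)"
proof (induction m arbitrary: F)
  case 0
  then show ?case by (simp add: sob_cont_const sob_contD(1))
next
  case (Suc m)
  from Suc.prems obtain F' where F': "sob_family \<sigma> m F'" "\<And>t. ac_deriv (F t) (F' t)" "\<And>t. periodic1 (F t)"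
    by (rule sob_familyE) blast
  show ?case by (rule sob_familyI[OF Suc.IH[OF F'(1)] F'(2,3) continuous_on_const])
qed

lemma ac_deriv_weak_deriv:
  assumes f: "ac_deriv f f'" "periodic1 f" and p: "periodic1 f'"
  shows "weak_deriv f f'"
  unfolding weak_deriv_def
proof (intro conjI allI impI p)
  show i: "f' absolutely_integrable_on {0..1}" by (rule ac_derivD(1)[OF f(1)])
  fix \<psi> assume \<psi>: "smooth_periodic \<psi>"
  have d: "((deriv ^^ n) \<psi> has_real_derivative (deriv ^^ Suc n) \<psi> x) (at x)" for n x
    using \<psi> by (simp add: smooth_periodic_def DERIV_deriv_iff_field_differentiable)
  have d0: "(\<psi> has_real_derivative deriv \<psi> x) (at x)" for x using d[of 0 x] by simp
  have d1: "continuous_on S (deriv \<psi>)" for S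
    using d[of 1] by (intro continuous_at_imp_continuous_on) (auto intro: DERIV_isCont)
  have \<psi>a: "ac_deriv \<psi> (deriv \<psi>)" by (rule ac_deriv_C1[OF d0 d1])
  have \<psi>p: "periodic1 \<psi>" using \<psi> by (simp add: smooth_periodic_def)
  have 1: "(LINT x:{0..1}|lebesgue. f x * deriv \<psi> x) = integral {0..1} (\<lambda>x. f x * deriv \<psi> x)"
    by (intro set_lebesgue_integral_eq_integral(2) abs_integrable_continuous continuous_on_mult ac_deriv_continuous[OF f(1)] d1)
  have 2: "(LINT x:{0..1}|lebesgue. f' x * \<psi> x) = integral {0..1} (\<lambda>x. f' x * \<psi> x)"
    by (intro set_lebesgue_integral_eq_integral(2) abs_integrable_mult_bounded(2) i ac_deriv_continuous[OF \<psi>a])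
  show "(LINT x:{0..1}|lebesgue. f x * deriv \<psi> x) = - (LINT x:{0..1}|lebesgue. f' x * \<psi> x)"
    unfolding 1 2 using ac_deriv_parts[OF f \<psi>a \<psi>p] by simp
qed

text \<open>Two cases of \<open>s\<close> arise because \<open>\<rho>\<^sub>t\<close> lies in
\<open>H\<^bsup>s-2\<^esup>\<close>, at level \<open>k\<close>: for \<open>s \<ge> 3\<close> it has a continuous representative as a derivative of positive
level, while for \<open>s = 2\<close> the space is \<open>L\<^sup>2\<close> and none is required.\<close>

theorem global_HS_solution:
  fixes h u0 \<rho>0 :: "real \<Rightarrow> real"
  assumes s: "s = 2 \<or> s \<ge> 3" and h: "continuous_on {0..} h"
    and u0: "u0 \<in> sobolev s" and \<rho>0: "\<rho>0 \<in> sobolev (s - 1)" and nz: "\<forall>x. \<rho>0 x \<noteq> 0"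
  shows "\<exists>u \<rho>. HS_solution 1 h s u0 \<rho>0 \<infinity> u \<rho>"
proof -
  define k where "k = nat \<lfloor>s\<rfloor> - 2"
  define \<sigma> where "\<sigma> = frac s"
  have fl: "\<lfloor>s\<rfloor> \<ge> 2" using s by (auto simp: le_floor_iff)
  have "int (Suc (Suc k)) = \<lfloor>s\<rfloor>" using fl unfolding k_def by linarith
  then have "real (Suc (Suc k)) = real_of_int \<lfloor>s\<rfloor>" by (metis of_int_of_nat_eq)
  then have sk: "s = real (Suc (Suc k)) + \<sigma>" by (simp add: \<sigma>_def frac_def)
  then have s1: "s - 1 = real (Suc k) + \<sigma>" and s2: "s - 2 = real k + \<sigma>" by simp_all
  have \<sigma>: "0 \<le> \<sigma>" "\<sigma> < 1" by (simp_all add: \<sigma>_def frac_lt_1)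
  have k: "k > 0 \<or> \<sigma> = 0"
  proof (cases "s = 2")
    case False
    then have "\<lfloor>s\<rfloor> \<ge> 3" using s by (simp add: le_floor_iff)
    then have "nat \<lfloor>s\<rfloor> > 2" by linarith
    then show ?thesis by (simp add: k_def)
  qed (simp add: \<sigma>_def)
  have "sob_family \<sigma> (Suc (Suc k)) (\<lambda>t. u0)" by (rule sobolev_sob_family[OF \<sigma>(1)]) (use u0 sk in simp)
  then obtain V :: "real \<Rightarrow> real \<Rightarrow> real" where V: "sob_family \<sigma> (Suc k) V" "\<And>t. ac_deriv u0 (V t)" "periodic1 u0"
    by (rule sob_familyE) blast
  define v0 where "v0 = V 0"
  have v0: "sob_family \<sigma> (Suc k) (\<lambda>t. v0)" "ac_deriv u0 v0"
    unfolding v0_def by (rule sob_family_freeze[OF V(1)], rule V(2))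
  have \<rho>0f: "sob_family \<sigma> (Suc k) (\<lambda>t. \<rho>0)" by (rule sobolev_sob_family[OF \<sigma>(1)]) (use \<rho>0 s1 in simp)
  (* An arbitrary continuous extension to negative times. *)
  define h' where "h' t = h (max 0 t)" for t
  have h': "continuous_on UNIV h'" unfolding h'_def[abs_def]
    by (rule continuous_on_compose2[OF h]) (auto intro!: continuous_intros)
  interpret hs_data \<sigma> k h' u0 v0 \<rho>0
    by unfold_locales (use \<sigma> h' v0 V(3) \<rho>0f nz in \<open>simp_all del: sob_family.simps\<close>)
  obtain w where w: "sob_family \<sigma> k w" "\<And>t. ac_deriv (\<lambda>y. \<rho> t y * u t y) (w t)" using mass_equation by blast
  have wc: "sob_cont (real k + \<sigma>) w" by (rule sob_family_sob_cont[OF \<sigma>(1) \<sigma>1 w(1)])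
  have wL: "L2fun (w t)" for t by (rule sob_contD(2)[OF wc])
  have w': "sob_family \<sigma> k (\<lambda>t x. (- 1) * w t x)"
    by (rule sob_family_time_mult[OF continuous_on_const \<sigma> w(1)])
  have per: "periodic1 (\<lambda>y. \<rho> t y * u t y)" for t
    using sob_family_periodic[OF \<rho>_family, of t] u_per[of t] by (simp add: periodic1_def)
  have C1u: "C1_in_sobolev \<infinity> (s - 1) u ut" unfolding s1
    by (rule sob_family_C1_in_sobolev[OF \<sigma>(1) \<sigma>1 sob_family_Suc[OF u_family \<sigma>(1) \<sigma>1] ut_family _ momentum_transport]) simp
  have C1\<rho>: "C1_in_sobolev \<infinity> (s - 2) \<rho> (\<lambda>t x. (- 1) * w t x)" unfolding s2
    by (rule sob_family_C1_in_sobolev[OF \<sigma>(1) \<sigma>1 sob_family_Suc[OF \<rho>_family \<sigma>(1) \<sigma>1] w' k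
          mass_transport[OF w(2) L2fun_circle_integrable[OF wL]]])
  have "HS_solution 1 h s u0 \<rho>0 \<infinity> u \<rho>"
    unfolding HS_solution_def
  proof (intro conjI u_initial \<rho>_initial)
    show "continuous_in_sobolev \<infinity> s u" unfolding sk
      by (rule sob_family_continuous_in_sobolev[OF \<sigma>(1) \<sigma>1 u_family]) simp
    show "continuous_in_sobolev \<infinity> (s - 1) \<rho>" unfolding s1
      by (rule sob_family_continuous_in_sobolev[OF \<sigma>(1) \<sigma>1 \<rho>_family]) simp
    show "\<exists>ut \<rho>t. C1_in_sobolev \<infinity> (s - 1) u ut \<and> C1_in_sobolev \<infinity> (s - 2) \<rho> \<rho>t
          \<and> (\<forall>t. 0 < t \<and> ereal t < \<infinity> \<longrightarrow>
               (\<forall>x. ut t x + u t x * deriv (u t) x =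
                  antideriv (\<lambda>y. 1 / 2 * (\<rho> t y)\<^sup>2 + 1 / 2 * (deriv (u t) y)\<^sup>2
                                 + HS_const 1 u0 \<rho>0) x + h t)
               \<and> (\<exists>w. weak_deriv (\<lambda>x. \<rho> t x * u t x) w
                      \<and> (AE x in lebesgue. \<rho>t t x + w x = 0)))"
    proof (rule exI[of _ ut], rule exI[of _ "\<lambda>t x. (- 1) * w t x"], intro conjI C1u C1\<rho> allI impI)
      fix t assume "0 < t \<and> ereal t < \<infinity>"
      then have "h' t = h t" by (simp add: h'_def)
      then show "ut t x + u t x * deriv (u t) x =
         antideriv (\<lambda>y. 1 / 2 * (\<rho> t y)\<^sup>2 + 1 / 2 * (deriv (u t) y)\<^sup>2 + HS_const 1 u0 \<rho>0) x + h t" for x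
        using momentum_equation[of t x] by simp
      have "periodic1 (w t)" using wL[of t] by (simp add: L2fun_def)
      then have "weak_deriv (\<lambda>x. \<rho> t x * u t x) (w t)" by (rule ac_deriv_weak_deriv[OF w(2) per])
      then show "\<exists>w'. weak_deriv (\<lambda>x. \<rho> t x * u t x) w' \<and> (AE x in lebesgue. (- 1) * w t x + w' x = 0)"
        by (intro exI[of _ "w t"]) simp
    qed
  qed
  then show ?thesis by blast
qed

theorem theorem5p1:
  fixes s :: real and h u0 \<rho>0 :: "real \<Rightarrow> real"
    and T :: ereal and u \<rho> :: "real \<Rightarrow> real \<Rightarrow> real"
  assumes "s = 2 \<or> s \<ge> 3"
    and "continuous_on {0..} h"
    and "u0 \<in> sobolev s" and "\<rho>0 \<in> sobolev (s - 1)"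
    and "maximal_HS_solution 1 h s u0 \<rho>0 T u \<rho>"
    and "\<forall>x. \<rho>0 x \<noteq> 0"
  shows "T = \<infinity>"
proof -
  obtain u' \<rho>' where "HS_solution 1 h s u0 \<rho>0 \<infinity> u' \<rho>'"
    using global_HS_solution[OF assms(1-4,6)] by blast
  then have "\<infinity> \<le> T" using assms(5) unfolding maximal_HS_solution_def by blast
  then show ?thesis by simp
qed

end
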